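(* Let $N\ge n$ and let $\mathbf Q\in\mathcal Q(N,r)$. Then $\mathsf G_\varepsilon(V_\varepsilon(\mathbf Q))\neq 0$ if and only if $\deg\mathbf Q\in\widetilde\Lambda(n,r)$, where $\widetilde\Lambda(n,r)=\{\widetilde\mu=(\mu_1,\dots,\mu_n,0,\dots,0)\mid \mu\in\Lambda(n,r)\}\subseteq\Lambda(N,r)$.
   Context: **Schur algebras.** Let $v$ be an indeterminate, $\mathcal Z=\mathbb C[v,v^{-1}]$, $\mathbb N=\{0,1,2,\dots\}$, $[c]_v=\frac{v^c-v^{-c}}{v-v^{-1}}$. Let $\varepsilon\in\mathbb C$ be a primitive $l'$-th root of $1$; $\mathbb C$ is a $\mathcal Z$-module via $v\mapsto\varepsilon$. Let $n\ge 2$, $r\ge 1$. The extended affine Hecke algebra $H_{\mathcal Z}=\mathcal H_\vartriangle(r)_{\mathcal Z}$ is the $\mathcal Z$-algebra generated by $T_i$ ($1\le i\le r-1$), $X_j^{\pm1}$ ($1\le j\le r$) with relations $(T_i+1)(T_i-v^2)=0$, $T_iT_{i+1}T_i=T_{i+1}T_iT_{i+1}$, $T_iT_j=T_jT_i$ ($|i-j|>1$), $X_iX_i^{-1}=1=X_i^{-1}X_i$, $X_iX_j=X_jX_i$, $T_iX_iT_i=v^2X_{i+1}$, $X_jT_i=T_iX_j$ ($j\ne i,i+1$). Let $\Omega_{\mathcal Z}$ be the free $\mathcal Z$-module with basis $\{\omega_i\mid i\in\mathbb Z\}$, and $\omega_{\mathbf i}=\omega_{i_1}\otimes\cdots\otimes\omega_{i_r}$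 for $\mathbf i\in\mathbb Z^r$. $\Omega_{\mathcal Z}^{\otimes r}$ is a right $H_{\mathcal Z}$-module: $\omega_{\mathbf i}X_t^{-1}$ is obtained from $\omega_{\mathbf i}$ by replacing $i_t$ with $i_t+n$ (all $\mathbf i\in\mathbb Z^r$), and for $\mathbf i$ with all $1\le i_k\le n$, $\omega_{\mathbf i}T_k=v^2\omega_{\mathbf i}$ if $i_k=i_{k+1}$; $=v\,\omega_{\mathbf is_k}$ if $i_k<i_{k+1}$; $=v\,\omega_{\mathbf is_k}+(v^2-1)\omega_{\mathbf i}$ if $i_{k+1}<i_k$, where $\mathbf is_k$ swaps the $k$-th and $(k+1)$-st entries. The affine quantum Schur algebra is $\mathcal S_\vartriangle(n,r)_{\mathcal Z}=\mathrm{End}_{H_{\mathcal Z}}(\Omega_{\mathcal Z}^{\otimes r})$; $\mathcal S_\vartriangle(n,r)_v=\mathcal S_\vartriangle(n,r)_{\mathcal Z}\otimes_{\mathcal Z}\mathbb C(v)$, $\mathcal S_\vartriangle(n,r)_\varepsilon=\mathcal S_\vartriangle(n,r)_{\mathcal Z}\otimes_{\mathcal Z}\mathbb C$, $\Omega_v=\Omega_{\mathcal Z}\otimes_{\mathcal Z}\mathbb C(v)$. Elements of $\mathcal S_\vartriangle(n,r)_{\mathcal Z}$ and their images in $\mathcal S_\vartriangle(n,r)_\varepsilon$ are denoted alike. For an algebra $B$, $B\text{-}\mathsf{mod}$ is the category of finite dimensional left $B$-modules. **Quantum affine $\mathfrak{gl}_n$.** $U_v(\widehat{\mathfrak{gl}}_n)$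 is the $\mathbb C(v)$-algebra generated by $x^\pm_{i,s}$ ($1\le i<n$, $s\in\mathbb Z$), $k_i^{\pm1}$, $g_{i,t}$ ($1\le i\le n$, $t\in\mathbb Z\setminus\{0\}$), with relations (where $[x,y]_a=xy-ayx$, $[x,y]=[x,y]_1$): $k_ik_i^{-1}=1=k_i^{-1}k_i$, $[k_i,k_j]=0$; $k_ix^\pm_{j,s}=v^{\pm(\delta_{i,j}-\delta_{i,j+1})}x^\pm_{j,s}k_i$, $[k_i,g_{j,s}]=0$; $[g_{i,s},x^\pm_{j,t}]$ equals $0$ if $i\ne j,j+1$, $\pm v^{-js}\frac{[s]_v}{s}x^\pm_{j,s+t}$ if $i=j$, $\mp v^{-js}\frac{[s]_v}{s}x^\pm_{j,s+t}$ if $i=j+1$; $[g_{i,s},g_{j,t}]=0$; $[x^+_{i,s},x^-_{j,t}]=\delta_{i,j}\frac{\phi^+_{i,s+t}-\phi^-_{i,s+t}}{v-v^{-1}}$; $x^\pm_{i,s}x^\pm_{j,t}=x^\pm_{j,t}x^\pm_{i,s}$ for $|i-j|>1$; $[x^\pm_{i,s+1},x^\pm_{j,t}]_{v^{\pm c_{ij}}}=-[x^\pm_{j,t+1},x^\pm_{i,s}]_{v^{\pm c_{ij}}}$ ($(c_{ij})$ the Cartan matrix of type $A_{n-1}$); $[x^\pm_{i,s},[x^\pm_{j,t},x^\pm_{i,p}]_v]_v=-[x^\pm_{i,p},[x^\pm_{j,t},x^\pm_{i,s}]_v]_v$ for $|i-j|=1$. Here $\tilde k_i^{\pm1}\exp\bigl(\pm(v-v^{-1})\sum_{m\ge1}h_{i,\pm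 m}u^{\pm m}\bigr)=\sum_{s\ge0}\phi^\pm_{i,\pm s}u^{\pm s}$ (other $\phi^\pm_{i,s}$ being $0$), $\tilde k_i=k_ik_{i+1}^{-1}$ ($k_{n+1}=k_1$), $h_{i,\pm m}=v^{\pm(i-1)m}g_{i,\pm m}-v^{\pm(i+1)m}g_{i+1,\pm m}$ ($1\le i<n$). Put $E_j=x^+_{j,0}$, $F_j=x^-_{j,0}$ ($1\le j<n$), $E_n=v[x^-_{n-1,0},[x^-_{n-2,0},\cdots,[x^-_{2,0},x^-_{1,1}]_{v^{-1}}\cdots]_{v^{-1}}]_{v^{-1}}\tilde k_n$, $F_n=v^{-1}\tilde k_n^{-1}[\cdots[[x^+_{1,-1},x^+_{2,0}]_v,x^+_{3,0}]_v,\cdots,x^+_{n-1,0}]_v$, $z_s^\pm=sv^{\pm s}\frac1{[s]_v}(g_{1,\pm s}+\cdots+g_{n,\pm s})$ ($s\ge1$); these and $k_i^{\pm1}$ generate, and $U_v(\widehat{\mathfrak{gl}}_n)$ is a Hopf algebra with $\Delta(E_i)=E_i\otimes\tilde k_i+1\otimes E_i$, $\Delta(F_i)=F_i\otimes1+\tilde k_i^{-1}\otimes F_i$, $\Delta(k_i^{\pm1})=k_i^{\pm1}\otimes k_i^{\pm1}$, $\Delta(z_s^\pm)=z_s^\pm\otimes1+1\otimes z_s^\pm$. It acts on $\Omega_v$ by $E_i\omega_s=\delta_{\overline{i+1},\bar s}\omega_{s-1}$, $F_i\omega_s=\delta_{\bar i,\bar s}\omega_{s+1}$, $k_i^{\pm1}\omega_s=v^{\pm\delta_{\bar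 i,\bar s}}\omega_s$, $z_t^\pm\omega_s=\omega_{s\mp tn}$ (bars: residues mod $n$), hence on $\Omega_v^{\otimes r}$, commuting with the Hecke algebra; this gives a (surjective) homomorphism $\zeta_r:U_v(\widehat{\mathfrak{gl}}_n)\to\mathcal S_\vartriangle(n,r)_v$. **Idempotents.** $\Lambda(n,r)=\{\lambda\in\mathbb N^n\mid\sum_i\lambda_i=r\}$. For $\lambda\in\Lambda(n,r)$, $\mathfrak l_\lambda=\prod_{i=1}^n\zeta_r\bigl(\bigl[{k_i;0\atop\lambda_i}\bigr]\bigr)\in\mathcal S_\vartriangle(n,r)_{\mathcal Z}$, where $\bigl[{k_i;0\atop t}\bigr]=\prod_{s=1}^t\frac{k_iv^{-s+1}-k_i^{-1}v^{s-1}}{v^s-v^{-s}}$. The $\mathfrak l_\lambda$ are orthogonal idempotents with sum $1$. **Modules.** $\mathcal Q(n)$ is the set of $n$-tuples $\mathbf Q=(Q_1(u),\dots,Q_n(u))$ of polynomials in $\mathbb C(v)[u]$ with constant term $1$ such that $Q_n(uv^{n-1})\in\mathbb C[u]$ and $Q_i(v^{i-1}u)/Q_{i+1}(v^{i+1}u)\in\mathbb C[u]$ for $1\le i\le n-1$; $\deg\mathbf Q=(\deg Q_1,\dots,\deg Q_n)$; $\mathcal Q(n,r)=\{\mathbf Q\in\mathcal Q(n)\mid\sum_i\deg Q_i=r\}$. For $g(u)=\prod_i(1-a_iu)$ put $g^\pm(u)=\prod_i(1-a_i^{\pm1}u^{\pm1})$. Define $Q_{i,s}\in\mathbb C(v)$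 by $Q_i^\pm(u)=\sum_{s\ge0}Q_{i,\pm s}u^{\pm s}$, and $\mathscr Q_{i,s}\in U_v(\widehat{\mathfrak{gl}}_n)$ by $\exp\bigl(-\sum_{t\ge1}\frac1{[t]_v}g_{i,\pm t}(vu)^{\pm t}\bigr)=\sum_{s\ge0}\mathscr Q_{i,\pm s}u^{\pm s}$. For $\mathbf Q\in\mathcal Q(n)$, $M(\mathbf Q)$ is the quotient of $U_v(\widehat{\mathfrak{gl}}_n)$ by the left ideal generated by $x^+_{j,s}$, $\mathscr Q_{i,s}-Q_{i,s}$, $k_i-v^{\deg Q_i}$ ($1\le j\le n-1$, $1\le i\le n$, $s\in\mathbb Z$), and $L(\mathbf Q)$ is its unique irreducible quotient (finite dimensional). For $\mathbf Q\in\mathcal Q(n,r)$, $L(\mathbf Q)$ is an irreducible $\mathcal S_\vartriangle(n,r)_v$-module via $\zeta_r$; with $\lambda=\deg\mathbf Q$, $\mathfrak l_\lambda L(\mathbf Q)$ is one dimensional; fix $0\ne w_{\mathbf Q}\in\mathfrak l_\lambda L(\mathbf Q)$ and put $L_{\mathcal Z}(\mathbf Q)=\mathcal S_\vartriangle(n,r)_{\mathcal Z}w_{\mathbf Q}$, $L_\varepsilon(\mathbf Q)=L_{\mathcal Z}(\mathbf Q)\otimes_{\mathcal Z}\mathbb C$. $V_\varepsilon(\mathbf Q)$ is the unique irreducible quotient $\mathcal S_\vartriangle(n,r)_\varepsilon$-module of $L_\varepsilon(\mathbf Q)$. The same constructions apply with $N$ in place of $n$. **The functor.** Let $N\ge n$.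 For $\mu\in\Lambda(n,r)$ let $\widetilde\mu=(\mu_1,\dots,\mu_n,0,\dots,0)\in\Lambda(N,r)$, and $e=\sum_{\mu\in\Lambda(n,r)}\mathfrak l_{\widetilde\mu}\in\mathcal S_\vartriangle(N,r)_{\mathcal Z}$. Identify $e\,\mathcal S_\vartriangle(N,r)\,e$ with $\mathcal S_\vartriangle(n,r)$ (over $\mathcal Z$, $\mathbb C(v)$, or at $\varepsilon$) by the natural isomorphism induced by the Hecke-module isomorphism from the tensor space for $n$ onto $e$ times the tensor space for $N$, given on factors by $\omega_{j+an}\mapsto\omega_{j+aN}$ ($1\le j\le n$, $a\in\mathbb Z$). Then $\mathsf G_\varepsilon:\mathcal S_\vartriangle(N,r)_\varepsilon\text{-}\mathsf{mod}\to\mathcal S_\vartriangle(n,r)_\varepsilon\text{-}\mathsf{mod}$ is $V\mapsto eV$. *)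

theory Defs
  imports
    "HOL-Algebra.QuotRing"
    "HOL-Algebra.Module"
    "HOL-Library.Poly_Mapping"
    "HOL-Computational_Algebra.Computational_Algebra"
begin

hide_const (open) Multiset.mult Polynomial.smult

section \<open>Coefficients\<close>

text \<open>\<open>\<int>\<close>-indexed finitely supported coefficient families with the convolution product are
  the Laurent polynomials \<open>\<Z> = \<complex>[v, v\<^sup>-\<^sup>1]\<close>.\<close>

type_synonym laurent = "int \<Rightarrow>\<^sub>0 complex"
type_synonym ratfun = "complex poly fract"

definition lv :: laurent where
  "lv = Poly_Mapping.single 1 1"

definition cst :: "complex \<Rightarrow> ratfun" where
  "cst c = to_fract [:c:]"

definition qv :: ratfun where
  "qv = to_fract [:0, 1:]"

definition laurent_to_ratfun :: "laurent \<Rightarrow> ratfun" where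
  "laurent_to_ratfun p = (\<Sum>k\<in>Poly_Mapping.keys p. cst (Poly_Mapping.lookup p k) * qv powi k)"

definition laurent_at :: "complex \<Rightarrow> laurent \<Rightarrow> complex" where
  "laurent_at \<epsilon> p = (\<Sum>k\<in>Poly_Mapping.keys p. Poly_Mapping.lookup p k * \<epsilon> powi k)"

definition primitive_root_of_unity :: "nat \<Rightarrow> complex \<Rightarrow> bool" where
  "primitive_root_of_unity l \<epsilon> \<longleftrightarrow> 0 < l \<and> \<epsilon> ^ l = 1 \<and> (\<forall>k. 0 < k \<and> k < l \<longrightarrow> \<epsilon> ^ k \<noteq> 1)"

definition qint :: "int \<Rightarrow> ratfun" where
  "qint c = (qv powi c - qv powi (- c)) / (qv - inverse qv)"


section \<open>Modules over not necessarily commutative rings\<close>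

text \<open>Modules use the record \<^typ>\<open>('a, 'b) module\<close>; its ring multiplication is meaningful only
  when the record describes an algebra, and is left undefined otherwise.\<close>

locale left_module = R?: ring R + M?: abelian_group M for R (structure) and M (structure) +
  assumes smult_closed:
      "\<lbrakk>a \<in> carrier R; x \<in> carrier M\<rbrakk> \<Longrightarrow> a \<odot>\<^bsub>M\<^esub> x \<in> carrier M"
    and smult_l_distr:
      "\<lbrakk>a \<in> carrier R; b \<in> carrier R; x \<in> carrier M\<rbrakk> \<Longrightarrow>
        (a \<oplus> b) \<odot>\<^bsub>M\<^esub> x = a \<odot>\<^bsub>M\<^esub> x \<oplus>\<^bsub>M\<^esub> b \<odot>\<^bsub>M\<^esub> x"
    and smult_r_distr:
      "\<lbrakk>a \<in> carrier R; x \<in> carrier M; y \<in> carrier M\<rbrakk> \<Longrightarrow>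
        a \<odot>\<^bsub>M\<^esub> (x \<oplus>\<^bsub>M\<^esub> y) = a \<odot>\<^bsub>M\<^esub> x \<oplus>\<^bsub>M\<^esub> a \<odot>\<^bsub>M\<^esub> y"
    and smult_assoc:
      "\<lbrakk>a \<in> carrier R; b \<in> carrier R; x \<in> carrier M\<rbrakk> \<Longrightarrow>
        (a \<otimes> b) \<odot>\<^bsub>M\<^esub> x = a \<odot>\<^bsub>M\<^esub> (b \<odot>\<^bsub>M\<^esub> x)"
    and smult_one: "x \<in> carrier M \<Longrightarrow> \<one> \<odot>\<^bsub>M\<^esub> x = x"

definition quot_module :: "('a, 'm) module \<Rightarrow> 'm set \<Rightarrow> ('a, 'm set) module" where
  "quot_module M K =
    \<lparr>carrier = a_rcosets\<^bsub>M\<^esub> K, mult = undefined, one = undefined, zero = K, add = set_add M,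
     smult = (\<lambda>a X. \<Union>x\<in>X. K +>\<^bsub>M\<^esub> (a \<odot>\<^bsub>M\<^esub> x))\<rparr>"

definition simple_module :: "('a, 'c) ring_scheme \<Rightarrow> ('a, 'm) module \<Rightarrow> bool" where
  "simple_module R M \<longleftrightarrow> left_module R M \<and> carrier M \<noteq> {\<zero>\<^bsub>M\<^esub>} \<and>
     (\<forall>K. submodule K R M \<longrightarrow> K = {\<zero>\<^bsub>M\<^esub>} \<or> K = carrier M)"

definition irreducible_quotient ::
  "('a, 'c) ring_scheme \<Rightarrow> ('a, 'm) module \<Rightarrow> ('a, 'm set) module \<Rightarrow> bool" where
  "irreducible_quotient R M L \<longleftrightarrow>
     (\<exists>K. submodule K R M \<and> L = quot_module M K \<and> simple_module R L)"

definition regular_module :: "('a, 'c) ring_scheme \<Rightarrow> ('a, 'a) module" where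
  "regular_module R =
    \<lparr>carrier = carrier R, mult = undefined, one = undefined, zero = \<zero>\<^bsub>R\<^esub>, add = add R,
     smult = mult R\<rparr>"

definition left_ideal_gen :: "('a, 'c) ring_scheme \<Rightarrow> 'a set \<Rightarrow> 'a set" where
  "left_ideal_gen R S = \<Inter>{I. submodule I R (regular_module R) \<and> S \<subseteq> I}"

definition right_module ::
  "('k, 'h) module \<Rightarrow> ('k, 'm) module \<Rightarrow> ('m \<Rightarrow> 'h \<Rightarrow> 'm) \<Rightarrow> bool" where
  "right_module H M act \<longleftrightarrow> ring H \<and> abelian_group M \<and>
     (\<forall>x\<in>carrier M. \<forall>h\<in>carrier H. act x h \<in> carrier M) \<and>
     (\<forall>x\<in>carrier M. \<forall>y\<in>carrier M. \<forall>h\<in>carrier H. act (x \<oplus>\<^bsub>M\<^esub> y) h = act x h \<oplus>\<^bsub>M\<^esub> act y h) \<and>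
     (\<forall>x\<in>carrier M. \<forall>g\<in>carrier H. \<forall>h\<in>carrier H. act x (g \<oplus>\<^bsub>H\<^esub> h) = act x g \<oplus>\<^bsub>M\<^esub> act x h) \<and>
     (\<forall>x\<in>carrier M. \<forall>g\<in>carrier H. \<forall>h\<in>carrier H. act x (g \<otimes>\<^bsub>H\<^esub> h) = act (act x g) h) \<and>
     (\<forall>x\<in>carrier M. act x \<one>\<^bsub>H\<^esub> = x) \<and>
     (\<forall>x\<in>carrier M. \<forall>h\<in>carrier H. \<forall>c.
        act (c \<odot>\<^bsub>M\<^esub> x) h = c \<odot>\<^bsub>M\<^esub> act x h \<and> act x (c \<odot>\<^bsub>H\<^esub> h) = c \<odot>\<^bsub>M\<^esub> act x h)"


section \<open>Extension of scalars\<close>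

text \<open>For a module \<open>M\<close> over a commutative ring and a homomorphism \<open>h\<close> into \<open>'k\<close>, the tensor product
  of \<open>M\<close> with \<open>'k\<close> is the free \<open>'k\<close>-module on the symbols \<open>x \<otimes> 1\<close> (\<open>x\<close> in \<open>M\<close>) modulo the
  \<open>'k\<close>-span of the relations below; \<open>x \<otimes> c\<close> is the class of \<open>Poly_Mapping.single x c\<close>.\<close>

definition pm_scale :: "'k \<Rightarrow> ('a \<Rightarrow>\<^sub>0 'k) \<Rightarrow> ('a \<Rightarrow>\<^sub>0 'k::comm_ring_1)" where
  "pm_scale c = Poly_Mapping.map (\<lambda>x. c * x)"

inductive_set tensor_null :: "('z \<Rightarrow> 'k::comm_ring_1) \<Rightarrow> ('z, 'm) module \<Rightarrow> ('m \<Rightarrow>\<^sub>0 'k) set"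
  for h :: "'z \<Rightarrow> 'k" and M :: "('z, 'm) module" where
  null_zero: "0 \<in> tensor_null h M"
| null_add: "p \<in> tensor_null h M \<Longrightarrow> q \<in> tensor_null h M \<Longrightarrow> p + q \<in> tensor_null h M"
| null_scale: "p \<in> tensor_null h M \<Longrightarrow> pm_scale c p \<in> tensor_null h M"
| rel_add: "x \<in> carrier M \<Longrightarrow> y \<in> carrier M \<Longrightarrow>
    Poly_Mapping.single (x \<oplus>\<^bsub>M\<^esub> y) 1 - Poly_Mapping.single x 1 - Poly_Mapping.single y 1
      \<in> tensor_null h M"
| rel_smult: "x \<in> carrier M \<Longrightarrow>
    Poly_Mapping.single (a \<odot>\<^bsub>M\<^esub> x) 1 - Poly_Mapping.single x (h a) \<in> tensor_null h M"

definition tensor_class ::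
  "('z \<Rightarrow> 'k::comm_ring_1) \<Rightarrow> ('z, 'm) module \<Rightarrow> ('m \<Rightarrow>\<^sub>0 'k) \<Rightarrow> ('m \<Rightarrow>\<^sub>0 'k) set" where
  "tensor_class h M p = {q. Poly_Mapping.keys q \<subseteq> carrier M \<and> q - p \<in> tensor_null h M}"

definition tensor_one ::
  "('z \<Rightarrow> 'k::comm_ring_1) \<Rightarrow> ('z, 'm) module \<Rightarrow> 'm \<Rightarrow> ('m \<Rightarrow>\<^sub>0 'k) set" where
  "tensor_one h M x = tensor_class h M (Poly_Mapping.single x 1)"

definition bilinear_ext ::
  "('a \<Rightarrow> 'b \<Rightarrow> 'c) \<Rightarrow> ('a \<Rightarrow>\<^sub>0 'k) \<Rightarrow> ('b \<Rightarrow>\<^sub>0 'k) \<Rightarrow> ('c \<Rightarrow>\<^sub>0 'k::comm_ring_1)" where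
  "bilinear_ext f p q = (\<Sum>a\<in>Poly_Mapping.keys p. \<Sum>b\<in>Poly_Mapping.keys q.
     Poly_Mapping.single (f a b) (Poly_Mapping.lookup p a * Poly_Mapping.lookup q b))"

definition tensor_algebra ::
  "('z \<Rightarrow> 'k::comm_ring_1) \<Rightarrow> ('z, 'a) module \<Rightarrow> ('k, ('a \<Rightarrow>\<^sub>0 'k) set) module" where
  "tensor_algebra h A =
    \<lparr>carrier = {tensor_class h A p | p. Poly_Mapping.keys p \<subseteq> carrier A},
     mult = (\<lambda>P Q. \<Union>p\<in>P. \<Union>q\<in>Q. tensor_class h A (bilinear_ext (mult A) p q)),
     one = tensor_one h A \<one>\<^bsub>A\<^esub>,
     zero = tensor_class h A 0,
     add = (\<lambda>P Q. \<Union>p\<in>P. \<Union>q\<in>Q. tensor_class h A (p + q)),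
     smult = (\<lambda>c P. \<Union>p\<in>P. tensor_class h A (pm_scale c p))\<rparr>"

definition restrict_to_base :: "('z, 'a) module \<Rightarrow> ('a, 'm) module \<Rightarrow> ('z, 'm) module" where
  "restrict_to_base A M =
    \<lparr>carrier = carrier M, mult = undefined, one = undefined, zero = \<zero>\<^bsub>M\<^esub>, add = add M,
     smult = (\<lambda>a x. (a \<odot>\<^bsub>A\<^esub> \<one>\<^bsub>A\<^esub>) \<odot>\<^bsub>M\<^esub> x)\<rparr>"

text \<open>For an \<open>A\<close>-module \<open>M\<close>, the extension of scalars of \<open>M\<close> as a module over that of \<open>A\<close>.\<close>

definition tensor_module ::
  "('z \<Rightarrow> 'k::comm_ring_1) \<Rightarrow> ('z, 'a) module \<Rightarrow> ('a, 'm) module \<Rightarrow>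
     (('a \<Rightarrow>\<^sub>0 'k) set, ('m \<Rightarrow>\<^sub>0 'k) set) module" where
  "tensor_module h A M = (let B = restrict_to_base A M in
    \<lparr>carrier = {tensor_class h B p | p. Poly_Mapping.keys p \<subseteq> carrier M},
     mult = undefined, one = undefined,
     zero = tensor_class h B 0,
     add = (\<lambda>X Y. \<Union>p\<in>X. \<Union>q\<in>Y. tensor_class h B (p + q)),
     smult = (\<lambda>P X. \<Union>p\<in>P. \<Union>x\<in>X. tensor_class h B (bilinear_ext (smult M) p x))\<rparr>)"


section \<open>Algebras given by generators and relations\<close>

text \<open>With lists as a monoid under concatenation, \<open>'g list \<Rightarrow>\<^sub>0 'k\<close> is the free associative
  \<open>'k\<close>-algebra on \<open>'g\<close>. For \<open>'g = int\<close> it is also used as the tensor algebra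
  of the free module with basis \<open>(\<omega>\<^sub>s)\<close>.\<close>

instantiation list :: (type) monoid_add
begin
definition zero_list_def: "0 = []"
definition plus_list_def: "xs + ys = xs @ ys"
instance by standard (simp_all add: zero_list_def plus_list_def)
end

definition gen :: "'g \<Rightarrow> ('g list \<Rightarrow>\<^sub>0 'k::comm_ring_1)" where
  "gen g = Poly_Mapping.single [g] 1"

definition scal :: "'k \<Rightarrow> ('g list \<Rightarrow>\<^sub>0 'k::comm_ring_1)" where
  "scal c = Poly_Mapping.single [] c"

definition free_algebra :: "'g set \<Rightarrow> ('g list \<Rightarrow>\<^sub>0 'k::comm_ring_1) ring" where
  "free_algebra G =
    \<lparr>carrier = {p. \<forall>w\<in>Poly_Mapping.keys p. set w \<subseteq> G}, mult = (*), one = 1, zero = 0, add = (+)\<rparr>"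

definition pres_class ::
  "'g set \<Rightarrow> ('g list \<Rightarrow>\<^sub>0 'k) set \<Rightarrow> ('g list \<Rightarrow>\<^sub>0 'k) \<Rightarrow> ('g list \<Rightarrow>\<^sub>0 'k::comm_ring_1) set" where
  "pres_class G Rel p = Idl\<^bsub>free_algebra G\<^esub> Rel +>\<^bsub>free_algebra G\<^esub> p"

definition presented_algebra ::
  "'g set \<Rightarrow> ('g list \<Rightarrow>\<^sub>0 'k) set \<Rightarrow> ('k, ('g list \<Rightarrow>\<^sub>0 'k::comm_ring_1) set) module" where
  "presented_algebra G Rel = (let B = free_algebra G Quot (Idl\<^bsub>free_algebra G\<^esub> Rel) in
    \<lparr>carrier = carrier B, mult = mult B, one = one B, zero = zero B, add = add B,
     smult = (\<lambda>c X. pres_class G Rel (scal c) \<otimes>\<^bsub>B\<^esub> X)\<rparr>)"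


section \<open>The extended affine Hecke algebra and the tensor space\<close>

datatype hecke_gen = T nat | X nat | X_inv nat

definition hecke_gens :: "nat \<Rightarrow> hecke_gen set" where
  "hecke_gens r = {T i | i. 1 \<le> i \<and> i < r} \<union> {X j | j. 1 \<le> j \<and> j \<le> r} \<union> {X_inv j | j. 1 \<le> j \<and> j \<le> r}"

text \<open>A relation \<open>a = b\<close> is recorded as \<open>a - b\<close>.\<close>

definition hecke_rels :: "nat \<Rightarrow> (hecke_gen list \<Rightarrow>\<^sub>0 laurent) set" where
  "hecke_rels r =
     {(gen (T i) + 1) * (gen (T i) - scal (lv ^ 2)) | i. 1 \<le> i \<and> i < r}
   \<union> {gen (T i) * gen (T (i + 1)) * gen (T i) - gen (T (i + 1)) * gen (T i) * gen (T (i + 1))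
       | i. 1 \<le> i \<and> i + 1 < r}
   \<union> {gen (T i) * gen (T j) - gen (T j) * gen (T i)
       | i j. 1 \<le> i \<and> i < r \<and> 1 \<le> j \<and> j < r \<and> (i + 1 < j \<or> j + 1 < i)}
   \<union> {gen (X i) * gen (X_inv i) - 1 | i. 1 \<le> i \<and> i \<le> r}
   \<union> {gen (X_inv i) * gen (X i) - 1 | i. 1 \<le> i \<and> i \<le> r}
   \<union> {gen (X i) * gen (X j) - gen (X j) * gen (X i) | i j. 1 \<le> i \<and> i \<le> r \<and> 1 \<le> j \<and> j \<le> r}
   \<union> {gen (T i) * gen (X i) * gen (T i) - scal (lv ^ 2) * gen (X (i + 1)) | i. 1 \<le> i \<and> i < r}
   \<union> {gen (X j) * gen (T i) - gen (T i) * gen (X j)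
       | i j. 1 \<le> i \<and> i < r \<and> 1 \<le> j \<and> j \<le> r \<and> j \<noteq> i \<and> j \<noteq> i + 1}"

definition hecke :: "nat \<Rightarrow> (laurent, (hecke_gen list \<Rightarrow>\<^sub>0 laurent) set) module" where
  "hecke r = presented_algebra (hecke_gens r) (hecke_rels r)"

definition hecke_elt :: "nat \<Rightarrow> hecke_gen \<Rightarrow> (hecke_gen list \<Rightarrow>\<^sub>0 laurent) set" where
  "hecke_elt r g = pres_class (hecke_gens r) (hecke_rels r) (gen g)"

text \<open>\<open>\<omega>\<^sub>i = \<omega>\<^bsub>i\<^sub>1\<^esub> \<otimes> \<dots> \<otimes> \<omega>\<^bsub>i\<^sub>r\<^esub>\<close> for a list \<open>i\<close> of length \<open>r\<close>; the entry \<open>i\<^sub>t\<close> is \<open>i ! (t - 1)\<close>.\<close>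

definition om :: "int list \<Rightarrow> (int list \<Rightarrow>\<^sub>0 'k::comm_ring_1)" where
  "om w = Poly_Mapping.single w 1"

definition tensor_space :: "nat \<Rightarrow> ('k::comm_ring_1, int list \<Rightarrow>\<^sub>0 'k) module" where
  "tensor_space r =
    \<lparr>carrier = {x. \<forall>w\<in>Poly_Mapping.keys x. length w = r}, mult = undefined, one = undefined,
     zero = 0, add = (+), smult = pm_scale\<rparr>"

text \<open>The right Hecke module structure on the tensor space for \<open>n\<close>. The formulas determine it:
  the \<open>\<omega>\<^sub>i\<close> with entries in \<open>{1..n}\<close> generate under the \<open>X\<^sub>t\<close>, and the Hecke relations move
  \<open>T\<^sub>k\<close> past the \<open>X\<^sub>t\<close>.\<close>

definition hecke_action ::
  "nat \<Rightarrow> nat \<Rightarrow>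
   ((int list \<Rightarrow>\<^sub>0 laurent) \<Rightarrow> (hecke_gen list \<Rightarrow>\<^sub>0 laurent) set \<Rightarrow> (int list \<Rightarrow>\<^sub>0 laurent)) \<Rightarrow> bool" where
  "hecke_action n r act \<longleftrightarrow>
     right_module (hecke r) (tensor_space r) act \<and>
     (\<forall>w t. length w = r \<and> 1 \<le> t \<and> t \<le> r \<longrightarrow>
        act (om w) (hecke_elt r (X_inv t)) = om (w[t - 1 := w ! (t - 1) + int n])) \<and>
     (\<forall>w k. length w = r \<and> set w \<subseteq> {1..int n} \<and> 1 \<le> k \<and> k < r \<longrightarrow>
        act (om w) (hecke_elt r (T k)) =
          (let a = w ! (k - 1); b = w ! k; w' = w[k - 1 := b, k := a] in
           if a = b then pm_scale (lv ^ 2) (om w)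
           else if a < b then pm_scale lv (om w')
           else pm_scale lv (om w') + pm_scale (lv ^ 2 - 1) (om w)))"


section \<open>Affine quantum Schur algebras\<close>

type_synonym endo = "(int list \<Rightarrow>\<^sub>0 laurent) \<Rightarrow> (int list \<Rightarrow>\<^sub>0 laurent)"
type_synonym hecke_act =
  "(int list \<Rightarrow>\<^sub>0 laurent) \<Rightarrow> (hecke_gen list \<Rightarrow>\<^sub>0 laurent) set \<Rightarrow> (int list \<Rightarrow>\<^sub>0 laurent)"

text \<open>The endomorphism algebra of the right module \<open>act\<close>; \<open>n\<close> enters through \<open>act\<close> only.\<close>

definition schur :: "nat \<Rightarrow> hecke_act \<Rightarrow> (laurent, endo) module" where
  "schur r act = (let \<Omega> = carrier (tensor_space r) in
    \<lparr>carrier = {f \<in> \<Omega> \<rightarrow>\<^sub>E \<Omega>. (\<forall>x\<in>\<Omega>. \<forall>y\<in>\<Omega>. f (x + y) = f x + f y) \<and>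
       (\<forall>x\<in>\<Omega>. \<forall>h\<in>carrier (hecke r). f (act x h) = act (f x) h)},
     mult = compose \<Omega>, one = (\<lambda>x\<in>\<Omega>. x), zero = (\<lambda>x\<in>\<Omega>. 0),
     add = (\<lambda>f g. \<lambda>x\<in>\<Omega>. f x + g x),
     smult = (\<lambda>c f. \<lambda>x\<in>\<Omega>. pm_scale c (f x))\<rparr>)"

definition schur_v :: "nat \<Rightarrow> hecke_act \<Rightarrow> (ratfun, (endo \<Rightarrow>\<^sub>0 ratfun) set) module" where
  "schur_v r act = tensor_algebra laurent_to_ratfun (schur r act)"

definition schur_at ::
  "complex \<Rightarrow> nat \<Rightarrow> hecke_act \<Rightarrow> (complex, (endo \<Rightarrow>\<^sub>0 complex) set) module" where
  "schur_at \<epsilon> r act = tensor_algebra (laurent_at \<epsilon>) (schur r act)"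

text \<open>The action of \<open>f \<otimes> c\<close> on the basis of the tensor space over \<^typ>\<open>ratfun\<close>.\<close>

definition schur_v_apply :: "(endo \<Rightarrow>\<^sub>0 ratfun) \<Rightarrow> int list \<Rightarrow> (int list \<Rightarrow>\<^sub>0 ratfun)" where
  "schur_v_apply p w = (\<Sum>f\<in>Poly_Mapping.keys p.
     pm_scale (Poly_Mapping.lookup p f) (Poly_Mapping.map laurent_to_ratfun (f (om w))))"

definition acts_as ::
  "nat \<Rightarrow> (endo \<Rightarrow>\<^sub>0 ratfun) set \<Rightarrow> (int list \<Rightarrow> (int list \<Rightarrow>\<^sub>0 ratfun)) \<Rightarrow> bool" where
  "acts_as r P D \<longleftrightarrow> (\<forall>p\<in>P. \<forall>w. length w = r \<longrightarrow> schur_v_apply p w = D w)"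


section \<open>Quantum affine \<open>gl\<^sub>n\<close>\<close>

text \<open>\<open>Xg 1 i s\<close> and \<open>Xg (-1) i s\<close> are \<open>x\<^sup>+\<^bsub>i,s\<^esub>\<close> and \<open>x\<^sup>-\<^bsub>i,s\<^esub>\<close>. Below, a sign \<open>\<plusminus>\<close> is an integer
  \<open>e \<in> {1, -1}\<close>.\<close>

datatype qaff_gen = Xg int nat int | Kg nat | Kg_inv nat | Gg nat int

type_synonym qaff_free = "qaff_gen list \<Rightarrow>\<^sub>0 ratfun"

abbreviation x_gen :: "int \<Rightarrow> nat \<Rightarrow> int \<Rightarrow> qaff_free" where "x_gen e i s \<equiv> gen (Xg e i s)"
abbreviation k_gen :: "nat \<Rightarrow> qaff_free" where "k_gen i \<equiv> gen (Kg i)"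
abbreviation k_inv :: "nat \<Rightarrow> qaff_free" where "k_inv i \<equiv> gen (Kg_inv i)"
abbreviation g_gen :: "nat \<Rightarrow> int \<Rightarrow> qaff_free" where "g_gen i t \<equiv> gen (Gg i t)"

definition qaff_gens :: "nat \<Rightarrow> qaff_gen set" where
  "qaff_gens n =
     {Xg e i s | e i s. e \<in> {1, -1} \<and> 1 \<le> i \<and> i < n}
   \<union> {Kg i | i. 1 \<le> i \<and> i \<le> n} \<union> {Kg_inv i | i. 1 \<le> i \<and> i \<le> n}
   \<union> {Gg i t | i t. 1 \<le> i \<and> i \<le> n \<and> t \<noteq> 0}"

definition bracket :: "ratfun \<Rightarrow> qaff_free \<Rightarrow> qaff_free \<Rightarrow> qaff_free" where
  "bracket a x y = x * y - scal a * y * x"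

text \<open>Coefficient of \<open>u\<^sup>s\<close> in \<open>exp (\<Sum>m\<ge>1. a m u\<^sup>m)\<close>; powers beyond \<open>s\<close> do not contribute.\<close>

definition exp_coeff :: "(nat \<Rightarrow> qaff_free) \<Rightarrow> nat \<Rightarrow> qaff_free" where
  "exp_coeff a s = (\<Sum>k\<le>s. scal (cst (1 / fact k)) *
     fps_nth (Abs_fps (\<lambda>m. if m = 0 then 0 else a m) ^ k) s)"

definition next_index :: "nat \<Rightarrow> nat \<Rightarrow> nat" where
  "next_index n i = (if i = n then 1 else i + 1)"

definition k_tilde :: "nat \<Rightarrow> int \<Rightarrow> nat \<Rightarrow> qaff_free" where
  "k_tilde n e i = (if e = 1 then k_gen i * k_inv (next_index n i)
                    else k_inv i * k_gen (next_index n i))"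

definition h_elt :: "nat \<Rightarrow> int \<Rightarrow> qaff_free" where
  "h_elt i m = scal (qv powi ((int i - 1) * m)) * g_gen i m
             - scal (qv powi ((int i + 1) * m)) * g_gen (i + 1) m"

definition phi :: "nat \<Rightarrow> int \<Rightarrow> nat \<Rightarrow> int \<Rightarrow> qaff_free" where
  "phi n e i s = (if e * s \<ge> 0
     then k_tilde n e i *
       exp_coeff (\<lambda>m. scal (of_int e * (qv - inverse qv)) * h_elt i (e * int m)) (nat (e * s))
     else 0)"

definition cartan :: "nat \<Rightarrow> nat \<Rightarrow> int" where
  "cartan i j = (if i = j then 2 else if i = j + 1 \<or> j = i + 1 then - 1 else 0)"

definition qaff_rels :: "nat \<Rightarrow> qaff_free set" where
  "qaff_rels n =
     {k_gen i * k_inv i - 1 | i. 1 \<le> i \<and> i \<le> n}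
   \<union> {k_inv i * k_gen i - 1 | i. 1 \<le> i \<and> i \<le> n}
   \<union> {bracket 1 (k_gen i) (k_gen j) | i j. 1 \<le> i \<and> i \<le> n \<and> 1 \<le> j \<and> j \<le> n}
   \<union> {k_gen i * x_gen e j s
       - scal (qv powi (e * (of_bool (i = j) - of_bool (i = j + 1)))) * x_gen e j s * k_gen i
       | e i j s. e \<in> {1, -1} \<and> 1 \<le> i \<and> i \<le> n \<and> 1 \<le> j \<and> j < n}
   \<union> {bracket 1 (k_gen i) (g_gen j s) | i j s. 1 \<le> i \<and> i \<le> n \<and> 1 \<le> j \<and> j \<le> n \<and> s \<noteq> 0}
   \<union> {bracket 1 (g_gen i s) (x_gen e j t)
       | e i j s t. e \<in> {1, -1} \<and> 1 \<le> i \<and> i \<le> n \<and> 1 \<le> j \<and> j < n \<and> s \<noteq> 0 \<and> i \<noteq> j \<and> i \<noteq> j + 1}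
   \<union> {bracket 1 (g_gen j s) (x_gen e j t)
       - scal (of_int e * qv powi (- int j * s) * qint s / of_int s) * x_gen e j (s + t)
       | e j s t. e \<in> {1, -1} \<and> 1 \<le> j \<and> j < n \<and> s \<noteq> 0}
   \<union> {bracket 1 (g_gen (j + 1) s) (x_gen e j t)
       + scal (of_int e * qv powi (- int j * s) * qint s / of_int s) * x_gen e j (s + t)
       | e j s t. e \<in> {1, -1} \<and> 1 \<le> j \<and> j < n \<and> s \<noteq> 0}
   \<union> {bracket 1 (g_gen i s) (g_gen j t)
       | i j s t. 1 \<le> i \<and> i \<le> n \<and> 1 \<le> j \<and> j \<le> n \<and> s \<noteq> 0 \<and> t \<noteq> 0}
   \<union> {bracket 1 (x_gen 1 i s) (x_gen (-1) j t)
       - (if i = j then scal (1 / (qv - inverse qv)) * (phi n 1 i (s + t) - phi n (-1) i (s + t))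
          else 0)
       | i j s t. 1 \<le> i \<and> i < n \<and> 1 \<le> j \<and> j < n}
   \<union> {bracket 1 (x_gen e i s) (x_gen e j t)
       | e i j s t. e \<in> {1, -1} \<and> 1 \<le> i \<and> i < n \<and> 1 \<le> j \<and> j < n \<and> (i + 1 < j \<or> j + 1 < i)}
   \<union> {bracket (qv powi (e * cartan i j)) (x_gen e i (s + 1)) (x_gen e j t)
       + bracket (qv powi (e * cartan i j)) (x_gen e j (t + 1)) (x_gen e i s)
       | e i j s t. e \<in> {1, -1} \<and> 1 \<le> i \<and> i < n \<and> 1 \<le> j \<and> j < n}
   \<union> {bracket qv (x_gen e i s) (bracket qv (x_gen e j t) (x_gen e i p))
       + bracket qv (x_gen e i p) (bracket qv (x_gen e j t) (x_gen e i s))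
       | e i j s t p. e \<in> {1, -1} \<and> 1 \<le> i \<and> i < n \<and> 1 \<le> j \<and> j < n \<and> (i = j + 1 \<or> j = i + 1)}"

definition qaff :: "nat \<Rightarrow> (ratfun, qaff_free set) module" where
  "qaff n = presented_algebra (qaff_gens n) (qaff_rels n)"

definition qaff_class :: "nat \<Rightarrow> qaff_free \<Rightarrow> qaff_free set" where
  "qaff_class n = pres_class (qaff_gens n) (qaff_rels n)"

text \<open>The iterated brackets in \<open>E\<^sub>n\<close> and \<open>F\<^sub>n\<close>; argument \<open>j\<close> is the bracket that ends with index
  \<open>j + 1\<close>.\<close>

primrec E_nest :: "nat \<Rightarrow> qaff_free" where
  "E_nest 0 = x_gen (-1) 1 1"
| "E_nest (Suc j) = bracket (inverse qv) (x_gen (-1) (j + 2) 0) (E_nest j)"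

primrec F_nest :: "nat \<Rightarrow> qaff_free" where
  "F_nest 0 = x_gen 1 1 (-1)"
| "F_nest (Suc j) = bracket qv (F_nest j) (x_gen 1 (j + 2) 0)"

definition E_elt :: "nat \<Rightarrow> nat \<Rightarrow> qaff_free" where
  "E_elt n i = (if i < n then x_gen 1 i 0 else scal qv * E_nest (n - 2) * k_tilde n 1 n)"

definition F_elt :: "nat \<Rightarrow> nat \<Rightarrow> qaff_free" where
  "F_elt n i =
     (if i < n then x_gen (-1) i 0 else scal (inverse qv) * k_tilde n (-1) n * F_nest (n - 2))"

definition z_elt :: "nat \<Rightarrow> int \<Rightarrow> nat \<Rightarrow> qaff_free" where
  "z_elt n e s = scal (of_nat s * qv powi (e * int s) / qint (int s)) * (\<Sum>i=1..n. g_gen i (e * int s))"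

subsection \<open>Action on the tensor space\<close>

text \<open>The action on basis vectors of the tensor powers, by recursion along the coproduct
  (the first tensor factor is split off). The product of \<^typ>\<open>int list \<Rightarrow>\<^sub>0 ratfun\<close> is the tensor
  product, and \<open>k_op n e i w\<close>, \<open>kt_op n e i w\<close> are group-like.\<close>

definition same_res :: "nat \<Rightarrow> int \<Rightarrow> int \<Rightarrow> bool" where
  "same_res n a b \<longleftrightarrow> a mod int n = b mod int n"

definition k_op :: "nat \<Rightarrow> int \<Rightarrow> int \<Rightarrow> int list \<Rightarrow> (int list \<Rightarrow>\<^sub>0 ratfun)" where
  "k_op n e i w = pm_scale (\<Prod>s\<leftarrow>w. qv powi (e * of_bool (same_res n i s))) (om w)"

definition kt_op :: "nat \<Rightarrow> int \<Rightarrow> int \<Rightarrow> int list \<Rightarrow> (int list \<Rightarrow>\<^sub>0 ratfun)" where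
  "kt_op n e i w = pm_scale
     (\<Prod>s\<leftarrow>w. qv powi (e * (of_bool (same_res n i s) - of_bool (same_res n (i + 1) s)))) (om w)"

primrec E_op :: "nat \<Rightarrow> int \<Rightarrow> int list \<Rightarrow> (int list \<Rightarrow>\<^sub>0 ratfun)" where
  "E_op n i [] = 0"
| "E_op n i (s # w) =
     (if same_res n (i + 1) s then om [s - 1] else 0) * kt_op n 1 i w + om [s] * E_op n i w"

primrec F_op :: "nat \<Rightarrow> int \<Rightarrow> int list \<Rightarrow> (int list \<Rightarrow>\<^sub>0 ratfun)" where
  "F_op n i [] = 0"
| "F_op n i (s # w) =
     (if same_res n i s then om [s + 1] else 0) * om w + kt_op n (-1) i [s] * F_op n i w"

primrec z_op :: "nat \<Rightarrow> int \<Rightarrow> nat \<Rightarrow> int list \<Rightarrow> (int list \<Rightarrow>\<^sub>0 ratfun)" where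
  "z_op n e t [] = 0"
| "z_op n e t (s # w) = om [s - e * int t * int n] * om w + om [s] * z_op n e t w"

text \<open>\<open>\<zeta>\<close> is the algebra homomorphism into the Schur algebra induced by this action. It is
  determined by these values, as the \<open>E\<^sub>i\<close>, \<open>F\<^sub>i\<close>, \<open>k\<^sub>i\<close>, \<open>k\<^sub>i\<^sup>-\<^sup>1\<close>, \<open>z\<^sub>s\<close> generate.\<close>

definition zeta_hom ::
  "nat \<Rightarrow> nat \<Rightarrow> hecke_act \<Rightarrow> (qaff_free set \<Rightarrow> (endo \<Rightarrow>\<^sub>0 ratfun) set) \<Rightarrow> bool" where
  "zeta_hom n r act \<zeta> \<longleftrightarrow>
     \<zeta> \<in> ring_hom (qaff n) (schur_v r act) \<and>
     (\<forall>c. \<forall>x\<in>carrier (qaff n). \<zeta> (c \<odot>\<^bsub>qaff n\<^esub> x) = c \<odot>\<^bsub>schur_v r act\<^esub> \<zeta> x) \<and>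
     (\<forall>i\<in>{1..n}.
        acts_as r (\<zeta> (qaff_class n (E_elt n i))) (E_op n (int i)) \<and>
        acts_as r (\<zeta> (qaff_class n (F_elt n i))) (F_op n (int i)) \<and>
        acts_as r (\<zeta> (qaff_class n (k_gen i))) (k_op n 1 (int i)) \<and>
        acts_as r (\<zeta> (qaff_class n (k_inv i))) (k_op n (-1) (int i))) \<and>
     (\<forall>s\<ge>1. \<forall>e\<in>{1, -1}. acts_as r (\<zeta> (qaff_class n (z_elt n e s))) (z_op n e s))"


section \<open>Idempotents\<close>

definition compositions :: "nat \<Rightarrow> nat \<Rightarrow> nat list set" where
  "compositions n r = {\<nu>. length \<nu> = n \<and> sum_list \<nu> = r}"

definition pad :: "nat \<Rightarrow> nat list \<Rightarrow> nat list" where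
  "pad N \<mu> = \<mu> @ replicate (N - length \<mu>) 0"

definition padded_compositions :: "nat \<Rightarrow> nat \<Rightarrow> nat \<Rightarrow> nat list set" where
  "padded_compositions n N r = pad N ` compositions n r"

definition k_binom :: "nat \<Rightarrow> nat \<Rightarrow> qaff_free" where
  "k_binom i t = (\<Prod>s\<leftarrow>[1..<t + 1]. scal (1 / (qv powi int s - qv powi (- int s))) *
     (scal (qv powi (1 - int s)) * k_gen i - scal (qv powi (int s - 1)) * k_inv i))"

text \<open>\<open>\<ll>\<^sub>\<nu>\<close> as the element of the integral Schur algebra whose image over \<^typ>\<open>ratfun\<close> is the
  product of the \<open>\<zeta> [k\<^sub>i; 0; \<nu>\<^sub>i]\<close>.\<close>

definition idem :: "nat \<Rightarrow> nat \<Rightarrow> hecke_act \<Rightarrow> (qaff_free set \<Rightarrow> (endo \<Rightarrow>\<^sub>0 ratfun) set) \<Rightarrow>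
    nat list \<Rightarrow> endo" where
  "idem n r act \<zeta> \<nu> = (THE f. f \<in> carrier (schur r act) \<and>
     tensor_one laurent_to_ratfun (schur r act) f =
       foldr (mult (schur_v r act))
         (map (\<lambda>i. \<zeta> (qaff_class n (k_binom i (\<nu> ! (i - 1))))) [1..<n + 1])
         \<one>\<^bsub>schur_v r act\<^esub>)"

definition corner_idem :: "nat \<Rightarrow> nat \<Rightarrow> nat \<Rightarrow> hecke_act \<Rightarrow>
    (qaff_free set \<Rightarrow> (endo \<Rightarrow>\<^sub>0 ratfun) set) \<Rightarrow> endo" where
  "corner_idem n N r act \<zeta> = (\<Oplus>\<^bsub>schur r act\<^esub>\<mu>\<in>compositions n r. idem N r act \<zeta> (pad N \<mu>))"


section \<open>Highest weight modules\<close>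

definition const_poly :: "ratfun poly \<Rightarrow> bool" where
  "const_poly p \<longleftrightarrow> p \<in> Set.range (map_poly cst :: complex poly \<Rightarrow> ratfun poly)"

text \<open>An \<open>n\<close>-tuple \<open>(Q\<^sub>1, \<dots>, Q\<^sub>n)\<close> is a list, with \<open>Q\<^sub>i = Q ! (i - 1)\<close>.\<close>

definition drinfeld_tuples :: "nat \<Rightarrow> ratfun poly list set" where
  "drinfeld_tuples n = {Q. length Q = n \<and> (\<forall>q\<in>set Q. coeff q 0 = 1) \<and>
     const_poly (pcompose (Q ! (n - 1)) [:0, qv ^ (n - 1):]) \<and>
     (\<forall>i\<in>{1..n - 1}. \<exists>p. const_poly p \<and>
        pcompose (Q ! (i - 1)) [:0, qv ^ (i - 1):] = p * pcompose (Q ! i) [:0, qv ^ (i + 1):])}"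

definition drinfeld_tuples_deg :: "nat \<Rightarrow> nat \<Rightarrow> ratfun poly list set" where
  "drinfeld_tuples_deg n r = {Q \<in> drinfeld_tuples n. sum_list (map degree Q) = r}"

text \<open>The \<open>a\<^sub>i\<close> with \<open>g(u) = \<Prod>(1 - a\<^sub>i u)\<close>; the members of a tuple in \<^const>\<open>drinfeld_tuples\<close> split
  over \<^typ>\<open>ratfun\<close>.\<close>

definition recip_roots :: "ratfun poly \<Rightarrow> ratfun multiset" where
  "recip_roots g = (THE A. 0 \<notin># A \<and> g = (\<Prod>a\<in>#A. [:1, - a:]))"

definition Q_coeff :: "ratfun poly \<Rightarrow> int \<Rightarrow> ratfun" where
  "Q_coeff g s =
     (if s \<ge> 0 then coeff (\<Prod>a\<in>#recip_roots g. [:1, - a:]) (nat s)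
      else coeff (\<Prod>a\<in>#recip_roots g. [:1, - inverse a:]) (nat (- s)))"

definition Q_elt :: "nat \<Rightarrow> int \<Rightarrow> qaff_free" where
  "Q_elt i s = (let e = (if s \<ge> 0 then 1 else -1) in
     exp_coeff (\<lambda>t. - (scal (qv powi (e * int t) / qint (int t)) * g_gen i (e * int t))) (nat (e * s)))"

definition hw_module :: "nat \<Rightarrow> ratfun poly list \<Rightarrow> (qaff_free set, qaff_free set set) module" where
  "hw_module n Q = quot_module (regular_module (qaff n)) (left_ideal_gen (qaff n) (qaff_class n `
     ({x_gen 1 j s | j s. 1 \<le> j \<and> j < n}
    \<union> {Q_elt i s - scal (Q_coeff (Q ! (i - 1)) s) | i s. 1 \<le> i \<and> i \<le> n}
    \<union> {k_gen i - scal (qv ^ degree (Q ! (i - 1))) | i. 1 \<le> i \<and> i \<le> n})))"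

text \<open>\<open>Lv\<close> is the module \<open>L\<close> over \<open>U\<close>, regarded as an \<open>S\<close>-module via \<open>\<zeta>\<close>.\<close>

definition module_via :: "('u, 'x) ring_scheme \<Rightarrow> ('s, 'y) ring_scheme \<Rightarrow> ('u \<Rightarrow> 's) \<Rightarrow>
    ('u, 'm) module \<Rightarrow> ('s, 'm) module \<Rightarrow> bool" where
  "module_via U S \<zeta> L Lv \<longleftrightarrow> left_module S Lv \<and>
     carrier Lv = carrier L \<and> zero Lv = zero L \<and> add Lv = add L \<and>
     (\<forall>x\<in>carrier U. \<forall>m\<in>carrier L. \<zeta> x \<odot>\<^bsub>Lv\<^esub> m = x \<odot>\<^bsub>L\<^esub> m)"

definition schur_smult ::
  "nat \<Rightarrow> hecke_act \<Rightarrow> ((endo \<Rightarrow>\<^sub>0 ratfun) set, 'm) module \<Rightarrow> endo \<Rightarrow> 'm \<Rightarrow> 'm" where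
  "schur_smult r act Lv f m = tensor_one laurent_to_ratfun (schur r act) f \<odot>\<^bsub>Lv\<^esub> m"

definition lattice ::
  "nat \<Rightarrow> hecke_act \<Rightarrow> ((endo \<Rightarrow>\<^sub>0 ratfun) set, 'm) module \<Rightarrow> 'm \<Rightarrow> (endo, 'm) module" where
  "lattice r act Lv w =
    \<lparr>carrier = {schur_smult r act Lv f w | f. f \<in> carrier (schur r act)},
     mult = undefined, one = undefined, zero = \<zero>\<^bsub>Lv\<^esub>, add = add Lv,
     smult = schur_smult r act Lv\<rparr>"

definition lattice_at :: "complex \<Rightarrow> nat \<Rightarrow> hecke_act \<Rightarrow> ((endo \<Rightarrow>\<^sub>0 ratfun) set, 'm) module \<Rightarrow> 'm \<Rightarrow>
    ((endo \<Rightarrow>\<^sub>0 complex) set, ('m \<Rightarrow>\<^sub>0 complex) set) module" where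
  "lattice_at \<epsilon> r act Lv w = tensor_module (laurent_at \<epsilon>) (schur r act) (lattice r act Lv w)"


section \<open>The functor \<open>V \<mapsto> eV\<close>\<close>

definition reindex :: "nat \<Rightarrow> nat \<Rightarrow> int \<Rightarrow> int" where
  "reindex n N s = (s - 1) mod int n + 1 + ((s - 1) div int n) * int N"

definition tensor_embed :: "nat \<Rightarrow> nat \<Rightarrow> (int list \<Rightarrow>\<^sub>0 'k::comm_ring_1) \<Rightarrow> (int list \<Rightarrow>\<^sub>0 'k)" where
  "tensor_embed n N x = (\<Sum>w\<in>Poly_Mapping.keys x.
     Poly_Mapping.single (map (reindex n N) w) (Poly_Mapping.lookup x w))"

text \<open>The isomorphism from the Schur algebra for \<open>n\<close> onto \<open>e S e\<close>, where \<open>e S e\<close> is the set of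
  endomorphisms of \<open>e\<Omega>\<close> extended by zero on \<open>(1 - e)\<Omega>\<close>.\<close>

definition corner_iso :: "nat \<Rightarrow> nat \<Rightarrow> nat \<Rightarrow> endo \<Rightarrow> endo \<Rightarrow> endo" where
  "corner_iso n N r e f = (\<lambda>x\<in>carrier (tensor_space r).
     tensor_embed n N (f (inv_into (carrier (tensor_space r)) (tensor_embed n N) (e x))))"

definition corner_iso_at :: "complex \<Rightarrow> nat \<Rightarrow> nat \<Rightarrow> nat \<Rightarrow> hecke_act \<Rightarrow> endo \<Rightarrow>
    (endo \<Rightarrow>\<^sub>0 complex) set \<Rightarrow> (endo \<Rightarrow>\<^sub>0 complex) set" where
  "corner_iso_at \<epsilon> n N r act e P = (\<Union>p\<in>P. tensor_class (laurent_at \<epsilon>) (schur r act)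
     (\<Sum>f\<in>Poly_Mapping.keys p. Poly_Mapping.single (corner_iso n N r e f) (Poly_Mapping.lookup p f)))"

text \<open>The value on a module \<open>V\<close> over the Schur algebra for \<open>N\<close> (with Hecke action \<open>act\<close>): the
  subspace \<open>eV\<close> as a module over the Schur algebra for \<open>n\<close>. The scalars \<open>P\<close> are classes
  formed with respect to the Hecke action for \<open>n\<close>; only their representatives are used.\<close>

definition functor_G :: "complex \<Rightarrow> nat \<Rightarrow> nat \<Rightarrow> nat \<Rightarrow> hecke_act \<Rightarrow>
    (qaff_free set \<Rightarrow> (endo \<Rightarrow>\<^sub>0 ratfun) set) \<Rightarrow>
    ((endo \<Rightarrow>\<^sub>0 complex) set, 'm) module \<Rightarrow> ((endo \<Rightarrow>\<^sub>0 complex) set, 'm) module" where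
  "functor_G \<epsilon> n N r act \<zeta> V = (let e = corner_idem n N r act \<zeta> in
    \<lparr>carrier = {tensor_one (laurent_at \<epsilon>) (schur r act) e \<odot>\<^bsub>V\<^esub> x | x. x \<in> carrier V},
     mult = undefined, one = undefined, zero = \<zero>\<^bsub>V\<^esub>, add = add V,
     smult = (\<lambda>P x. corner_iso_at \<epsilon> n N r act e P \<odot>\<^bsub>V\<^esub> x)\<rparr>)"

end

theory Submission
  imports Defs
begin

text \<open>Let \<open>\<lambda> = deg Q\<close>, let \<open>e\<close> be the corner idempotent and \<open>\<ll>\<^sub>\<lambda>\<close> the idempotent of \<open>\<lambda>\<close>. The
  irreducible module \<open>V\<close> is a quotient of \<open>L\<^sub>\<epsilon>\<close>, which is generated by the image of \<open>w\<close>, and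
  \<open>\<ll>\<^sub>\<lambda> w = w\<close>.

  If \<open>\<lambda>\<close> is padded then \<open>e \<ll>\<^sub>\<lambda> = \<ll>\<^sub>\<lambda>\<close>, so \<open>e\<close> fixes the image of \<open>w\<close> in \<open>V\<close>. This image generates
  \<open>V\<close> (\<open>lattice_at_generated\<close>), hence is not zero, and \<open>e V\<close> is not zero.

  Every weight \<open>a\<close> of \<open>L(Q)\<close> satisfies \<open>a\<^sub>1 + \<dots> + a\<^sub>n \<le> \<lambda>\<^sub>1 + \<dots> + \<lambda>\<^sub>n\<close>: words in the generators
  other than the \<open>x\<^sup>+\<close> span \<open>L(Q)\<close> (\<open>carrier_lowered\<close>), and none of their letters raises this sum
  (\<open>weight_vector_lowering\<close>). On the other hand \<open>e k\<^sub>1 \<cdots> k\<^sub>n = v\<^sup>r e\<close>, because \<open>e\<close> projects onto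
  the tensors all of whose \<open>r\<close> factors have residues \<open>1, \<dots>, n\<close>. As \<open>v\<close> is not a root of unity,
  \<open>e\<close> kills every weight vector with \<open>a\<^sub>1 + \<dots> + a\<^sub>n \<noteq> r\<close> (\<open>corner_kills_weight_vector\<close>). If \<open>\<lambda>\<close> is
  not padded then \<open>\<lambda>\<^sub>1 + \<dots> + \<lambda>\<^sub>n < r\<close>. So \<open>e\<close> kills \<open>L(Q)\<close>, hence also the lattice in it, the
  reduction of the lattice at \<open>\<epsilon>\<close>, and \<open>V\<close>.

  Both arguments use that \<open>\<ll>\<^sub>\<nu>\<close> is the projection of the tensor space onto the span of the basis
  vectors of content \<open>\<nu>\<close> (\<open>idem_eq_weight_proj\<close>). The projection belongs to the integral Schur
  algebra because \<open>\<zeta> k\<^sub>i\<close> commutes with the Hecke algebra and its eigenvalues, for all \<open>i\<close>,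
  determine the content, so that the Hecke algebra preserves contents
  (\<open>hecke_preserves_content\<close>). It equals the product of the \<open>\<zeta> [k\<^sub>i; 0; \<nu>\<^sub>i]\<close> because the Schur
  algebra over \<open>\<complex>(v)\<close> acts faithfully on the tensor space (\<open>schur_v_faithful\<close>) and
  the product of Gaussian binomials \<open>[\<mu>\<^sub>i; \<nu>\<^sub>i]\<close> of two compositions of \<open>r\<close> is \<open>1\<close> or \<open>0\<close>
  according to whether they are equal (\<open>prod_gauss_binom\<close>).\<close>

section \<open>Finitely supported families\<close>

text \<open>When every \<open>\<phi> a\<close> is additive this is the linear extension of \<open>\<phi>\<close>. The maps
  \<^const>\<open>bilinear_ext\<close>, \<^const>\<open>laurent_to_ratfun\<close> and \<^const>\<open>schur_v_apply\<close> have this form.\<close>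

definition lin_ext :: "('a \<Rightarrow> 'k \<Rightarrow> 'm) \<Rightarrow> ('a \<Rightarrow>\<^sub>0 'k::zero) \<Rightarrow> 'm::comm_monoid_add" where
  "lin_ext \<phi> p = (\<Sum>a\<in>Poly_Mapping.keys p. \<phi> a (Poly_Mapping.lookup p a))"

lemma lin_ext_superset:
  assumes "finite S" "Poly_Mapping.keys p \<subseteq> S" "\<And>a. \<phi> a 0 = 0"
  shows "lin_ext \<phi> p = (\<Sum>a\<in>S. \<phi> a (Poly_Mapping.lookup p a))"
  unfolding lin_ext_def
  by (rule sum.mono_neutral_left) (use assms in \<open>auto simp: in_keys_iff\<close>)

lemma lin_ext_add:
  fixes p q :: "'a \<Rightarrow>\<^sub>0 'k::monoid_add"
  assumes "\<And>a. \<phi> a 0 = 0" "\<And>a c d. \<phi> a (c + d) = \<phi> a c + \<phi> a d"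
  shows "lin_ext \<phi> (p + q) = lin_ext \<phi> p + lin_ext \<phi> q"
proof -
  let ?S = "Poly_Mapping.keys p \<union> Poly_Mapping.keys q"
  have "lin_ext \<phi> r = (\<Sum>a\<in>?S. \<phi> a (Poly_Mapping.lookup r a))" if "Poly_Mapping.keys r \<subseteq> ?S" for r
    by (rule lin_ext_superset) (use that assms in auto)
  then show ?thesis
    by (simp add: Poly_Mapping.keys_add lookup_add assms sum.distrib)
qed

lemma lin_ext_zero [simp]: "lin_ext \<phi> 0 = 0"
  by (simp add: lin_ext_def)

lemma lin_ext_zero_fun [simp]: "lin_ext (\<lambda>a c. 0) p = 0"
  by (simp add: lin_ext_def)

lemma lin_ext_single: "\<phi> a 0 = 0 \<Longrightarrow> lin_ext \<phi> (Poly_Mapping.single a c) = \<phi> a c"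
  by (simp add: lin_ext_def)

lemma lin_ext_plus_fun:
  "lin_ext (\<lambda>a c. \<phi> a c + \<psi> a c) p = lin_ext \<phi> p + lin_ext \<psi> p"
  by (simp add: lin_ext_def sum.distrib)

lemma lin_ext_cong:
  assumes "\<And>a. a \<in> Poly_Mapping.keys p \<Longrightarrow> \<phi> a (Poly_Mapping.lookup p a) = \<psi> a (Poly_Mapping.lookup p a)"
  shows "lin_ext \<phi> p = lin_ext \<psi> p"
  unfolding lin_ext_def by (rule sum.cong) (use assms in auto)

lemma poly_mapping_sum_singles:
  fixes p :: "'a \<Rightarrow>\<^sub>0 'b::comm_monoid_add"
  shows "p = (\<Sum>k\<in>Poly_Mapping.keys p. Poly_Mapping.single k (Poly_Mapping.lookup p k))"
  by (rule poly_mapping_eqI) (auto simp: lookup_sum lookup_single when_def in_keys_iff)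

text \<open>The singletons are those that occur in \<open>p\<close>, so that a bound on the keys of \<open>p\<close> is available
  for them.\<close>

lemma poly_mapping_span_induct [consumes 0, case_names zero add single]:
  fixes p :: "'a \<Rightarrow>\<^sub>0 'b::comm_monoid_add"
  assumes "P 0" "\<And>p q. P p \<Longrightarrow> P q \<Longrightarrow> P (p + q)"
    and "\<And>k. k \<in> Poly_Mapping.keys p \<Longrightarrow> P (Poly_Mapping.single k (Poly_Mapping.lookup p k))"
  shows "P p"
proof -
  have "P (\<Sum>k\<in>S. Poly_Mapping.single k (Poly_Mapping.lookup p k))" if "S \<subseteq> Poly_Mapping.keys p" for S
  proof -
    have "finite S" using that finite_subset finite_keys by blast
    then show ?thesis using that
      by (induction S rule: finite_induct) (use assms in auto)
  qed
  from this[OF order_refl] show ?thesis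
    using poly_mapping_sum_singles[of p] by simp
qed

lemma lookup_pm_scale [simp]:
  "Poly_Mapping.lookup (pm_scale c p) k = c * Poly_Mapping.lookup p k"
  by (simp add: pm_scale_def Poly_Mapping.map.rep_eq when_def)

lemma keys_pm_scale: "Poly_Mapping.keys (pm_scale c p) \<subseteq> Poly_Mapping.keys p"
  by (auto simp: in_keys_iff)

lemma pm_scale_simps [simp]:
  "pm_scale c (p + q) = pm_scale c p + pm_scale c q"
  "pm_scale c (p - q) = pm_scale c p - pm_scale c q"
  "pm_scale c (pm_scale d p) = pm_scale (c * d) p"
  "pm_scale c 0 = 0" "pm_scale 0 p = 0" "pm_scale 1 p = p"
  "pm_scale c (Poly_Mapping.single k d) = Poly_Mapping.single k (c * d)"
  by (rule poly_mapping_eqI;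
      simp add: lookup_add lookup_minus lookup_single when_def algebra_simps)+

lemma pm_scale_add_left: "pm_scale (c + d) p = pm_scale c p + pm_scale d p"
  by (rule poly_mapping_eqI) (simp add: lookup_add algebra_simps)

lemma pm_scale_minus_one: "pm_scale (- 1) p = - p"
  by (rule poly_mapping_eqI) simp

lemma pm_scale_sum: "pm_scale c (sum f S) = (\<Sum>s\<in>S. pm_scale c (f s))"
  by (rule poly_mapping_eqI) (simp add: lookup_sum sum_distrib_left)

lemma pm_scale_lin_ext:
  "pm_scale c (lin_ext \<phi> p) = lin_ext (\<lambda>a d. pm_scale c (\<phi> a d)) p"
  by (simp add: lin_ext_def pm_scale_sum)

lemma lin_ext_pm_scale:
  assumes "\<And>a. \<phi> a 0 = 0" "\<And>a d. \<phi> a (c * d) = pm_scale k (\<phi> a d)"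
  shows "lin_ext \<phi> (pm_scale c p) = pm_scale k (lin_ext \<phi> p)"
proof -
  have "lin_ext \<phi> (pm_scale c p) = (\<Sum>a\<in>Poly_Mapping.keys p. \<phi> a (c * Poly_Mapping.lookup p a))"
    by (subst lin_ext_superset[OF finite_keys keys_pm_scale]) (auto simp: assms(1))
  then show ?thesis by (simp add: lin_ext_def assms(2) pm_scale_sum)
qed

lemma keys_lin_ext:
  assumes "\<And>a. a \<in> Poly_Mapping.keys p \<Longrightarrow> Poly_Mapping.keys (\<phi> a (Poly_Mapping.lookup p a)) \<subseteq> S"
  shows "Poly_Mapping.keys (lin_ext \<phi> p) \<subseteq> S"
  unfolding lin_ext_def
  by (rule order_trans[OF Poly_Mapping.keys_sum]) (use assms in auto)

lemma bilinear_ext_lin_ext: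
  "bilinear_ext f p q =
     lin_ext (\<lambda>a c. lin_ext (\<lambda>b d. Poly_Mapping.single (f a b) (c * d)) q) p"
  by (simp add: bilinear_ext_def lin_ext_def)

lemma bilinear_ext_add_left:
  "bilinear_ext f (p + p') q = bilinear_ext f p q + bilinear_ext f p' q"
  unfolding bilinear_ext_lin_ext
  by (rule lin_ext_add) (simp_all add: lin_ext_def algebra_simps single_add sum.distrib)

lemma bilinear_ext_add_right:
  "bilinear_ext f p (q + q') = bilinear_ext f p q + bilinear_ext f p q'"
  unfolding bilinear_ext_lin_ext
  by (subst lin_ext_add) (simp_all add: algebra_simps single_add lin_ext_plus_fun)

lemma bilinear_ext_zero [simp]: "bilinear_ext f 0 q = 0" "bilinear_ext f p 0 = 0"
  by (simp_all add: bilinear_ext_def)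

lemma bilinear_ext_scale_left: "bilinear_ext f (pm_scale c p) q = pm_scale c (bilinear_ext f p q)"
  unfolding bilinear_ext_lin_ext
  by (rule lin_ext_pm_scale) (simp_all add: mult.assoc lin_ext_def pm_scale_sum)

lemma bilinear_ext_diff_left:
  "bilinear_ext f (p - p') q = bilinear_ext f p q - bilinear_ext f p' q"
  using bilinear_ext_add_left[of f "p - p'" p' q] by (simp add: eq_diff_eq)

lemma bilinear_ext_diff_right:
  "bilinear_ext f p (q - q') = bilinear_ext f p q - bilinear_ext f p q'"
  using bilinear_ext_add_right[of f p "q - q'" q'] by (simp add: eq_diff_eq)

lemma bilinear_ext_single [simp]:
  "bilinear_ext f (Poly_Mapping.single a c) (Poly_Mapping.single b d) =
     Poly_Mapping.single (f a b) (c * d)"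
  by (simp add: bilinear_ext_lin_ext lin_ext_single)

lemma keys_bilinear_ext:
  assumes "\<And>a b. a \<in> Poly_Mapping.keys p \<Longrightarrow> b \<in> Poly_Mapping.keys q \<Longrightarrow> f a b \<in> S"
  shows "Poly_Mapping.keys (bilinear_ext f p q) \<subseteq> S"
  unfolding bilinear_ext_lin_ext
  by (intro keys_lin_ext) (use assms in \<open>auto split: if_splits\<close>)

lemma bilinear_ext_assoc:
  assumes "\<And>a b c. a \<in> Poly_Mapping.keys p \<Longrightarrow> b \<in> Poly_Mapping.keys q \<Longrightarrow> c \<in> Poly_Mapping.keys x \<Longrightarrow>
    f (g a b) c = f' a (g' b c)"
  shows "bilinear_ext f (bilinear_ext g p q) x = bilinear_ext f' p (bilinear_ext g' q x)"
proof (induction p rule: poly_mapping_span_induct)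
  case (single a)
  show ?case
  proof (induction q rule: poly_mapping_span_induct)
    case (single b)
    show ?case
    proof (induction x rule: poly_mapping_span_induct)
      case (single c)
      then show ?case
        using assms \<open>a \<in> Poly_Mapping.keys p\<close> \<open>b \<in> Poly_Mapping.keys q\<close> by (simp add: mult.assoc)
    qed (simp_all add: bilinear_ext_add_right)
  qed (simp_all add: bilinear_ext_add_left bilinear_ext_add_right)
qed (simp_all add: bilinear_ext_add_left)

section \<open>Modules and their quotients\<close>

lemma (in left_module) smult_zero_right: "a \<in> carrier R \<Longrightarrow> a \<odot>\<^bsub>M\<^esub> \<zero>\<^bsub>M\<^esub> = \<zero>\<^bsub>M\<^esub>"
  using smult_r_distr[of a "\<zero>\<^bsub>M\<^esub>" "\<zero>\<^bsub>M\<^esub>"] smult_closed[of a "\<zero>\<^bsub>M\<^esub>"] by (simp add: M.add.l_cancel_one)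

lemma (in left_module) smult_zero_left: "x \<in> carrier M \<Longrightarrow> \<zero>\<^bsub>R\<^esub> \<odot>\<^bsub>M\<^esub> x = \<zero>\<^bsub>M\<^esub>"
  using smult_l_distr[of "\<zero>\<^bsub>R\<^esub>" "\<zero>\<^bsub>R\<^esub>" x] smult_closed[of "\<zero>\<^bsub>R\<^esub>" x] by (simp add: M.add.l_cancel_one)

context
  fixes R :: "('a, 'c) ring_scheme" and M :: "('a, 'm) module" and K :: "'m set"
  assumes M: "left_module R M" and K: "submodule K R M"
begin

interpretation M: left_module R M by (rule M)
interpretation K: abelian_subgroup K M
  by (rule abelian_subgroupI3) (use K in \<open>simp_all add: submodule_def additive_subgroup_def M.abelian_group_axioms\<close>)

lemma submodule_smult_closed: "a \<in> carrier R \<Longrightarrow> x \<in> K \<Longrightarrow> a \<odot>\<^bsub>M\<^esub> x \<in> K"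
  using K by (simp add: submodule_def submodule_axioms_def)

lemma quot_module_carrier: "carrier (quot_module M K) = (\<lambda>x. K +>\<^bsub>M\<^esub> x) ` carrier M"
  by (auto simp: quot_module_def A_RCOSETS_def' a_r_coset_def')

lemma quot_module_zero: "\<zero>\<^bsub>quot_module M K\<^esub> = K"
  by (simp add: quot_module_def)

lemma quot_module_add:
  "x \<in> carrier M \<Longrightarrow> y \<in> carrier M \<Longrightarrow>
   (K +>\<^bsub>M\<^esub> x) \<oplus>\<^bsub>quot_module M K\<^esub> (K +>\<^bsub>M\<^esub> y) = K +>\<^bsub>M\<^esub> (x \<oplus>\<^bsub>M\<^esub> y)"
  by (simp add: quot_module_def K.a_rcos_sum)

lemma coset_eq_iff:
  assumes "x \<in> carrier M"
  shows "K +>\<^bsub>M\<^esub> x = K \<longleftrightarrow> x \<in> K"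
  using K.a_rcos_self[OF assms] K.a_rcos_const by auto

text \<open>The scalar multiplication of a quotient is a union over the representatives of a coset; it
  collapses to one coset because \<open>K\<close> is stable.\<close>

lemma coset_smult:
  assumes "a \<in> carrier R" "x \<in> carrier M" "y \<in> K +>\<^bsub>M\<^esub> x"
  shows "K +>\<^bsub>M\<^esub> (a \<odot>\<^bsub>M\<^esub> y) = K +>\<^bsub>M\<^esub> (a \<odot>\<^bsub>M\<^esub> x)"
proof -
  obtain k where k: "k \<in> K" "y = k \<oplus>\<^bsub>M\<^esub> x" using assms(3) unfolding a_r_coset_def' by blast
  then have "k \<in> carrier M" using K.a_Hcarr by blast
  then have "a \<odot>\<^bsub>M\<^esub> y = a \<odot>\<^bsub>M\<^esub> k \<oplus>\<^bsub>M\<^esub> a \<odot>\<^bsub>M\<^esub> x" using k assms by (simp add: M.smult_r_distr)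
  moreover have "a \<odot>\<^bsub>M\<^esub> k \<in> K" using k assms submodule_smult_closed by blast
  ultimately have "a \<odot>\<^bsub>M\<^esub> y \<in> K +>\<^bsub>M\<^esub> (a \<odot>\<^bsub>M\<^esub> x)" unfolding a_r_coset_def' by blast
  from M.a_repr_independence[OF this M.smult_closed[OF assms(1,2)] K.a_subgroup]
  show ?thesis by simp
qed

lemma quot_module_smult:
  assumes "a \<in> carrier R" "x \<in> carrier M"
  shows "a \<odot>\<^bsub>quot_module M K\<^esub> (K +>\<^bsub>M\<^esub> x) = K +>\<^bsub>M\<^esub> (a \<odot>\<^bsub>M\<^esub> x)"
proof -
  have "a \<odot>\<^bsub>quot_module M K\<^esub> (K +>\<^bsub>M\<^esub> x) = (\<Union>y\<in>K +>\<^bsub>M\<^esub> x. K +>\<^bsub>M\<^esub> (a \<odot>\<^bsub>M\<^esub> y))"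
    by (simp add: quot_module_def)
  also have "\<dots> = (\<Union>y\<in>K +>\<^bsub>M\<^esub> x. K +>\<^bsub>M\<^esub> (a \<odot>\<^bsub>M\<^esub> x))"
    by (intro SUP_cong refl coset_smult assms)
  also have "\<dots> = K +>\<^bsub>M\<^esub> (a \<odot>\<^bsub>M\<^esub> x)" using K.a_rcos_self[OF assms(2)] by auto
  finally show ?thesis .
qed

lemma left_module_quot_module: "left_module R (quot_module M K)"
proof -
  have "abelian_group (quot_module M K)"
  proof (rule abelian_groupI)
    have K0: "K +>\<^bsub>M\<^esub> \<zero>\<^bsub>M\<^esub> = K" by (simp add: coset_eq_iff)
    show "\<zero>\<^bsub>quot_module M K\<^esub> \<in> carrier (quot_module M K)"
      unfolding quot_module_zero quot_module_carrier using K0[symmetric] M.zero_closed by blast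
    fix X assume "X \<in> carrier (quot_module M K)"
    then obtain x where x: "x \<in> carrier M" "X = K +>\<^bsub>M\<^esub> x" by (auto simp: quot_module_carrier)
    show "\<zero>\<^bsub>quot_module M K\<^esub> \<oplus>\<^bsub>quot_module M K\<^esub> X = X"
      using x quot_module_add[OF M.zero_closed x(1)] by (simp add: K0 quot_module_zero)
    show "\<exists>Y\<in>carrier (quot_module M K). Y \<oplus>\<^bsub>quot_module M K\<^esub> X = \<zero>\<^bsub>quot_module M K\<^esub>"
      using x by (intro bexI[of _ "K +>\<^bsub>M\<^esub> (\<ominus>\<^bsub>M\<^esub> x)"])
        (auto simp: quot_module_add quot_module_zero quot_module_carrier M.l_neg K0)
  qed (auto simp: quot_module_carrier quot_module_add M.a_ac)
  moreover have "left_module_axioms R (quot_module M K)"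
    by (unfold_locales)
      (auto simp: quot_module_carrier quot_module_smult quot_module_add M.smult_closed
        M.smult_l_distr M.smult_r_distr M.smult_assoc M.smult_one)
  ultimately show ?thesis by (intro left_module.intro M.ring_axioms)
qed

end

lemma left_module_regular: "ring R \<Longrightarrow> left_module R (regular_module R)"
proof -
  assume "ring R"
  then interpret ring R .
  have "abelian_group (regular_module R)"
    by (rule abelian_groupI) (auto simp: regular_module_def a_ac intro: exI[of _ "\<ominus>\<^bsub>R\<^esub> _"] l_neg)
  moreover have "left_module_axioms R (regular_module R)"
    by unfold_locales (auto simp: regular_module_def l_distr r_distr m_assoc)
  ultimately show ?thesis by (intro left_module.intro ring_axioms)
qed

lemma submodule_left_ideal_gen:
  assumes R: "ring R" and S: "S \<subseteq> carrier R"
  shows "submodule (left_ideal_gen R S) R (regular_module R)" "S \<subseteq> left_ideal_gen R S"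
proof -
  interpret M: left_module R "regular_module R" by (rule left_module_regular[OF R])
  let ?F = "{I. submodule I R (regular_module R) \<and> S \<subseteq> I}"
  have "submodule (carrier R) R (regular_module R)"
    using M.add.subgroup_self by (simp add: submodule_def submodule_axioms_def regular_module_def R ring.ring_simprules)
  \<comment> \<open>the intersection of an empty family would be the whole type\<close>
  then have ne: "?F \<noteq> {}" using S by blast
  have "subgroup (\<Inter>?F) (add_monoid (regular_module R))"
    by (rule M.add.subgroups_Inter[OF _ ne]) (auto simp: submodule_def)
  then show "submodule (left_ideal_gen R S) R (regular_module R)"
    unfolding left_ideal_gen_def submodule_def submodule_axioms_def by auto
  show "S \<subseteq> left_ideal_gen R S" unfolding left_ideal_gen_def by blast
qed

section \<open>Extension of scalars\<close>

subsection \<open>Classes modulo the tensor relations\<close>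

lemma tensor_null_uminus: "p \<in> tensor_null h M \<Longrightarrow> - p \<in> tensor_null h M"
  using tensor_null.null_scale[of p h M "- 1"] by (simp add: pm_scale_minus_one)

lemma tensor_null_diff:
  "p \<in> tensor_null h M \<Longrightarrow> q \<in> tensor_null h M \<Longrightarrow> p - q \<in> tensor_null h M"
  using tensor_null.null_add[OF _ tensor_null_uminus, of p h M q] by simp

lemma tensor_class_self: "Poly_Mapping.keys p \<subseteq> carrier M \<Longrightarrow> p \<in> tensor_class h M p"
  by (simp add: tensor_class_def tensor_null.null_zero)

lemma tensor_class_eqI: "p - q \<in> tensor_null h M \<Longrightarrow> tensor_class h M p = tensor_class h M q"
  unfolding tensor_class_def
proof (intro Collect_cong conj_cong refl)
  fix x assume d: "p - q \<in> tensor_null h M"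
  show "x - p \<in> tensor_null h M \<longleftrightarrow> x - q \<in> tensor_null h M"
    using tensor_null.null_add[OF _ d, of "x - p"] tensor_null_diff[OF _ d, of "x - q"]
    by (auto simp: algebra_simps)
qed

lemma tensor_class_eqD:
  "tensor_class h M p = tensor_class h M q \<Longrightarrow> Poly_Mapping.keys p \<subseteq> carrier M
    \<Longrightarrow> p - q \<in> tensor_null h M"
  using tensor_class_self[of p M h] by (auto simp: tensor_class_def)

lemma tensor_classD:
  "p' \<in> tensor_class h M p \<Longrightarrow> Poly_Mapping.keys p' \<subseteq> carrier M"
  "p' \<in> tensor_class h M p \<Longrightarrow> p' - p \<in> tensor_null h M"
  by (simp_all add: tensor_class_def)

text \<open>Operations on classes are unions over representatives. If the operation respects the
  relations then all classes in the union are equal.\<close>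

lemma Union_tensor_class:
  assumes "Poly_Mapping.keys p \<subseteq> carrier M"
    and "\<And>p'. p' \<in> tensor_class h M p \<Longrightarrow> F p' - F p \<in> tensor_null h' M'"
  shows "(\<Union>p'\<in>tensor_class h M p. tensor_class h' M' (F p')) = tensor_class h' M' (F p)"
proof -
  have "tensor_class h' M' (F p') = tensor_class h' M' (F p)" if "p' \<in> tensor_class h M p" for p'
    by (rule tensor_class_eqI) (use assms that in auto)
  then have "(\<Union>p'\<in>tensor_class h M p. tensor_class h' M' (F p'))
      = (\<Union>p'\<in>tensor_class h M p. tensor_class h' M' (F p))"
    by (intro SUP_cong refl)
  then show ?thesis using tensor_class_self[OF assms(1), of h] by auto
qed

lemma Union2_tensor_class:
  assumes "Poly_Mapping.keys p \<subseteq> carrier M1" "Poly_Mapping.keys q \<subseteq> carrier M2"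
    and "\<And>p' q'. p' \<in> tensor_class h1 M1 p \<Longrightarrow> q' \<in> tensor_class h2 M2 q
           \<Longrightarrow> F p' q' - F p q \<in> tensor_null h' M'"
  shows "(\<Union>p'\<in>tensor_class h1 M1 p. \<Union>q'\<in>tensor_class h2 M2 q. tensor_class h' M' (F p' q'))
           = tensor_class h' M' (F p q)"
proof -
  have "tensor_class h' M' (F p' q') = tensor_class h' M' (F p q)"
    if "p' \<in> tensor_class h1 M1 p" "q' \<in> tensor_class h2 M2 q" for p' q'
    by (rule tensor_class_eqI) (use assms that in auto)
  then have "(\<Union>p'\<in>tensor_class h1 M1 p. \<Union>q'\<in>tensor_class h2 M2 q. tensor_class h' M' (F p' q'))
      = (\<Union>p'\<in>tensor_class h1 M1 p. \<Union>q'\<in>tensor_class h2 M2 q. tensor_class h' M' (F p q))"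
    by (intro SUP_cong refl)
  then show ?thesis
    using tensor_class_self[OF assms(1), of h1] tensor_class_self[OF assms(2), of h2] by auto
qed

lemma tensor_class_add_union:
  assumes "Poly_Mapping.keys p \<subseteq> carrier M" "Poly_Mapping.keys q \<subseteq> carrier M"
  shows "(\<Union>p'\<in>tensor_class h M p. \<Union>q'\<in>tensor_class h M q. tensor_class h M (p' + q'))
           = tensor_class h M (p + q)"
proof (rule Union2_tensor_class[OF assms])
  fix p' q' assume "p' \<in> tensor_class h M p" "q' \<in> tensor_class h M q"
  then have "(p' - p) + (q' - q) \<in> tensor_null h M"
    by (intro tensor_null.null_add tensor_classD)
  then show "p' + q' - (p + q) \<in> tensor_null h M" by (simp add: algebra_simps)
qed

lemma tensor_class_smult_union:
  assumes "Poly_Mapping.keys p \<subseteq> carrier M"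
  shows "(\<Union>p'\<in>tensor_class h M p. tensor_class h M (pm_scale c p')) = tensor_class h M (pm_scale c p)"
proof (rule Union_tensor_class[OF assms])
  fix p' assume "p' \<in> tensor_class h M p"
  from tensor_null.null_scale[OF tensor_classD(2)[OF this], of c]
  show "pm_scale c p' - pm_scale c p \<in> tensor_null h M" by simp
qed

text \<open>By additivity in the second argument it suffices to consider one element of \<open>B\<close>, and pairing
  with it maps the relations that generate the null space of \<open>A\<close> to relations for \<open>C\<close>. Hence \<open>\<beta>\<close>
  induces a map on classes.\<close>

lemma bilinear_ext_null_left:
  assumes closed: "\<And>x y. x \<in> carrier A \<Longrightarrow> y \<in> carrier B \<Longrightarrow> \<beta> x y \<in> carrier C"
    and add: "\<And>x x' y. x \<in> carrier A \<Longrightarrow> x' \<in> carrier A \<Longrightarrow> y \<in> carrier B \<Longrightarrow>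
                \<beta> (x \<oplus>\<^bsub>A\<^esub> x') y = \<beta> x y \<oplus>\<^bsub>C\<^esub> \<beta> x' y"
    and smult: "\<And>a x y. x \<in> carrier A \<Longrightarrow> y \<in> carrier B \<Longrightarrow> \<beta> (a \<odot>\<^bsub>A\<^esub> x) y = a \<odot>\<^bsub>C\<^esub> \<beta> x y"
    and p: "p \<in> tensor_null h A" and q: "Poly_Mapping.keys q \<subseteq> carrier B"
  shows "bilinear_ext \<beta> p q \<in> tensor_null h C"
  using p
proof (induction rule: tensor_null.induct)
  case (null_add p p')
  then show ?case by (simp add: bilinear_ext_add_left tensor_null.null_add)
next
  case (null_scale p c)
  then show ?case by (simp add: bilinear_ext_scale_left tensor_null.null_scale)
next
  case (rel_add x y)
  show ?case
  proof (induction q rule: poly_mapping_span_induct)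
    case (single b)
    then have "b \<in> carrier B" using q by auto
    from tensor_null.null_scale[OF tensor_null.rel_add
        [OF closed[OF rel_add(1) this] closed[OF rel_add(2) this]], of "Poly_Mapping.lookup q b" h]
    show ?case
      by (simp add: bilinear_ext_diff_left add[OF rel_add \<open>b \<in> carrier B\<close>])
  qed (simp_all add: tensor_null.null_zero bilinear_ext_add_right tensor_null.null_add)
next
  case (rel_smult x a)
  show ?case
  proof (induction q rule: poly_mapping_span_induct)
    case (single b)
    then have "b \<in> carrier B" using q by auto
    from tensor_null.null_scale[OF tensor_null.rel_smult[OF closed[OF rel_smult this]],
        of "Poly_Mapping.lookup q b" a h]
    show ?case
      by (simp add: bilinear_ext_diff_left smult[OF rel_smult \<open>b \<in> carrier B\<close>] mult.commute)
  qed (simp_all add: tensor_null.null_zero bilinear_ext_add_right tensor_null.null_add)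
qed (simp add: tensor_null.null_zero)

lemma bilinear_ext_swap: "bilinear_ext \<beta> p q = bilinear_ext (\<lambda>y x. \<beta> x y) q p"
  unfolding bilinear_ext_def by (subst sum.swap) (simp add: mult.commute)

lemma bilinear_ext_class:
  assumes closed: "\<And>x y. x \<in> carrier A \<Longrightarrow> y \<in> carrier B \<Longrightarrow> \<beta> x y \<in> carrier C"
    and add_l: "\<And>x x' y. x \<in> carrier A \<Longrightarrow> x' \<in> carrier A \<Longrightarrow> y \<in> carrier B \<Longrightarrow>
                \<beta> (x \<oplus>\<^bsub>A\<^esub> x') y = \<beta> x y \<oplus>\<^bsub>C\<^esub> \<beta> x' y"
    and add_r: "\<And>x y y'. x \<in> carrier A \<Longrightarrow> y \<in> carrier B \<Longrightarrow> y' \<in> carrier B \<Longrightarrow>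
                \<beta> x (y \<oplus>\<^bsub>B\<^esub> y') = \<beta> x y \<oplus>\<^bsub>C\<^esub> \<beta> x y'"
    and smult_l: "\<And>a x y. x \<in> carrier A \<Longrightarrow> y \<in> carrier B \<Longrightarrow> \<beta> (a \<odot>\<^bsub>A\<^esub> x) y = a \<odot>\<^bsub>C\<^esub> \<beta> x y"
    and smult_r: "\<And>a x y. x \<in> carrier A \<Longrightarrow> y \<in> carrier B \<Longrightarrow> \<beta> x (a \<odot>\<^bsub>B\<^esub> y) = a \<odot>\<^bsub>C\<^esub> \<beta> x y"
    and p: "Poly_Mapping.keys p \<subseteq> carrier A" and q: "Poly_Mapping.keys q \<subseteq> carrier B"
  shows "(\<Union>p'\<in>tensor_class h A p. \<Union>q'\<in>tensor_class h B q. tensor_class h C (bilinear_ext \<beta> p' q'))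
           = tensor_class h C (bilinear_ext \<beta> p q)"
proof (rule Union2_tensor_class[OF p q])
  fix p' q' assume p': "p' \<in> tensor_class h A p" and q': "q' \<in> tensor_class h B q"
  have 1: "bilinear_ext \<beta> (p' - p) q' \<in> tensor_null h C"
    by (rule bilinear_ext_null_left
        [OF closed add_l smult_l tensor_classD(2)[OF p'] tensor_classD(1)[OF q']])
  have 2: "bilinear_ext \<beta> p (q' - q) \<in> tensor_null h C"
    by (subst bilinear_ext_swap)
      (rule bilinear_ext_null_left[OF closed add_r smult_r tensor_classD(2)[OF q'] p])
  from tensor_null.null_add[OF 1 2]
  show "bilinear_ext \<beta> p' q' - bilinear_ext \<beta> p q \<in> tensor_null h C"
    by (simp add: bilinear_ext_diff_left bilinear_ext_diff_right)
qed

subsection \<open>Extension of scalars for algebras and modules\<close>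

text \<open>Compatibility of the scalars with the product makes the latter descend to the extension of
  scalars.\<close>

locale scalar_algebra = ring A for A :: "('z, 'a) module" (structure) +
  assumes scalar_closed: "x \<in> carrier A \<Longrightarrow> c \<odot> x \<in> carrier A"
    and scalar_left: "x \<in> carrier A \<Longrightarrow> y \<in> carrier A \<Longrightarrow> (c \<odot> x) \<otimes> y = c \<odot> (x \<otimes> y)"
    and scalar_right: "x \<in> carrier A \<Longrightarrow> y \<in> carrier A \<Longrightarrow> x \<otimes> (c \<odot> y) = c \<odot> (x \<otimes> y)"

lemma tensor_algebra_simps:
  "carrier (tensor_algebra h A) = {tensor_class h A p | p. Poly_Mapping.keys p \<subseteq> carrier A}"
  "\<zero>\<^bsub>tensor_algebra h A\<^esub> = tensor_class h A 0"
  "\<one>\<^bsub>tensor_algebra h A\<^esub> = tensor_one h A \<one>\<^bsub>A\<^esub>"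
  by (simp_all add: tensor_algebra_def)

lemma tensor_algebra_add:
  "Poly_Mapping.keys p \<subseteq> carrier A \<Longrightarrow> Poly_Mapping.keys q \<subseteq> carrier A \<Longrightarrow>
   tensor_class h A p \<oplus>\<^bsub>tensor_algebra h A\<^esub> tensor_class h A q = tensor_class h A (p + q)"
  by (simp add: tensor_algebra_def tensor_class_add_union)

lemma tensor_algebra_smult:
  "Poly_Mapping.keys p \<subseteq> carrier A \<Longrightarrow>
   c \<odot>\<^bsub>tensor_algebra h A\<^esub> tensor_class h A p = tensor_class h A (pm_scale c p)"
  by (simp add: tensor_algebra_def tensor_class_smult_union)

lemma (in scalar_algebra) tensor_algebra_mult:
  assumes "Poly_Mapping.keys p \<subseteq> carrier A" "Poly_Mapping.keys q \<subseteq> carrier A"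
  shows "tensor_class h A p \<otimes>\<^bsub>tensor_algebra h A\<^esub> tensor_class h A q
           = tensor_class h A (bilinear_ext (mult A) p q)"
  unfolding tensor_algebra_def monoid.simps
  by (rule bilinear_ext_class[OF _ _ _ _ _ assms])
    (simp_all add: l_distr r_distr scalar_left scalar_right)

lemma tensor_one_closed: "x \<in> carrier A \<Longrightarrow> tensor_one h A x \<in> carrier (tensor_algebra h A)"
  by (auto simp: tensor_algebra_simps tensor_one_def intro!: exI[of _ "Poly_Mapping.single x 1"])

lemma (in scalar_algebra) tensor_one_ring_hom:
  "tensor_one h A \<in> ring_hom A (tensor_algebra h A)"
proof (rule ring_hom_memI)
  fix x y assume xy: "x \<in> carrier A" "y \<in> carrier A"
  show "tensor_one h A (x \<otimes> y) = tensor_one h A x \<otimes>\<^bsub>tensor_algebra h A\<^esub> tensor_one h A y"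
    using xy by (simp add: tensor_one_def tensor_algebra_mult)
  show "tensor_one h A (x \<oplus> y) = tensor_one h A x \<oplus>\<^bsub>tensor_algebra h A\<^esub> tensor_one h A y"
    using xy tensor_null.rel_add[of x A y h]
    by (simp add: tensor_one_def tensor_algebra_add tensor_class_eqI algebra_simps)
qed (simp_all add: tensor_one_closed tensor_algebra_simps(3))

lemma tensor_module_simps:
  "carrier (tensor_module h A M) =
     {tensor_class h (restrict_to_base A M) p | p. Poly_Mapping.keys p \<subseteq> carrier M}"
  "\<zero>\<^bsub>tensor_module h A M\<^esub> = tensor_class h (restrict_to_base A M) 0"
  by (simp_all add: tensor_module_def Let_def)

lemma carrier_restrict_to_base [simp]: "carrier (restrict_to_base A M) = carrier M"
  by (simp add: restrict_to_base_def)

lemma tensor_module_add: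
  "Poly_Mapping.keys p \<subseteq> carrier M \<Longrightarrow> Poly_Mapping.keys q \<subseteq> carrier M \<Longrightarrow>
   tensor_class h (restrict_to_base A M) p \<oplus>\<^bsub>tensor_module h A M\<^esub> tensor_class h (restrict_to_base A M) q
     = tensor_class h (restrict_to_base A M) (p + q)"
  by (simp add: tensor_module_def Let_def tensor_class_add_union)

lemma (in scalar_algebra) tensor_module_smult:
  assumes "left_module A M" "Poly_Mapping.keys p \<subseteq> carrier A" "Poly_Mapping.keys x \<subseteq> carrier M"
  shows "tensor_class h A p \<odot>\<^bsub>tensor_module h A M\<^esub> tensor_class h (restrict_to_base A M) x
           = tensor_class h (restrict_to_base A M) (bilinear_ext (smult M) p x)"
proof -
  interpret M: left_module A M by fact
  have unit: "c \<odot> a = (c \<odot> \<one>) \<otimes> a" "c \<odot> a = a \<otimes> (c \<odot> \<one>)" if "a \<in> carrier A" for c a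
    using that by (simp_all add: scalar_left scalar_right)
  show ?thesis
    unfolding tensor_module_def Let_def module.simps
  proof (rule bilinear_ext_class)
    fix c a m assume am: "a \<in> carrier A" "m \<in> carrier (restrict_to_base A M)"
    then show "(c \<odot> a) \<odot>\<^bsub>M\<^esub> m = c \<odot>\<^bsub>restrict_to_base A M\<^esub> (a \<odot>\<^bsub>M\<^esub> m)"
      by (simp add: restrict_to_base_def scalar_closed M.smult_assoc[symmetric] unit(1)[symmetric])
    show "a \<odot>\<^bsub>M\<^esub> (c \<odot>\<^bsub>restrict_to_base A M\<^esub> m) = c \<odot>\<^bsub>restrict_to_base A M\<^esub> (a \<odot>\<^bsub>M\<^esub> m)"
      using am
      by (simp add: restrict_to_base_def scalar_closed M.smult_assoc[symmetric] unit[symmetric])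
  qed (use assms in \<open>auto simp: restrict_to_base_def M.smult_closed M.smult_l_distr M.smult_r_distr\<close>)
qed

lemma tensor_module_abelian_group: "abelian_group (tensor_module h A M)"
proof (rule abelian_groupI)
  let ?T = "tensor_module h A M" and ?B = "restrict_to_base A M"
  fix x assume "x \<in> carrier ?T"
  then obtain p where p: "x = tensor_class h ?B p" "Poly_Mapping.keys p \<subseteq> carrier M"
    by (auto simp: tensor_module_simps)
  then show "\<zero>\<^bsub>?T\<^esub> \<oplus>\<^bsub>?T\<^esub> x = x"
    by (simp add: tensor_module_simps tensor_module_add)
  have np: "Poly_Mapping.keys (- p) \<subseteq> carrier M" using p(2) by (auto simp: in_keys_iff)
  then have "tensor_class h ?B (- p) \<oplus>\<^bsub>?T\<^esub> x = \<zero>\<^bsub>?T\<^esub>"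
    using p by (simp add: tensor_module_simps tensor_module_add)
  moreover have "tensor_class h ?B (- p) \<in> carrier ?T"
    using np unfolding tensor_module_simps by blast
  ultimately show "\<exists>y\<in>carrier ?T. y \<oplus>\<^bsub>?T\<^esub> x = \<zero>\<^bsub>?T\<^esub>" by blast
  fix y assume "y \<in> carrier ?T"
  then obtain q where q: "y = tensor_class h ?B q" "Poly_Mapping.keys q \<subseteq> carrier M"
    by (auto simp: tensor_module_simps)
  have pq: "Poly_Mapping.keys (p + q) \<subseteq> carrier M"
    using p(2) q(2) Poly_Mapping.keys_add[of p q] by blast
  then show "x \<oplus>\<^bsub>?T\<^esub> y \<in> carrier ?T"
    using p q by (auto simp: tensor_module_simps tensor_module_add)
  show "x \<oplus>\<^bsub>?T\<^esub> y = y \<oplus>\<^bsub>?T\<^esub> x"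
    using p q by (simp add: tensor_module_add add.commute)
  fix z assume "z \<in> carrier ?T"
  then obtain s where s: "z = tensor_class h ?B s" "Poly_Mapping.keys s \<subseteq> carrier M"
    by (auto simp: tensor_module_simps)
  have qs: "Poly_Mapping.keys (q + s) \<subseteq> carrier M"
    using s(2) q(2) Poly_Mapping.keys_add[of q s] by blast
  show "x \<oplus>\<^bsub>?T\<^esub> y \<oplus>\<^bsub>?T\<^esub> z = x \<oplus>\<^bsub>?T\<^esub> (y \<oplus>\<^bsub>?T\<^esub> z)"
    using p q s pq qs by (simp add: tensor_module_add add.assoc)
qed (auto simp: tensor_module_simps intro!: exI[of _ 0])

lemma (in scalar_algebra) left_module_tensor_module:
  assumes M: "left_module A M" and T: "ring (tensor_algebra h A)"
  shows "left_module (tensor_algebra h A) (tensor_module h A M)"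
proof (intro left_module.intro T tensor_module_abelian_group)
  interpret M: left_module A M by (rule M)
  let ?T = "tensor_algebra h A" and ?M = "tensor_module h A M"
  let ?c = "tensor_class h A" and ?d = "tensor_class h (restrict_to_base A M)"
  note smult = tensor_module_smult[OF M]
  have keys: "Poly_Mapping.keys (bilinear_ext (smult M) p x) \<subseteq> carrier M"
    if "Poly_Mapping.keys p \<subseteq> carrier A" "Poly_Mapping.keys x \<subseteq> carrier M" for p x
    by (rule keys_bilinear_ext) (use that in \<open>auto intro: M.smult_closed\<close>)
  have keys_mult: "Poly_Mapping.keys (bilinear_ext (mult A) p q) \<subseteq> carrier A"
    if "Poly_Mapping.keys p \<subseteq> carrier A" "Poly_Mapping.keys q \<subseteq> carrier A" for p q
    by (rule keys_bilinear_ext) (use that in auto)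
  have keys_sum: "Poly_Mapping.keys (p + q) \<subseteq> C"
    if "Poly_Mapping.keys p \<subseteq> C" "Poly_Mapping.keys q \<subseteq> C" for p q :: "'x \<Rightarrow>\<^sub>0 'y::comm_ring_1" and C
    using that Poly_Mapping.keys_add[of p q] by blast
  have TE: "\<exists>p. P = ?c p \<and> Poly_Mapping.keys p \<subseteq> carrier A" if "P \<in> carrier ?T" for P
    using that by (auto simp: tensor_algebra_simps)
  have ME: "\<exists>x. X = ?d x \<and> Poly_Mapping.keys x \<subseteq> carrier M" if "X \<in> carrier ?M" for X
    using that by (auto simp: tensor_module_simps)
  show "left_module_axioms ?T ?M"
  proof
    fix P X assume P: "P \<in> carrier ?T" and X: "X \<in> carrier ?M"
    obtain p where p: "P = ?c p" "Poly_Mapping.keys p \<subseteq> carrier A" using TE[OF P] by blast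
    obtain x where x: "X = ?d x" "Poly_Mapping.keys x \<subseteq> carrier M" using ME[OF X] by blast
    show "P \<odot>\<^bsub>?M\<^esub> X \<in> carrier ?M"
      using keys[OF p(2) x(2)] by (auto simp: p(1) x(1) smult[OF p(2) x(2)] tensor_module_simps)
    fix Y assume Y: "Y \<in> carrier ?M"
    obtain y where y: "Y = ?d y" "Poly_Mapping.keys y \<subseteq> carrier M" using ME[OF Y] by blast
    show "P \<odot>\<^bsub>?M\<^esub> (X \<oplus>\<^bsub>?M\<^esub> Y) = P \<odot>\<^bsub>?M\<^esub> X \<oplus>\<^bsub>?M\<^esub> P \<odot>\<^bsub>?M\<^esub> Y"
      using p x y by (simp add: smult tensor_module_add keys keys_sum bilinear_ext_add_right)
  next
    fix P P' X assume P: "P \<in> carrier ?T" "P' \<in> carrier ?T" and X: "X \<in> carrier ?M"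
    obtain p where p: "P = ?c p" "Poly_Mapping.keys p \<subseteq> carrier A" using TE[OF P(1)] by blast
    obtain q where q: "P' = ?c q" "Poly_Mapping.keys q \<subseteq> carrier A" using TE[OF P(2)] by blast
    obtain x where x: "X = ?d x" "Poly_Mapping.keys x \<subseteq> carrier M" using ME[OF X] by blast
    show "(P \<oplus>\<^bsub>?T\<^esub> P') \<odot>\<^bsub>?M\<^esub> X = P \<odot>\<^bsub>?M\<^esub> X \<oplus>\<^bsub>?M\<^esub> P' \<odot>\<^bsub>?M\<^esub> X"
      using p q x
      by (simp add: smult tensor_module_add tensor_algebra_add keys keys_sum bilinear_ext_add_left)
    have "bilinear_ext (smult M) (bilinear_ext (mult A) p q) x
        = bilinear_ext (smult M) p (bilinear_ext (smult M) q x)"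
      by (rule bilinear_ext_assoc) (use p q x in \<open>auto intro!: M.smult_assoc\<close>)
    then show "(P \<otimes>\<^bsub>?T\<^esub> P') \<odot>\<^bsub>?M\<^esub> X = P \<odot>\<^bsub>?M\<^esub> (P' \<odot>\<^bsub>?M\<^esub> X)"
      using p q x by (simp add: smult tensor_algebra_mult keys keys_mult)
  next
    fix X assume X: "X \<in> carrier ?M"
    obtain x where x: "X = ?d x" "Poly_Mapping.keys x \<subseteq> carrier M" using ME[OF X] by blast
    have "bilinear_ext (smult M) (Poly_Mapping.single \<one> 1) x = x"
    proof (induction x rule: poly_mapping_span_induct)
      case (single m)
      then show ?case using x(2) by (simp add: M.smult_one subset_iff)
    qed (simp_all add: bilinear_ext_add_right)
    then show "\<one>\<^bsub>?T\<^esub> \<odot>\<^bsub>?M\<^esub> X = X"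
      using x by (simp add: smult tensor_algebra_simps tensor_one_def)
  qed
qed

section \<open>Algebras by generators and relations\<close>

lemma free_algebra_carrier:
  "p \<in> carrier (free_algebra G) \<longleftrightarrow> (\<forall>w\<in>Poly_Mapping.keys p. set w \<subseteq> G)"
  by (simp add: free_algebra_def)

lemma free_algebra_ops [simp]:
  "p \<oplus>\<^bsub>free_algebra G\<^esub> q = p + q" "p \<otimes>\<^bsub>free_algebra G\<^esub> q = p * q"
  "\<zero>\<^bsub>free_algebra G\<^esub> = 0" "\<one>\<^bsub>free_algebra G\<^esub> = 1"
  by (simp_all add: free_algebra_def)

lemma free_algebra_mono: "G \<subseteq> H \<Longrightarrow> carrier (free_algebra G) \<subseteq> carrier (free_algebra H)"
  by (fastforce simp: free_algebra_carrier)

lemma free_algebra_single: "set w \<subseteq> G \<Longrightarrow> Poly_Mapping.single w c \<in> carrier (free_algebra G)"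
  by (simp add: free_algebra_carrier)

lemma free_algebra_zero: "0 \<in> carrier (free_algebra G)"
  and free_algebra_one: "1 \<in> carrier (free_algebra G)"
  and free_algebra_scal: "scal c \<in> carrier (free_algebra G)"
  and free_algebra_gen: "g \<in> G \<Longrightarrow> gen g \<in> carrier (free_algebra G)"
  by (simp_all add: free_algebra_carrier zero_list_def scal_def gen_def)

lemma free_algebra_add:
  "p \<in> carrier (free_algebra G) \<Longrightarrow> q \<in> carrier (free_algebra G) \<Longrightarrow> p + q \<in> carrier (free_algebra G)"
  using Poly_Mapping.keys_add[of p q] by (force simp: free_algebra_carrier)

lemma free_algebra_uminus:
  "p \<in> carrier (free_algebra G) \<Longrightarrow> - p \<in> carrier (free_algebra G)"
  by (simp add: free_algebra_carrier in_keys_iff)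

lemma free_algebra_diff:
  "p \<in> carrier (free_algebra G) \<Longrightarrow> q \<in> carrier (free_algebra G) \<Longrightarrow> p - q \<in> carrier (free_algebra G)"
  using free_algebra_add[of p G "- q"] free_algebra_uminus[of q G] by simp

lemma free_algebra_mult:
  "p \<in> carrier (free_algebra G) \<Longrightarrow> q \<in> carrier (free_algebra G) \<Longrightarrow> p * q \<in> carrier (free_algebra G)"
  using keys_mult[of p q] by (fastforce simp: free_algebra_carrier plus_list_def)

lemma free_algebra_sum:
  "(\<And>s. s \<in> S \<Longrightarrow> f s \<in> carrier (free_algebra G)) \<Longrightarrow> sum f S \<in> carrier (free_algebra G)"
  by (induction S rule: infinite_finite_induct) (auto intro: free_algebra_zero free_algebra_add)

lemma free_algebra_prod_list:
  "(\<And>p. p \<in> set ps \<Longrightarrow> p \<in> carrier (free_algebra G)) \<Longrightarrow> prod_list ps \<in> carrier (free_algebra G)"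
  by (induction ps) (auto intro: free_algebra_one free_algebra_mult)

lemmas free_algebra_intros =
  free_algebra_zero free_algebra_one free_algebra_scal free_algebra_gen free_algebra_add
  free_algebra_diff free_algebra_mult free_algebra_sum free_algebra_prod_list

lemma free_algebra_bracket:
  "x \<in> carrier (free_algebra G) \<Longrightarrow> y \<in> carrier (free_algebra G) \<Longrightarrow>
   bracket a x y \<in> carrier (free_algebra G)"
  unfolding bracket_def by (intro free_algebra_intros)

lemma free_algebra_exp_coeff:
  assumes "\<And>m. m > 0 \<Longrightarrow> a m \<in> carrier (free_algebra G)"
  shows "exp_coeff a s \<in> carrier (free_algebra G)"
proof -
  let ?f = "Abs_fps (\<lambda>m. if m = 0 then 0 else a m)"
  have "fps_nth (?f ^ k) s \<in> carrier (free_algebra G)" for k s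
  proof (induction k arbitrary: s)
    case (Suc k)
    have "fps_nth ?f i \<in> carrier (free_algebra G)" for i
      using assms by (simp add: free_algebra_zero)
    then show ?case unfolding power_Suc fps_mult_nth
      by (intro free_algebra_sum free_algebra_mult Suc)
  qed (simp add: free_algebra_zero free_algebra_one)
  then show ?thesis unfolding exp_coeff_def by (intro free_algebra_intros)
qed

lemma ring_free_algebra: "ring (free_algebra G)"
proof (rule ringI)
  show "abelian_group (free_algebra G)"
  proof (rule abelian_groupI)
    fix p assume "p \<in> carrier (free_algebra G)"
    then show "\<exists>q\<in>carrier (free_algebra G). q \<oplus>\<^bsub>free_algebra G\<^esub> p = \<zero>\<^bsub>free_algebra G\<^esub>"
      by (intro bexI[of _ "- p"]) (auto intro: free_algebra_uminus)
  qed (auto intro: free_algebra_intros simp: algebra_simps)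
  show "Group.monoid (free_algebra G)"
    by (rule monoidI) (auto intro: free_algebra_intros simp: mult.assoc)
qed (auto simp: algebra_simps)

lemma scal_simps [simp]:
  "scal 1 = 1" "scal 0 = 0" "scal c * scal d = scal (c * d)"
  by (simp_all add: scal_def mult_single plus_list_def) (simp add: single_one[symmetric] zero_list_def del: single_one)

lemma scal_uminus: "scal (- c) = - scal c"
  by (simp add: scal_def single_uminus)

lemma scal_times: "scal c * p = pm_scale c p"
  by (induction p rule: poly_mapping_span_induct) (simp_all add: scal_def mult_single plus_list_def distrib_left)

lemma times_scal: "p * scal c = pm_scale c p"
  by (induction p rule: poly_mapping_span_induct)
    (simp_all add: scal_def mult_single plus_list_def distrib_right mult.commute)

lemma scal_commute: "p * scal c = scal c * p"
  by (simp add: scal_times times_scal)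

lemma gen_times_single: "gen g * Poly_Mapping.single w c = Poly_Mapping.single (g # w) c"
  by (simp add: gen_def mult_single plus_list_def)

lemma scal_times_single: "scal c * Poly_Mapping.single w 1 = Poly_Mapping.single w c"
  by (simp add: scal_times)

context
  fixes G :: "'g set" and Rel :: "('g list \<Rightarrow>\<^sub>0 'k::comm_ring_1) set"
  assumes Rel: "Rel \<subseteq> carrier (free_algebra G)"
begin

lemma ideal_relations: "ideal (Idl\<^bsub>free_algebra G\<^esub> Rel) (free_algebra G)"
  by (rule ring.genideal_ideal[OF ring_free_algebra Rel])

lemma pres_class_hom: "pres_class G Rel \<in> ring_hom (free_algebra G) (presented_algebra G Rel)"
proof -
  have "pres_class G Rel = (+>\<^bsub>free_algebra G\<^esub>) (Idl\<^bsub>free_algebra G\<^esub> Rel)"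
    by (simp add: fun_eq_iff pres_class_def)
  then show ?thesis
    using ideal.rcos_ring_hom[OF ideal_relations]
    by (simp add: ring_hom_def presented_algebra_def Let_def)
qed

lemma presented_algebra_carrier:
  "carrier (presented_algebra G Rel) = pres_class G Rel ` carrier (free_algebra G)"
  by (auto simp: presented_algebra_def Let_def pres_class_def FactRing_def A_RCOSETS_def'
      a_r_coset_def' RCOSETS_def r_coset_def)

lemma presented_algebra_smult:
  assumes "p \<in> carrier (free_algebra G)"
  shows "c \<odot>\<^bsub>presented_algebra G Rel\<^esub> pres_class G Rel p = pres_class G Rel (scal c * p)"
  using ring_hom_mult[OF pres_class_hom free_algebra_scal assms]
  by (simp add: presented_algebra_def Let_def)

lemma pres_class_eqI:
  assumes "p \<in> carrier (free_algebra G)" "q \<in> carrier (free_algebra G)" "p - q \<in> Rel"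
  shows "pres_class G Rel p = pres_class G Rel q"
proof -
  interpret ideal "Idl\<^bsub>free_algebra G\<^esub> Rel" "free_algebra G" by (rule ideal_relations)
  have "p - q \<in> Idl\<^bsub>free_algebra G\<^esub> Rel"
    using assms(3) ring.genideal_self[OF ring_free_algebra Rel] by blast
  then have "p \<in> Idl\<^bsub>free_algebra G\<^esub> Rel +>\<^bsub>free_algebra G\<^esub> q"
    unfolding a_r_coset_def' by (force intro!: bexI[of _ "p - q"])
  from a_repr_independence'[OF this assms(2)] show ?thesis
    by (simp add: pres_class_def a_subgroup)
qed

end

section \<open>Laurent polynomials as rational functions\<close>

lemma cst_simps [simp]:
  "cst 0 = 0" "cst 1 = 1" "cst (a + b) = cst a + cst b" "cst (a * b) = cst a * cst b"
proof -
  show "cst 0 = 0" "cst 1 = 1" by (simp_all add: cst_def one_pCons[symmetric])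
  show "cst (a + b) = cst a + cst b" "cst (a * b) = cst a * cst b"
    by (simp_all add: cst_def to_fract_add[symmetric] to_fract_mult[symmetric] del: to_fract_add to_fract_mult)
qed

lemma qv_nonzero [simp]: "qv \<noteq> 0"
  by (simp add: qv_def)

lemma laurent_to_ratfun_lin_ext: "laurent_to_ratfun p = lin_ext (\<lambda>k c. cst c * qv powi k) p"
  by (simp add: laurent_to_ratfun_def lin_ext_def)

lemma laurent_to_ratfun_add [simp]:
  "laurent_to_ratfun (p + q) = laurent_to_ratfun p + laurent_to_ratfun q"
  unfolding laurent_to_ratfun_lin_ext by (rule lin_ext_add) (simp_all add: distrib_right)

lemma laurent_to_ratfun_zero [simp]: "laurent_to_ratfun 0 = 0"
  by (simp add: laurent_to_ratfun_lin_ext)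

lemma laurent_to_ratfun_single [simp]:
  "laurent_to_ratfun (Poly_Mapping.single k c) = cst c * qv powi k"
  by (simp add: laurent_to_ratfun_lin_ext lin_ext_single)

lemma laurent_to_ratfun_diff [simp]:
  "laurent_to_ratfun (p - q) = laurent_to_ratfun p - laurent_to_ratfun q"
  using laurent_to_ratfun_add[of "p - q" q] by (simp add: eq_diff_eq)

lemma laurent_to_ratfun_mult [simp]:
  "laurent_to_ratfun (p * q) = laurent_to_ratfun p * laurent_to_ratfun q"
proof (induction p rule: poly_mapping_span_induct)
  case (single k)
  show ?case
  proof (induction q rule: poly_mapping_span_induct)
    case (single l)
    show ?case by (simp add: mult_single power_int_add mult_ac)
  qed (simp_all add: distrib_left)
qed (simp_all add: distrib_right)

lemma laurent_to_ratfun_one [simp]: "laurent_to_ratfun 1 = 1"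
  using laurent_to_ratfun_single[of 0 1] by simp

text \<open>After multiplication with a power of \<open>v\<close> the image is a polynomial, whose coefficients are
  those of \<open>p\<close>.\<close>

lemma laurent_to_ratfun_eq_0_iff [simp]: "laurent_to_ratfun p = 0 \<longleftrightarrow> p = 0"
proof
  assume 0: "laurent_to_ratfun p = 0"
  \<comment> \<open>any \<open>m\<close> with \<open>k + m \<ge> 0\<close> for all exponents \<open>k\<close> would do\<close>
  define m where "m = (\<Sum>k\<in>Poly_Mapping.keys p. \<bar>k\<bar>)"
  have m: "k + m \<ge> 0" if "k \<in> Poly_Mapping.keys p" for k
  proof -
    have "\<bar>k\<bar> \<le> m" unfolding m_def using that by (intro member_le_sum) auto
    then show ?thesis by linarith
  qed
  define P where "P = (\<Sum>k\<in>Poly_Mapping.keys p. monom (Poly_Mapping.lookup p k) (nat (k + m)))"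
  have to_fract_monom: "to_fract (monom c i) = cst c * qv ^ i" for c i
  proof (induction i)
    case (Suc i)
    have "monom c (Suc i) = [:0, 1:] * monom c i" by (simp add: monom_Suc)
    then have "to_fract (monom c (Suc i)) = to_fract [:0, 1:] * to_fract (monom c i)"
      by (simp only: to_fract_mult)
    then show ?case by (simp add: Suc qv_def mult_ac)
  qed (simp add: monom_0 cst_def)
  have "to_fract P = (\<Sum>k\<in>Poly_Mapping.keys p. cst (Poly_Mapping.lookup p k) * qv powi (k + m))"
    unfolding P_def to_fract_sum to_fract_monom
    by (rule sum.cong) (use m in \<open>auto simp: power_int_def\<close>)
  also have "\<dots> = laurent_to_ratfun p * qv powi m"
    by (simp add: laurent_to_ratfun_def sum_distrib_right power_int_add mult.assoc)
  finally have "P = 0" using 0 by simp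
  show "p = 0"
  proof (rule ccontr)
    assume "p \<noteq> 0"
    then obtain k where k: "k \<in> Poly_Mapping.keys p" by (metis keys_eq_empty ex_in_conv)
    have "coeff P (nat (k + m)) = (\<Sum>l\<in>Poly_Mapping.keys p. if l = k then Poly_Mapping.lookup p l else 0)"
      unfolding P_def coeff_sum by (rule sum.cong) (use m k in \<open>auto simp: nat_eq_iff\<close>)
    also have "\<dots> = Poly_Mapping.lookup p k" using k by simp
    finally show False using \<open>P = 0\<close> k by (simp add: in_keys_iff)
  qed
qed simp

lemma laurent_to_ratfun_eq_iff [simp]: "laurent_to_ratfun p = laurent_to_ratfun q \<longleftrightarrow> p = q"
  using laurent_to_ratfun_eq_0_iff[of "p - q"] by (simp del: laurent_to_ratfun_eq_0_iff)

text \<open>Distinct monomials of Laurent polynomials are linearly independent, so \<open>v\<close> is not a root of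
  unity. This separates the eigenvalues \<open>v\<^sup>a\<close> of the \<open>k\<^sub>i\<close>.\<close>

lemma qv_powi_eq_iff [simp]: "qv powi a = qv powi b \<longleftrightarrow> a = b"
proof
  assume "qv powi a = qv powi b"
  then have "laurent_to_ratfun (Poly_Mapping.single a 1) = laurent_to_ratfun (Poly_Mapping.single b 1)"
    by simp
  then have "Poly_Mapping.single a (1::complex) = Poly_Mapping.single b 1"
    by (simp only: laurent_to_ratfun_eq_iff)
  then have "Poly_Mapping.keys (Poly_Mapping.single a (1::complex)) = Poly_Mapping.keys (Poly_Mapping.single b (1::complex))"
    by simp
  then show "a = b" by simp
qed simp

lemma to_fract_in_range_laurent: "to_fract P \<in> range laurent_to_ratfun"
proof (induction P)
  case (pCons a P)
  then obtain p where p: "to_fract P = laurent_to_ratfun p" by blast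
  have "to_fract (pCons a P) = to_fract [:a:] + to_fract [:0, 1:] * to_fract P"
    by (simp flip: to_fract_add to_fract_mult)
  also have "\<dots> = laurent_to_ratfun (Poly_Mapping.single 0 a + lv * p)"
    by (simp add: p lv_def cst_def[symmetric] qv_def[symmetric])
  finally show ?case by blast
qed (auto intro!: image_eqI[of _ _ 0])

lemma common_laurent_denominator:
  fixes c :: "'a \<Rightarrow> ratfun"
  assumes "finite S"
  obtains b a where "b \<noteq> 0" "\<And>s. s \<in> S \<Longrightarrow> c s * laurent_to_ratfun b = laurent_to_ratfun (a s)"
proof -
  have "\<exists>b. b \<noteq> 0 \<and> (\<forall>s\<in>S. c s * laurent_to_ratfun b \<in> range laurent_to_ratfun)"
    using assms
  proof (induction S rule: finite_induct)
    case (insert x S)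
    then obtain b where b: "b \<noteq> 0" "\<And>s. s \<in> S \<Longrightarrow> c s * laurent_to_ratfun b \<in> range laurent_to_ratfun"
      by blast
    obtain P D where PD: "c x = Fract P D" "D \<noteq> 0" by (cases "c x") auto
    obtain p d where pd: "to_fract P = laurent_to_ratfun p" "to_fract D = laurent_to_ratfun d"
      using to_fract_in_range_laurent by (metis imageE)
    have d: "d \<noteq> 0" using PD(2) pd(2) by auto
    have cx: "c x * laurent_to_ratfun d = laurent_to_ratfun p"
      using PD d by (simp add: Fract_conv_to_fract pd)
    show ?case
    proof (intro exI[of _ "d * b"] conjI ballI)
      show "d * b \<noteq> 0" using b(1) d by simp
      fix s assume "s \<in> insert x S"
      then consider "s = x" | "s \<in> S" by blast
      then show "c s * laurent_to_ratfun (d * b) \<in> range laurent_to_ratfun"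
      proof cases
        case 1
        then have "c s * laurent_to_ratfun (d * b) = laurent_to_ratfun (p * b)"
          by (simp add: cx mult.assoc[symmetric])
        then show ?thesis by blast
      next
        case 2
        then obtain e where "c s * laurent_to_ratfun b = laurent_to_ratfun e" using b(2) by blast
        then have "c s * laurent_to_ratfun (d * b) = laurent_to_ratfun (d * e)"
          by (simp add: mult_ac)
        then show ?thesis by blast
      qed
    qed
  qed (auto intro!: exI[of _ 1])
  then obtain b where b: "b \<noteq> 0" "\<forall>s\<in>S. \<exists>a. c s * laurent_to_ratfun b = laurent_to_ratfun a"
    by blast
  from b(2) obtain a where "\<forall>s\<in>S. c s * laurent_to_ratfun b = laurent_to_ratfun (a s)"
    by metis
  with b(1) that show thesis by blast
qed

section \<open>Weight vectors for the quantum affine algebra\<close>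

abbreviation qaff_alg :: "nat \<Rightarrow> qaff_free set" where
  "qaff_alg N \<equiv> carrier (free_algebra (qaff_gens N))"

lemma qaff_gens_mem [simp]:
  "Xg e i s \<in> qaff_gens N \<longleftrightarrow> e \<in> {1, -1} \<and> 1 \<le> i \<and> i < N"
  "Kg i \<in> qaff_gens N \<longleftrightarrow> 1 \<le> i \<and> i \<le> N"
  "Kg_inv i \<in> qaff_gens N \<longleftrightarrow> 1 \<le> i \<and> i \<le> N"
  "Gg i t \<in> qaff_gens N \<longleftrightarrow> 1 \<le> i \<and> i \<le> N \<and> t \<noteq> 0"
  by (auto simp: qaff_gens_def)

text \<open>The \<open>k\<close> and \<open>g\<close> are included so that the commutators of the \<open>x\<^sup>+\<close> with the \<open>x\<^sup>-\<close> are
  expressions in these letters.\<close>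

definition lowering_gens :: "nat \<Rightarrow> qaff_gen set" where
  "lowering_gens N = qaff_gens N - {Xg 1 j s | j s. True}"

lemma lowering_gens_subset: "lowering_gens N \<subseteq> qaff_gens N"
  by (auto simp: lowering_gens_def)

lemma lowering_gens_mem [simp]:
  "Xg e i s \<in> lowering_gens N \<longleftrightarrow> e = - 1 \<and> 1 \<le> i \<and> i < N"
  "Kg i \<in> lowering_gens N \<longleftrightarrow> 1 \<le> i \<and> i \<le> N"
  "Kg_inv i \<in> lowering_gens N \<longleftrightarrow> 1 \<le> i \<and> i \<le> N"
  "Gg i t \<in> lowering_gens N \<longleftrightarrow> 1 \<le> i \<and> i \<le> N \<and> t \<noteq> 0"
  by (auto simp: lowering_gens_def)

lemma phi_lowering:
  assumes "1 \<le> i" "i < N" "e \<in> {1, - 1}"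
  shows "phi N e i s \<in> carrier (free_algebra (lowering_gens N))"
proof -
  have "k_tilde N e i \<in> carrier (free_algebra (lowering_gens N))"
    unfolding k_tilde_def next_index_def using assms
    by (auto intro!: free_algebra_intros)
  moreover have "scal (of_int e * (qv - inverse qv)) * h_elt i (e * int m)
      \<in> carrier (free_algebra (lowering_gens N))" if "m > 0" for m
    unfolding h_elt_def using assms that by (auto intro!: free_algebra_intros)
  ultimately show ?thesis
    by (simp add: phi_def free_algebra_zero free_algebra_mult free_algebra_exp_coeff del: of_int_mult)
qed

lemma lowering_in_qaff_alg: "p \<in> carrier (free_algebra (lowering_gens N)) \<Longrightarrow> p \<in> qaff_alg N"
  using free_algebra_mono[OF lowering_gens_subset] by blast

lemma Q_elt_in_qaff_alg:
  assumes "1 \<le> i" "i \<le> N"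
  shows "Q_elt i s \<in> qaff_alg N"
  unfolding Q_elt_def Let_def minus_mult_left[symmetric]
  using assms by (intro free_algebra_exp_coeff free_algebra_uminus free_algebra_mult) (auto intro!: free_algebra_intros)

lemma qaff_rels_subset: "qaff_rels N \<subseteq> qaff_alg N"
  unfolding qaff_rels_def
  by (intro Un_least subsetI; elim CollectE exE conjE; hypsubst)
    (auto intro!: free_algebra_intros free_algebra_bracket lowering_in_qaff_alg[OF phi_lowering])

lemma qaff_class_hom: "qaff_class N \<in> ring_hom (free_algebra (qaff_gens N)) (qaff N)"
  unfolding qaff_class_def qaff_def by (rule pres_class_hom[OF qaff_rels_subset])

lemma qaff_class_eqI:
  "p \<in> qaff_alg N \<Longrightarrow> q \<in> qaff_alg N \<Longrightarrow> p - q \<in> qaff_rels N \<Longrightarrow> qaff_class N p = qaff_class N q"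
  unfolding qaff_class_def by (rule pres_class_eqI[OF qaff_rels_subset])

lemma qaff_carrier: "carrier (qaff N) = qaff_class N ` qaff_alg N"
  unfolding qaff_class_def qaff_def by (rule presented_algebra_carrier[OF qaff_rels_subset])

lemma qaff_class_closed: "p \<in> qaff_alg N \<Longrightarrow> qaff_class N p \<in> carrier (qaff N)"
  by (simp add: qaff_carrier)

lemma qaff_smult:
  "p \<in> qaff_alg N \<Longrightarrow> c \<odot>\<^bsub>qaff N\<^esub> qaff_class N p = qaff_class N (scal c * p)"
  unfolding qaff_class_def qaff_def by (rule presented_algebra_smult[OF qaff_rels_subset])

lemma rel_k_inv_k: "1 \<le> i \<Longrightarrow> i \<le> N \<Longrightarrow> k_inv i * k_gen i - 1 \<in> qaff_rels N"
  unfolding qaff_rels_def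
  \<comment> \<open>this tries the families of relations in the union from the last to the first\<close>
  by ((rule UnI2, intro CollectI exI conjI, rule refl; simp) | rule UnI1)+

lemma rel_k_x:
  "e \<in> {1, - 1} \<Longrightarrow> 1 \<le> i \<Longrightarrow> i \<le> N \<Longrightarrow> 1 \<le> j \<Longrightarrow> j < N \<Longrightarrow>
   k_gen i * x_gen e j s - scal (qv powi (e * (of_bool (i = j) - of_bool (i = j + 1)))) * x_gen e j s * k_gen i
     \<in> qaff_rels N"
  unfolding qaff_rels_def
  by ((rule UnI2, intro CollectI exI conjI, rule refl; simp) | rule UnI1)+

lemma rel_k_g:
  "1 \<le> i \<Longrightarrow> i \<le> N \<Longrightarrow> 1 \<le> j \<Longrightarrow> j \<le> N \<Longrightarrow> s \<noteq> 0 \<Longrightarrow>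
   bracket 1 (k_gen i) (g_gen j s) \<in> qaff_rels N"
  unfolding qaff_rels_def
  by ((rule UnI2, intro CollectI exI conjI, rule refl; simp) | rule UnI1)+

lemma rel_g_x:
  assumes "e \<in> {1, - 1}" "1 \<le> i" "i \<le> N" "1 \<le> j" "j < N" "s \<noteq> 0"
  obtains c where "bracket 1 (g_gen i s) (x_gen e j t) - scal c * x_gen e j (s + t) \<in> qaff_rels N"
proof -
  let ?c = "of_int e * qv powi (- int j * s) * qint s / of_int s :: ratfun"
  consider "i = j" | "i = j + 1" | "i \<noteq> j" "i \<noteq> j + 1" by blast
  then show thesis
  proof cases
    case 1
    have "bracket 1 (g_gen j s) (x_gen e j t) - scal ?c * x_gen e j (s + t) \<in> qaff_rels N"
      unfolding qaff_rels_def
  by (insert assms, ((rule UnI2, intro CollectI exI conjI, rule refl; simp) | rule UnI1)+)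
    then show thesis using that 1 by blast
  next
    case 2
    have "bracket 1 (g_gen (j + 1) s) (x_gen e j t) + scal ?c * x_gen e j (s + t) \<in> qaff_rels N"
      unfolding qaff_rels_def
  by (insert assms, ((rule UnI2, intro CollectI exI conjI, rule refl; simp) | rule UnI1)+)
    moreover have "- (scal (- ?c) * x_gen e j (s + t)) = scal ?c * x_gen e j (s + t)"
      by (simp add: scal_uminus)
    ultimately show thesis using that[of "- ?c"] 2 by (simp only: diff_conv_add_uminus)
  next
    case 3
    have "bracket 1 (g_gen i s) (x_gen e j t) \<in> qaff_rels N"
      unfolding qaff_rels_def
  by (insert assms 3, ((rule UnI2, intro CollectI exI conjI, rule refl; simp) | rule UnI1)+)
    then show thesis using that[of 0] by simp
  qed
qed

lemma rel_x_x:
  "1 \<le> i \<Longrightarrow> i < N \<Longrightarrow> 1 \<le> j \<Longrightarrow> j < N \<Longrightarrow>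
   bracket 1 (x_gen 1 i s) (x_gen (-1) j t)
     - (if i = j then scal (1 / (qv - inverse qv)) * (phi N 1 i (s + t) - phi N (-1) i (s + t)) else 0)
     \<in> qaff_rels N"
  unfolding qaff_rels_def
  by ((rule UnI2, intro CollectI exI conjI, rule refl; simp) | rule UnI1)+

text \<open>The pairing of a weight with the fundamental coweight of the \<open>n\<close>-th simple root. It separates
  the generators \<open>x\<^sup>\<plusminus>\<^bsub>n,s\<^esub>\<close> from all others, which preserve it.\<close>

definition weight_height :: "nat \<Rightarrow> (nat \<Rightarrow> int) \<Rightarrow> int" where
  "weight_height n a = (\<Sum>i=1..n. a i)"

locale qaff_module =
  fixes N :: nat and M :: "(qaff_free set, 'm) module" (structure)
  assumes left_module: "left_module (qaff N) M"
begin

sublocale M: left_module "qaff N" M by (rule left_module)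

definition op :: "qaff_free \<Rightarrow> 'm \<Rightarrow> 'm" where
  "op p x = qaff_class N p \<odot> x"

lemma op_closed: "p \<in> qaff_alg N \<Longrightarrow> x \<in> carrier M \<Longrightarrow> op p x \<in> carrier M"
  by (simp add: op_def M.smult_closed qaff_class_closed)

lemma op_add:
  "p \<in> qaff_alg N \<Longrightarrow> q \<in> qaff_alg N \<Longrightarrow> x \<in> carrier M \<Longrightarrow> op (p + q) x = op p x \<oplus> op q x"
  using ring_hom_add[OF qaff_class_hom, of p N q]
  by (simp add: op_def M.smult_l_distr qaff_class_closed)

lemma op_mult:
  "p \<in> qaff_alg N \<Longrightarrow> q \<in> qaff_alg N \<Longrightarrow> x \<in> carrier M \<Longrightarrow> op (p * q) x = op p (op q x)"
  using ring_hom_mult[OF qaff_class_hom, of p N q]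
  by (simp add: op_def M.smult_assoc qaff_class_closed)

lemma op_one: "x \<in> carrier M \<Longrightarrow> op 1 x = x"
  using ring_hom_one[OF qaff_class_hom, of N] by (simp add: op_def M.smult_one)

lemma op_add_right:
  "p \<in> qaff_alg N \<Longrightarrow> x \<in> carrier M \<Longrightarrow> y \<in> carrier M \<Longrightarrow> op p (x \<oplus> y) = op p x \<oplus> op p y"
  by (simp add: op_def M.smult_r_distr qaff_class_closed)

lemma op_zero_left: "x \<in> carrier M \<Longrightarrow> op 0 x = \<zero>"
  using op_add[of 0 0 x] op_closed[of 0 x] by (simp add: free_algebra_zero M.add.l_cancel_one)

lemma op_zero_right: "p \<in> qaff_alg N \<Longrightarrow> op p \<zero> = \<zero>"
  using op_add_right[of p \<zero> \<zero>] op_closed[of p \<zero>] by (simp add: M.add.l_cancel_one)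

lemma op_relation:
  "p \<in> qaff_alg N \<Longrightarrow> q \<in> qaff_alg N \<Longrightarrow> p - q \<in> qaff_rels N \<Longrightarrow> op p x = op q x"
  using qaff_class_eqI by (simp add: op_def)

lemma op_scal_commute:
  "p \<in> qaff_alg N \<Longrightarrow> x \<in> carrier M \<Longrightarrow> op p (op (scal c) x) = op (scal c) (op p x)"
  using op_mult[of p "scal c" x] op_mult[of "scal c" p x]
  by (simp add: free_algebra_scal scal_commute[of p])

lemma op_scal_scal: "x \<in> carrier M \<Longrightarrow> op (scal c) (op (scal d) x) = op (scal (c * d)) x"
  using op_mult[of "scal c" "scal d" x] by (simp add: free_algebra_scal)

definition weight_vector :: "(nat \<Rightarrow> int) \<Rightarrow> 'm \<Rightarrow> bool" where
  "weight_vector a x \<longleftrightarrow>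
     x \<in> carrier M \<and> (\<forall>i\<in>{1..N}. op (k_gen i) x = op (scal (qv powi a i)) x)"

lemma weight_vector_scal: "weight_vector a x \<Longrightarrow> weight_vector a (op (scal c) x)"
  by (simp add: weight_vector_def op_closed free_algebra_scal
      op_scal_commute[OF free_algebra_gen] op_scal_scal mult.commute)

text \<open>The quantum form of the fact that root vectors shift weights.\<close>

lemma weight_vector_shift:
  assumes x: "weight_vector a x" and p: "p \<in> qaff_alg N"
    and rel: "\<And>i. i \<in> {1..N} \<Longrightarrow> k_gen i * p - scal (qv powi c i) * p * k_gen i \<in> qaff_rels N"
  shows "weight_vector (\<lambda>i. c i + a i) (op p x)"
  unfolding weight_vector_def
proof (intro conjI ballI)
  have xM: "x \<in> carrier M" using x by (simp add: weight_vector_def)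
  then show "op p x \<in> carrier M" using p by (simp add: op_closed)
  fix i assume i: "i \<in> {1..N}"
  then have k: "k_gen i \<in> qaff_alg N" by (simp add: free_algebra_gen)
  have "op (k_gen i) (op p x) = op (k_gen i * p) x"
    using k p xM by (simp add: op_mult)
  also have "\<dots> = op (scal (qv powi c i) * p * k_gen i) x"
    by (rule op_relation) (use k p rel[OF i] in \<open>auto intro!: free_algebra_intros\<close>)
  also have "\<dots> = op (scal (qv powi c i)) (op p (op (k_gen i) x))"
    using k p xM by (simp add: op_mult op_closed free_algebra_intros)
  also have "op (k_gen i) x = op (scal (qv powi a i)) x"
    using x i by (simp add: weight_vector_def)
  finally show "op (k_gen i) (op p x) = op (scal (qv powi (c i + a i))) (op p x)"
    using p xM by (simp add: op_scal_commute[OF p] op_scal_scal op_closed power_int_add)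
qed

lemma op_k_inv:
  assumes x: "weight_vector a x" and i: "1 \<le> i" "i \<le> N"
  shows "op (k_inv i) x = op (scal (qv powi (- a i))) x"
proof -
  have xM: "x \<in> carrier M" using x by (simp add: weight_vector_def)
  have k: "k_gen i \<in> qaff_alg N" "k_inv i \<in> qaff_alg N" using i by (simp_all add: free_algebra_gen)
  have "x = op (k_inv i * k_gen i) x"
  proof -
    have "op (k_inv i * k_gen i) x = op 1 x"
      by (rule op_relation) (use k i in \<open>auto intro!: free_algebra_intros rel_k_inv_k\<close>)
    also have "\<dots> = x" using xM by (rule op_one)
    finally show ?thesis by (rule sym)
  qed
  also have "\<dots> = op (scal (qv powi a i)) (op (k_inv i) x)"
    using x xM i k by (simp add: op_mult op_scal_commute[OF k(2)] weight_vector_def)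
  finally have "op (scal (qv powi (- a i))) x
      = op (scal (qv powi (- a i))) (op (scal (qv powi a i)) (op (k_inv i) x))"
    by (rule arg_cong)
  then show ?thesis
    using xM k by (simp add: op_scal_scal op_closed op_one power_int_add[symmetric])
qed

text \<open>The \<open>k\<close> and \<open>g\<close> preserve weights, and \<open>x\<^sup>-\<^bsub>j,s\<^esub>\<close> lowers \<open>a\<^sub>j\<close> and raises \<open>a\<^bsub>j+1\<^esub>\<close> by one,
  which changes \<open>a\<^sub>1 + \<dots> + a\<^sub>n\<close> only for \<open>j = n\<close>.\<close>

lemma weight_vector_lowering:
  assumes x: "weight_vector a x" and g: "g \<in> lowering_gens N" and n: "n \<le> N"
  obtains b where "weight_vector b (op (gen g) x)" "weight_height n b \<le> weight_height n a"
proof (cases g)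
  case (Xg e j s)
  then have j: "e = - 1" "1 \<le> j" "j < N" using g by auto
  let ?c = "\<lambda>i. e * (of_bool (i = j) - of_bool (i = j + 1)) :: int"
  have "weight_vector (\<lambda>i. ?c i + a i) (op (gen g) x)"
    unfolding Xg by (rule weight_vector_shift[OF x free_algebra_gen rel_k_x]) (use j in auto)
  moreover have "weight_height n (\<lambda>i. ?c i + a i) \<le> weight_height n a"
  proof -
    have "(\<Sum>i=1..n. ?c i) = of_bool (j + 1 \<in> {1..n}) - of_bool (j \<in> {1..n})"
      by (simp add: j(1) sum_subtractf of_bool_def)
    then show ?thesis using j by (simp add: weight_height_def sum.distrib)
  qed
  ultimately show ?thesis by (rule that)
next
  case (Kg j)
  then have "op (gen g) x = op (scal (qv powi a j)) x"
    using x g by (simp add: weight_vector_def)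
  then have "weight_vector a (op (gen g) x)" using weight_vector_scal[OF x] by simp
  then show ?thesis by (rule that) simp
next
  case (Kg_inv j)
  then have "op (gen g) x = op (scal (qv powi (- a j))) x"
    using op_k_inv[OF x] g by simp
  then have "weight_vector a (op (gen g) x)" using weight_vector_scal[OF x] by simp
  then show ?thesis by (rule that) simp
next
  case (Gg j t)
  then have j: "1 \<le> j" "j \<le> N" "t \<noteq> 0" using g by auto
  have "weight_vector (\<lambda>i. 0 + a i) (op (gen g) x)"
  proof (rule weight_vector_shift[OF x])
    fix i assume "i \<in> {1..N}"
    then show "k_gen i * gen g - scal (qv powi 0) * gen g * k_gen i \<in> qaff_rels N"
      using rel_k_g[of i N j t] Gg j by (simp add: bracket_def)
  qed (use Gg j in \<open>simp add: free_algebra_gen\<close>)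
  then show ?thesis using that by simp
qed

lemma op_k_prod:
  assumes x: "weight_vector a x" and "set is \<subseteq> {1..N}"
  shows "op (\<Prod>i\<leftarrow>is. k_gen i) x = op (scal (qv powi (\<Sum>i\<leftarrow>is. a i))) x"
  using assms(2)
proof (induction "is")
  case (Cons i "is")
  have xM: "x \<in> carrier M" using x by (simp add: weight_vector_def)
  have k: "k_gen j \<in> qaff_alg N" if "j \<in> set (i # is)" for j
    using that Cons.prems by (intro free_algebra_gen) auto
  have "op (\<Prod>j\<leftarrow>i # is. k_gen j) x = op (k_gen i) (op (\<Prod>j\<leftarrow>is. k_gen j) x)"
    using op_mult[OF k free_algebra_prod_list xM, of i "map k_gen is"] k by auto
  also have "op (\<Prod>j\<leftarrow>is. k_gen j) x = op (scal (qv powi (\<Sum>j\<leftarrow>is. a j))) x"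
    using Cons by simp
  also have "op (k_gen i) \<dots> = op (scal (qv powi (\<Sum>j\<leftarrow>is. a j))) (op (scal (qv powi a i)) x)"
    using x Cons.prems op_scal_commute[OF k xM, of i] by (simp add: weight_vector_def)
  finally show ?case
    using xM by (simp add: op_scal_scal power_int_add mult.commute)
qed simp

end

locale highest_weight_module = qaff_module +
  fixes hw :: "'a" and a\<^sub>0 :: "nat \<Rightarrow> int"
  assumes hw_weight: "weight_vector a\<^sub>0 hw"
    and hw_raising: "\<And>j s. 1 \<le> j \<Longrightarrow> j < N \<Longrightarrow> op (x_gen 1 j s) hw = \<zero>"
    and hw_generates: "carrier M = (\<lambda>p. op p hw) ` qaff_alg N"
begin

lemma hw_closed: "hw \<in> carrier M"
  using hw_weight by (simp add: weight_vector_def)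

definition lowered :: "'a set" where
  "lowered = (\<lambda>p. op p hw) ` carrier (free_algebra (lowering_gens N))"

lemma loweredI: "p \<in> carrier (free_algebra (lowering_gens N)) \<Longrightarrow> op p hw \<in> lowered"
  unfolding lowered_def by (rule imageI)

lemma lowered_subset: "lowered \<subseteq> carrier M"
  by (auto simp: lowered_def op_closed hw_closed lowering_in_qaff_alg)

lemma lowered_op:
  assumes "p \<in> carrier (free_algebra (lowering_gens N))" "x \<in> lowered"
  shows "op p x \<in> lowered"
proof -
  obtain q where q: "q \<in> carrier (free_algebra (lowering_gens N))" "x = op q hw"
    using assms(2) by (auto simp: lowered_def)
  then have "op p x = op (p * q) hw"
    using assms(1) by (simp add: op_mult hw_closed lowering_in_qaff_alg)
  then show ?thesis using assms(1) q(1) by (simp add: loweredI free_algebra_mult)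
qed

lemma lowered_add: "x \<in> lowered \<Longrightarrow> y \<in> lowered \<Longrightarrow> x \<oplus> y \<in> lowered"
  by (auto simp: lowered_def op_add[symmetric] hw_closed lowering_in_qaff_alg intro!: imageI free_algebra_add)

lemma zero_lowered: "\<zero> \<in> lowered"
  using loweredI[OF free_algebra_zero] by (simp add: op_zero_left hw_closed)

text \<open>The commutator of \<open>x\<^sup>+\<close> with a letter \<open>x\<^sup>-\<close> is an expression in the \<open>k\<close> and \<open>g\<close>, and with
  \<open>g\<close> it is again a multiple of some \<open>x\<^sup>+\<close>; so \<open>x\<^sup>+\<close> moves through a lowering word until
  it meets the highest weight vector. The letters \<open>k\<^sub>i\<^sup>\<plusminus>\<^sup>1\<close> act by scalars on a word.\<close>

lemma lowering_word:
  assumes "set w \<subseteq> lowering_gens N" "n \<le> N"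
  shows "(\<exists>a. weight_vector a (op (Poly_Mapping.single w 1) hw) \<and> weight_height n a \<le> weight_height n a\<^sub>0) \<and>
    (\<forall>j s. 1 \<le> j \<and> j < N \<longrightarrow> op (x_gen 1 j s) (op (Poly_Mapping.single w 1) hw) \<in> lowered)"
  using assms(1)
proof (induction w)
  case Nil
  have "Poly_Mapping.single [] 1 = (1 :: qaff_free)"
    by (simp add: zero_list_def flip: single_one)
  then show ?case using hw_weight hw_raising hw_closed zero_lowered by (auto simp: op_one)
next
  case (Cons g w)
  define x where "x = op (Poly_Mapping.single w 1) hw"
  have g: "g \<in> lowering_gens N" and w: "set w \<subseteq> lowering_gens N" using Cons.prems by auto
  have gA: "gen g \<in> qaff_alg N" using g lowering_gens_subset by (auto intro: free_algebra_gen)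
  have wA: "Poly_Mapping.single w 1 \<in> qaff_alg N" using w lowering_gens_subset by (auto intro: free_algebra_single)
  from Cons.IH[OF w] obtain a where a: "weight_vector a x" "weight_height n a \<le> weight_height n a\<^sub>0"
    and raise: "\<And>j s. 1 \<le> j \<Longrightarrow> j < N \<Longrightarrow> op (x_gen 1 j s) x \<in> lowered"
    unfolding x_def by blast
  have xM: "x \<in> carrier M" using a by (simp add: weight_vector_def)
  have xL: "x \<in> lowered" unfolding x_def by (intro loweredI free_algebra_single w)
  have step: "op (Poly_Mapping.single (g # w) 1) hw = op (gen g) x"
    unfolding x_def using op_mult[OF gA wA hw_closed] by (simp add: gen_times_single)
  obtain b where b: "weight_vector b (op (gen g) x)" "weight_height n b \<le> weight_height n a"
    by (rule weight_vector_lowering[OF a(1) g assms(2)])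
  have "op (x_gen 1 j s) (op (gen g) x) \<in> lowered" if j: "1 \<le> j" "j < N" for j s
  proof -
    let ?X = "x_gen 1 j s"
    have X: "x_gen 1 j s' \<in> qaff_alg N" for s' using j by (simp add: free_algebra_gen)
    have gL: "gen g \<in> carrier (free_algebra (lowering_gens N))" using g by (rule free_algebra_gen)
    have scalL: "scal c \<in> carrier (free_algebra (lowering_gens N))" for c by (rule free_algebra_scal)
    have scalar: "op ?X (op (scal c) x) \<in> lowered" for c
      using op_scal_commute[OF X xM] lowered_op[OF scalL raise[OF j]] by simp
    have past: "op ?X (op (gen g) x) = op (gen g) (op ?X x) \<oplus> op r x"
      if "?X * gen g - (gen g * ?X + r) \<in> qaff_rels N \<or> gen g * ?X + r - ?X * gen g \<in> qaff_rels N"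
        and r: "r \<in> qaff_alg N" for r
    proof -
      have "?X * gen g \<in> qaff_alg N" "gen g * ?X + r \<in> qaff_alg N"
        using X[of s] gA r by (simp_all add: free_algebra_mult free_algebra_add)
      then have "op (?X * gen g) x = op (gen g * ?X + r) x"
        using that(1) op_relation by metis
      then show ?thesis
        using X[of s] gA r xM by (simp add: op_mult op_add free_algebra_intros)
    qed
    show ?thesis
    proof (cases g)
      case (Xg e i t)
      then have i: "e = - 1" "1 \<le> i" "i < N" using g by auto
      define r where "r = (if j = i then scal (1 / (qv - inverse qv)) * (phi N 1 j (s + t) - phi N (-1) j (s + t)) else 0)"
      have r: "r \<in> carrier (free_algebra (lowering_gens N))"
        unfolding r_def using j i by (auto intro!: free_algebra_intros phi_lowering)
      have "bracket 1 ?X (gen g) - r \<in> qaff_rels N"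
        using rel_x_x[OF j i(2,3), of s t] Xg i unfolding r_def by simp
      then have "?X * gen g - (gen g * ?X + r) \<in> qaff_rels N"
        by (simp add: bracket_def algebra_simps)
      from past[OF disjI1[OF this] lowering_in_qaff_alg[OF r]]
      show ?thesis using lowered_op[OF gL raise[OF j]] lowered_op[OF r xL] lowered_add by simp
    next
      case (Kg i)
      then show ?thesis using a(1) g scalar by (simp add: weight_vector_def)
    next
      case (Kg_inv i)
      then show ?thesis using op_k_inv[OF a(1)] g scalar by simp
    next
      case (Gg i t)
      then have i: "1 \<le> i" "i \<le> N" "t \<noteq> 0" using g by auto
      obtain c where c: "bracket 1 (gen g) ?X - scal c * x_gen 1 j (t + s) \<in> qaff_rels N"
        unfolding Gg by (rule rel_g_x[of 1 i N j t s]) (use i j in auto)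
      define r where "r = scal (- c) * x_gen 1 j (t + s)"
      have r: "r \<in> qaff_alg N" unfolding r_def by (intro free_algebra_mult free_algebra_scal X)
      have "gen g * ?X + r - ?X * gen g \<in> qaff_rels N"
        using c by (simp add: r_def bracket_def scal_uminus algebra_simps)
      from past[OF disjI2[OF this] r]
      have "op ?X (op (gen g) x) = op (gen g) (op ?X x) \<oplus> op (scal (- c)) (op (x_gen 1 j (t + s)) x)"
        using X xM unfolding r_def by (simp add: op_mult free_algebra_scal)
      then show ?thesis
        using lowered_op[OF gL raise[OF j]] lowered_op[OF scalL raise[OF j]] lowered_add by simp
    qed
  qed
  with b a(2) step show ?case by (auto intro: order_trans)
qed

lemma raising_lowered:
  assumes "1 \<le> j" "j < N" "x \<in> lowered"
  shows "op (x_gen 1 j s) x \<in> lowered"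
proof -
  have X: "x_gen 1 j s \<in> qaff_alg N" using assms by (simp add: free_algebra_gen)
  obtain p where p: "p \<in> carrier (free_algebra (lowering_gens N))" "x = op p hw"
    using assms(3) by (auto simp: lowered_def)
  have "p \<in> carrier (free_algebra (lowering_gens N)) \<and> op (x_gen 1 j s) (op p hw) \<in> lowered"
  proof (induction p rule: poly_mapping_span_induct)
    case (single w)
    have w: "set w \<subseteq> lowering_gens N" using p(1) single by (simp add: free_algebra_carrier)
    let ?c = "Poly_Mapping.lookup p w"
    have wA: "Poly_Mapping.single w 1 \<in> qaff_alg N"
      by (intro lowering_in_qaff_alg free_algebra_single w)
    have "op (Poly_Mapping.single w ?c) hw = op (scal ?c) (op (Poly_Mapping.single w 1) hw)"
      using op_mult[OF free_algebra_scal[of ?c] wA hw_closed] by (simp add: scal_times_single)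
    then have eq: "op (x_gen 1 j s) (op (Poly_Mapping.single w ?c) hw)
        = op (scal ?c) (op (x_gen 1 j s) (op (Poly_Mapping.single w 1) hw))"
      using X wA hw_closed by (simp add: op_scal_commute[OF X] op_closed)
    have "op (x_gen 1 j s) (op (Poly_Mapping.single w 1) hw) \<in> lowered"
      using lowering_word[OF w order_refl] assms(1,2) by blast
    from lowered_op[OF free_algebra_scal this] show ?case
      unfolding eq using w by (simp add: free_algebra_single)
  next
    case zero
    show ?case using X hw_closed by (simp add: op_zero_left op_zero_right zero_lowered free_algebra_zero)
  next
    case (add p q)
    then have "p \<in> qaff_alg N" "q \<in> qaff_alg N" by (simp_all add: lowering_in_qaff_alg)
    then have "op (x_gen 1 j s) (op (p + q) hw) = op (x_gen 1 j s) (op p hw) \<oplus> op (x_gen 1 j s) (op q hw)"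
      using X hw_closed by (simp add: op_add op_add_right op_closed)
    then show ?case using add by (simp add: free_algebra_add lowered_add)
  qed
  then show ?thesis using p by simp
qed

lemma carrier_lowered: "carrier M = lowered"
proof
  have gen: "op (gen g) x \<in> lowered" if g: "g \<in> qaff_gens N" and x: "x \<in> lowered" for g x
  proof (cases "g \<in> lowering_gens N")
    case True
    then show ?thesis using x by (intro lowered_op free_algebra_gen)
  next
    case False
    then obtain j s where "g = Xg 1 j s" "1 \<le> j" "j < N"
      using g by (auto simp: lowering_gens_def)
    then show ?thesis using raising_lowered x by simp
  qed
  have word: "op (Poly_Mapping.single w c) hw \<in> lowered" if "set w \<subseteq> qaff_gens N" for w c
    using that
  proof (induction w)
    case (Cons g w)
    then show ?case
      using op_mult[of "gen g" "Poly_Mapping.single w c" hw] hw_closed gen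
      by (simp add: free_algebra_gen free_algebra_single gen_times_single)
  qed (auto intro!: loweredI free_algebra_single)
  show "carrier M \<subseteq> lowered"
  proof
    fix x assume "x \<in> carrier M"
    then obtain p where p: "p \<in> qaff_alg N" "x = op p hw" by (auto simp: hw_generates)
    have "p \<in> qaff_alg N \<and> op p hw \<in> lowered"
    proof (induction p rule: poly_mapping_span_induct)
      case (single w)
      then show ?case using p(1) word by (simp add: free_algebra_carrier)
    next
      case zero
      then show ?case by (simp add: loweredI free_algebra_zero)
    next
      case (add p q)
      then show ?case using hw_closed by (simp add: op_add free_algebra_add lowered_add)
    qed
    with p show "x \<in> lowered" by simp
  qed
qed (rule lowered_subset)

text \<open>Every element is a combination of lowering words, and these are weight vectors whose height is
  at most that of \<open>a\<^sub>0\<close>.\<close>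

lemma weight_vector_induct:
  assumes n: "n \<le> N" and x: "x \<in> carrier M"
    and weight: "\<And>a x. weight_vector a x \<Longrightarrow> weight_height n a \<le> weight_height n a\<^sub>0 \<Longrightarrow> P x"
    and add: "\<And>x y. x \<in> carrier M \<Longrightarrow> y \<in> carrier M \<Longrightarrow> P x \<Longrightarrow> P y \<Longrightarrow> P (x \<oplus> y)"
  shows "P x"
proof -
  obtain p where p: "p \<in> carrier (free_algebra (lowering_gens N))" "x = op p hw"
    using x by (auto simp: carrier_lowered lowered_def)
  have "p \<in> carrier (free_algebra (lowering_gens N)) \<and> P (op p hw)"
  proof (induction p rule: poly_mapping_span_induct)
    case (single w)
    have w: "set w \<subseteq> lowering_gens N" using p(1) single by (simp add: free_algebra_carrier)
    let ?c = "Poly_Mapping.lookup p w"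
    have wA: "Poly_Mapping.single w 1 \<in> qaff_alg N"
      by (intro lowering_in_qaff_alg free_algebra_single w)
    have eq: "op (Poly_Mapping.single w ?c) hw = op (scal ?c) (op (Poly_Mapping.single w 1) hw)"
      using op_mult[OF free_algebra_scal[of ?c] wA hw_closed] by (simp add: scal_times_single)
    obtain a where a: "weight_vector a (op (Poly_Mapping.single w 1) hw)"
        "weight_height n a \<le> weight_height n a\<^sub>0"
      using lowering_word[OF w n] by blast
    show ?case
      using weight[OF weight_vector_scal[OF a(1), of ?c] a(2)] w unfolding eq
      by (simp add: free_algebra_single)
  next
    case zero
    have "op 0 hw = op (scal 0) hw" by simp
    then show ?case
      using weight[OF weight_vector_scal[OF hw_weight] order_refl, of 0] by (simp add: free_algebra_zero)
  next
    case (add p q)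
    then show ?case
      using hw_closed assms(4)
      by (simp add: op_add op_closed free_algebra_add lowering_in_qaff_alg)
  qed
  then show ?thesis using p by simp
qed

end

text \<open>The class of \<open>1\<close> generates, and it has the right properties because the \<open>x\<^sup>+\<close> and the
  \<open>k\<^sub>i - v\<^bsup>deg Q\<^sub>i\<^esup>\<close> are among the generators of the left ideal.\<close>

lemma highest_weight_quotient:
  assumes U: "ring (qaff N)" and K: "submodule K (qaff N) (hw_module N Q)" and N: "1 \<le> N"
  obtains hw where "highest_weight_module N (quot_module (hw_module N Q) K) hw
    (\<lambda>i. int (degree (Q ! (i - 1))))"
proof -
  define S where "S = qaff_class N `
     ({x_gen 1 j s | j s. 1 \<le> j \<and> j < N}
    \<union> {Q_elt i s - scal (Q_coeff (Q ! (i - 1)) s) | i s. 1 \<le> i \<and> i \<le> N}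
    \<union> {k_gen i - scal (qv ^ degree (Q ! (i - 1))) | i. 1 \<le> i \<and> i \<le> N})"
  define J where "J = left_ideal_gen (qaff N) S"
  let ?R = "regular_module (qaff N)"
  let ?H = "hw_module N Q"
  let ?L = "quot_module ?H K"
  have H_def: "?H = quot_module ?R J"
    by (simp add: hw_module_def J_def S_def)
  have "S \<subseteq> carrier (qaff N)"
    unfolding S_def
    by (auto intro!: qaff_class_closed free_algebra_diff free_algebra_scal free_algebra_gen Q_elt_in_qaff_alg)
  note J = submodule_left_ideal_gen[OF U this, folded J_def]
  note R = left_module_regular[OF U]
  have H: "left_module (qaff N) ?H"
    unfolding H_def by (rule left_module_quot_module[OF R J(1)])
  have L: "left_module (qaff N) ?L"
    by (rule left_module_quot_module[OF H K])
  interpret U: ring "qaff N" by (rule U)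
  have H_carrier: "carrier ?H = (\<lambda>u. J +>\<^bsub>?R\<^esub> u) ` carrier (qaff N)"
    unfolding H_def quot_module_carrier[OF R J(1)] by (simp add: regular_module_def)
  note L_carrier = quot_module_carrier[OF H K, unfolded H_carrier image_image]
  interpret L: qaff_module N ?L by (rule qaff_module.intro[OF L])
  define hw where "hw = K +>\<^bsub>?H\<^esub> (J +>\<^bsub>?R\<^esub> \<one>\<^bsub>qaff N\<^esub>)"
  have act: "L.op p hw = K +>\<^bsub>?H\<^esub> (J +>\<^bsub>?R\<^esub> qaff_class N p)" if "p \<in> qaff_alg N" for p
  proof -
    have p: "qaff_class N p \<in> carrier (qaff N)" using that by (rule qaff_class_closed)
    have one: "\<one>\<^bsub>qaff N\<^esub> \<in> carrier ?R" by (simp add: regular_module_def)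
    have "J +>\<^bsub>?R\<^esub> \<one>\<^bsub>qaff N\<^esub> \<in> carrier ?H"
      unfolding H_carrier by (rule imageI) (rule U.one_closed)
    then have "L.op p hw = K +>\<^bsub>?H\<^esub> (qaff_class N p \<odot>\<^bsub>?H\<^esub> (J +>\<^bsub>?R\<^esub> \<one>\<^bsub>qaff N\<^esub>))"
      unfolding L.op_def hw_def by (rule quot_module_smult[OF H K p])
    also have "qaff_class N p \<odot>\<^bsub>?H\<^esub> (J +>\<^bsub>?R\<^esub> \<one>\<^bsub>qaff N\<^esub>) = J +>\<^bsub>?R\<^esub> (qaff_class N p \<odot>\<^bsub>?R\<^esub> \<one>\<^bsub>qaff N\<^esub>)"
      unfolding H_def by (rule quot_module_smult[OF R J(1) p one])
    also have "qaff_class N p \<odot>\<^bsub>?R\<^esub> \<one>\<^bsub>qaff N\<^esub> = qaff_class N p"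
      using p by (simp add: regular_module_def)
    finally show ?thesis .
  qed
  have hw_closed: "hw \<in> carrier ?L"
    unfolding hw_def L_carrier by (rule imageI) (rule U.one_closed)
  have kill: "L.op p hw = \<zero>\<^bsub>?L\<^esub>" if "p \<in> qaff_alg N" "qaff_class N p \<in> S" for p
  proof -
    have "J +>\<^bsub>?R\<^esub> qaff_class N p = J"
      using coset_eq_iff[OF R J(1), of "qaff_class N p"] that J(2) qaff_class_closed[OF that(1)]
      by (auto simp: regular_module_def)
    moreover have "K +>\<^bsub>?H\<^esub> J = K"
    proof -
      have "\<zero>\<^bsub>?H\<^esub> = J" unfolding H_def by (rule quot_module_zero[OF R J(1)])
      moreover have "\<zero>\<^bsub>?H\<^esub> \<in> K"
        using subgroup.one_closed[of K "add_monoid ?H"] K by (simp add: submodule_def)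
      moreover have "\<zero>\<^bsub>?H\<^esub> \<in> carrier ?H"
        using H by (simp add: left_module_def abelian_group_def abelian_monoid.zero_closed)
      ultimately show ?thesis using coset_eq_iff[OF H K] by metis
    qed
    ultimately show ?thesis by (simp add: act[OF that(1)] quot_module_zero[OF H K])
  qed
  have "highest_weight_module N ?L hw (\<lambda>i. int (degree (Q ! (i - 1))))"
  proof (intro highest_weight_module.intro qaff_module.intro L highest_weight_module_axioms.intro)
    show "L.weight_vector (\<lambda>i. int (degree (Q ! (i - 1)))) hw"
      unfolding L.weight_vector_def
    proof (intro conjI ballI hw_closed)
      fix i assume i: "i \<in> {1..N}"
      let ?s = "scal (qv powi int (degree (Q ! (i - 1)))) :: qaff_free"
      let ?p = "k_gen i - ?s"
      have k: "k_gen i \<in> qaff_alg N" using i by (simp add: free_algebra_gen)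
      have "qaff_class N ?p \<in> S" unfolding S_def using i by auto
      then have "L.op ?p hw = \<zero>\<^bsub>?L\<^esub>" using k by (intro kill free_algebra_diff free_algebra_scal)
      moreover have "L.op (?p + ?s) hw = L.op ?p hw \<oplus>\<^bsub>?L\<^esub> L.op ?s hw"
        by (intro L.op_add free_algebra_diff free_algebra_scal k hw_closed)
      ultimately show "L.op (k_gen i) hw = L.op ?s hw"
        using L.op_closed[OF free_algebra_scal hw_closed] by simp
    qed
    fix j s assume j: "1 \<le> j" "j < N"
    then have "qaff_class N (x_gen 1 j s) \<in> S" unfolding S_def by (intro imageI) blast
    with j show "L.op (x_gen 1 j s) hw = \<zero>\<^bsub>?L\<^esub>"
      by (intro kill) (simp_all add: free_algebra_gen)
  next
    show "carrier ?L = (\<lambda>p. L.op p hw) ` qaff_alg N"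
      unfolding L_carrier qaff_carrier image_image by (rule image_cong) (simp_all add: act)
  qed
  then show thesis by (rule that)
qed

section \<open>The affine quantum Schur algebra\<close>

abbreviation tensor_carrier :: "nat \<Rightarrow> (int list \<Rightarrow>\<^sub>0 'k::comm_ring_1) set" where
  "tensor_carrier r \<equiv> carrier (tensor_space r)"

lemma tensor_carrier: "x \<in> tensor_carrier r \<longleftrightarrow> (\<forall>w\<in>Poly_Mapping.keys x. length w = r)"
  by (simp add: tensor_space_def)

lemma tensor_space_ops [simp]:
  "x \<oplus>\<^bsub>tensor_space r\<^esub> y = x + y" "\<zero>\<^bsub>tensor_space r\<^esub> = 0" "c \<odot>\<^bsub>tensor_space r\<^esub> x = pm_scale c x"
  by (simp_all add: tensor_space_def)

lemma tensor_carrier_zero [simp]: "0 \<in> tensor_carrier r"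
  and tensor_carrier_scale [simp]: "x \<in> tensor_carrier r \<Longrightarrow> pm_scale c x \<in> tensor_carrier r"
  and tensor_carrier_om [simp]: "om w \<in> tensor_carrier r \<longleftrightarrow> length w = r"
  using keys_pm_scale[of c x] by (auto simp: tensor_carrier om_def)

lemma tensor_carrier_add [simp]:
  "x \<in> tensor_carrier r \<Longrightarrow> y \<in> tensor_carrier r \<Longrightarrow> x + y \<in> tensor_carrier r"
  using Poly_Mapping.keys_add[of x y] by (auto simp: tensor_carrier)

lemma single_om: "Poly_Mapping.single w c = pm_scale c (om w)"
  by (simp add: om_def)

lemma linear_on_basis:
  fixes F :: "(int list \<Rightarrow>\<^sub>0 'k::comm_ring_1) \<Rightarrow> (int list \<Rightarrow>\<^sub>0 'k)"
  assumes add: "\<And>x y. x \<in> tensor_carrier r \<Longrightarrow> y \<in> tensor_carrier r \<Longrightarrow> F (x + y) = F x + F y"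
    and scale: "\<And>c x. x \<in> tensor_carrier r \<Longrightarrow> F (pm_scale c x) = pm_scale c (F x)"
    and x: "x \<in> tensor_carrier r"
  shows "F x = lin_ext (\<lambda>u c. pm_scale c (F (om u))) x"
proof -
  have "x \<in> tensor_carrier r \<and> F x = lin_ext (\<lambda>u c. pm_scale c (F (om u))) x"
  proof (induction x rule: poly_mapping_span_induct)
    case zero
    have "F 0 = 0" using scale[of 0 0] by simp
    then show ?case by simp
  next
    case (add x y)
    then show ?case by (simp add: assms(1) lin_ext_add pm_scale_add_left)
  next
    case (single w)
    then have "length w = r" using x by (simp add: tensor_carrier)
    then show ?case
      by (simp add: single_om scale) (simp add: om_def lin_ext_single)
  qed
  then show ?thesis ..
qed

lemma hecke_rels_subset: "hecke_rels r \<subseteq> carrier (free_algebra (hecke_gens r))"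
proof -
  have [simp]: "T i \<in> hecke_gens r \<longleftrightarrow> 1 \<le> i \<and> i < r" "X j \<in> hecke_gens r \<longleftrightarrow> 1 \<le> j \<and> j \<le> r"
    "X_inv j \<in> hecke_gens r \<longleftrightarrow> 1 \<le> j \<and> j \<le> r" for i j
    by (auto simp: hecke_gens_def)
  show ?thesis
    unfolding hecke_rels_def
    by (intro Un_least subsetI; elim CollectE exE conjE; hypsubst) (auto intro!: free_algebra_intros)
qed

text \<open>The Hecke algebra contains the scalars, so that maps commuting with it are linear over the
  Laurent polynomials (\<open>schur_scale\<close>).\<close>

lemma hecke_scalar: "c \<odot>\<^bsub>hecke r\<^esub> \<one>\<^bsub>hecke r\<^esub> \<in> carrier (hecke r)"
proof -
  have "\<one>\<^bsub>hecke r\<^esub> = pres_class (hecke_gens r) (hecke_rels r) 1"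
    using ring_hom_one[OF pres_class_hom[OF hecke_rels_subset, of r]] by (simp add: hecke_def)
  then show ?thesis
    by (simp add: hecke_def presented_algebra_smult[OF hecke_rels_subset free_algebra_one]
        presented_algebra_carrier[OF hecke_rels_subset] free_algebra_scal)
qed

locale hecke_space =
  fixes r :: nat and act :: hecke_act
  assumes right_module: "right_module (hecke r) (tensor_space r) act"
begin

abbreviation S where "S \<equiv> schur r act"

lemma act_closed: "x \<in> tensor_carrier r \<Longrightarrow> h \<in> carrier (hecke r) \<Longrightarrow> act x h \<in> tensor_carrier r"
  and act_add: "x \<in> tensor_carrier r \<Longrightarrow> y \<in> tensor_carrier r \<Longrightarrow> h \<in> carrier (hecke r) \<Longrightarrow>
    act (x + y) h = act x h + act y h"
  and act_scale: "x \<in> tensor_carrier r \<Longrightarrow> h \<in> carrier (hecke r) \<Longrightarrow>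
    act (pm_scale c x) h = pm_scale c (act x h)"
  and act_scalar: "x \<in> tensor_carrier r \<Longrightarrow> act x (c \<odot>\<^bsub>hecke r\<^esub> \<one>\<^bsub>hecke r\<^esub>) = pm_scale c x"
  using right_module by (simp_all add: right_module_def ring.ring_simprules)

lemma schurI:
  assumes "f \<in> extensional (tensor_carrier r)"
    and "\<And>x. x \<in> tensor_carrier r \<Longrightarrow> f x \<in> tensor_carrier r"
    and "\<And>x y. x \<in> tensor_carrier r \<Longrightarrow> y \<in> tensor_carrier r \<Longrightarrow> f (x + y) = f x + f y"
    and "\<And>x h. x \<in> tensor_carrier r \<Longrightarrow> h \<in> carrier (hecke r) \<Longrightarrow> f (act x h) = act (f x) h"
  shows "f \<in> carrier S"
  using assms by (auto simp: schur_def Let_def PiE_def)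

lemma schurD:
  assumes "f \<in> carrier S"
  shows schur_extensional: "f \<in> extensional (tensor_carrier r)"
    and schur_closed: "x \<in> tensor_carrier r \<Longrightarrow> f x \<in> tensor_carrier r"
    and schur_add: "x \<in> tensor_carrier r \<Longrightarrow> y \<in> tensor_carrier r \<Longrightarrow> f (x + y) = f x + f y"
    and schur_act: "x \<in> tensor_carrier r \<Longrightarrow> h \<in> carrier (hecke r) \<Longrightarrow> f (act x h) = act (f x) h"
  using assms by (auto simp: schur_def Let_def PiE_def Pi_def)

lemma schur_ops:
  "f \<otimes>\<^bsub>S\<^esub> g = compose (tensor_carrier r) f g"
  "\<one>\<^bsub>S\<^esub> = (\<lambda>x\<in>tensor_carrier r. x)" "\<zero>\<^bsub>S\<^esub> = (\<lambda>x\<in>tensor_carrier r. 0)"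
  "f \<oplus>\<^bsub>S\<^esub> g = (\<lambda>x\<in>tensor_carrier r. f x + g x)"
  "c \<odot>\<^bsub>S\<^esub> f = (\<lambda>x\<in>tensor_carrier r. pm_scale c (f x))"
  by (simp_all add: schur_def Let_def)

lemma schur_apply:
  assumes "x \<in> tensor_carrier r"
  shows "(f \<otimes>\<^bsub>S\<^esub> g) x = f (g x)" "\<one>\<^bsub>S\<^esub> x = x" "\<zero>\<^bsub>S\<^esub> x = 0" "(f \<oplus>\<^bsub>S\<^esub> g) x = f x + g x"
    "(c \<odot>\<^bsub>S\<^esub> f) x = pm_scale c (f x)"
  using assms by (simp_all add: schur_ops compose_eq)

lemma schur_scale:
  assumes "f \<in> carrier S" "x \<in> tensor_carrier r"
  shows "f (pm_scale c x) = pm_scale c (f x)"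
  using schur_act[OF assms hecke_scalar, of c] assms
  by (simp add: act_scalar schur_closed)

lemma schur_eqI:
  assumes "f \<in> carrier S" "g \<in> carrier S" "\<And>w. length w = r \<Longrightarrow> f (om w) = g (om w)"
  shows "f = g"
proof (rule extensionalityI[OF schur_extensional[OF assms(1)] schur_extensional[OF assms(2)]])
  fix x :: "int list \<Rightarrow>\<^sub>0 laurent" assume x: "x \<in> tensor_carrier r"
  have "f x = lin_ext (\<lambda>u c. pm_scale c (f (om u))) x"
    by (rule linear_on_basis) (use assms(1) x in \<open>simp_all add: schur_add schur_scale\<close>)
  also have "\<dots> = lin_ext (\<lambda>u c. pm_scale c (g (om u))) x"
    by (rule lin_ext_cong) (use x assms(3) in \<open>auto simp: tensor_carrier\<close>)
  also have "\<dots> = g x"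
    by (rule linear_on_basis[symmetric]) (use assms(2) x in \<open>simp_all add: schur_add schur_scale\<close>)
  finally show "f x = g x" .
qed

lemma schur_mult_closed: "f \<in> carrier S \<Longrightarrow> g \<in> carrier S \<Longrightarrow> f \<otimes>\<^bsub>S\<^esub> g \<in> carrier S"
  by (rule schurI) (simp_all add: schur_ops compose_eq schur_closed schur_add schur_act act_closed)

lemma schur_add_closed: "f \<in> carrier S \<Longrightarrow> g \<in> carrier S \<Longrightarrow> f \<oplus>\<^bsub>S\<^esub> g \<in> carrier S"
  by (rule schurI) (simp_all add: schur_ops schur_closed schur_add schur_act act_closed act_add algebra_simps)

lemma schur_smult_closed: "f \<in> carrier S \<Longrightarrow> c \<odot>\<^bsub>S\<^esub> f \<in> carrier S"
  by (rule schurI) (simp_all add: schur_ops schur_closed schur_add schur_act act_closed act_scale)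

lemma act_zero: "h \<in> carrier (hecke r) \<Longrightarrow> act 0 h = 0"
  using act_scale[of 0 h 0] by simp

lemma schur_abelian_group: "abelian_group S"
proof (rule abelian_groupI)
  show "\<zero>\<^bsub>S\<^esub> \<in> carrier S"
    by (rule schurI) (simp_all add: schur_ops act_closed act_zero)
  fix f assume f: "f \<in> carrier S"
  have "\<zero>\<^bsub>S\<^esub> \<oplus>\<^bsub>S\<^esub> f \<in> carrier S" using \<open>\<zero>\<^bsub>S\<^esub> \<in> carrier S\<close> f by (rule schur_add_closed)
  then show "\<zero>\<^bsub>S\<^esub> \<oplus>\<^bsub>S\<^esub> f = f"
    by (rule schur_eqI) (simp_all add: f schur_ops)
  have "(- 1) \<odot>\<^bsub>S\<^esub> f \<oplus>\<^bsub>S\<^esub> f = \<zero>\<^bsub>S\<^esub>"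
    by (simp add: schur_ops pm_scale_minus_one fun_eq_iff restrict_def)
  then show "\<exists>g\<in>carrier S. g \<oplus>\<^bsub>S\<^esub> f = \<zero>\<^bsub>S\<^esub>"
    using schur_smult_closed[OF f] by blast
qed (simp_all add: schur_add_closed, simp_all add: schur_ops fun_eq_iff restrict_def algebra_simps)

sublocale S: scalar_algebra S
proof (rule scalar_algebra.intro)
  have one: "\<one>\<^bsub>S\<^esub> \<in> carrier S"
    by (rule schurI) (simp_all add: schur_ops act_closed)
  note closed = one schur_mult_closed schur_add_closed schur_smult_closed
  have unit: "\<one>\<^bsub>S\<^esub> \<otimes>\<^bsub>S\<^esub> f = f" "f \<otimes>\<^bsub>S\<^esub> \<one>\<^bsub>S\<^esub> = f" if "f \<in> carrier S" for f
    by (intro schur_eqI closed that; simp add: schur_apply schur_closed that)+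
  show "ring S"
  proof (rule ringI[OF schur_abelian_group])
    have assoc: "f \<otimes>\<^bsub>S\<^esub> g \<otimes>\<^bsub>S\<^esub> h = f \<otimes>\<^bsub>S\<^esub> (g \<otimes>\<^bsub>S\<^esub> h)"
      if "f \<in> carrier S" "g \<in> carrier S" "h \<in> carrier S" for f g h
      using that by (intro schur_eqI closed) (simp_all add: schur_apply schur_closed)
    show "Group.monoid S" by (rule monoidI) (simp_all add: closed unit assoc)
    fix f g h assume fgh: "f \<in> carrier S" "g \<in> carrier S" "h \<in> carrier S"
    show "(f \<oplus>\<^bsub>S\<^esub> g) \<otimes>\<^bsub>S\<^esub> h = f \<otimes>\<^bsub>S\<^esub> h \<oplus>\<^bsub>S\<^esub> g \<otimes>\<^bsub>S\<^esub> h"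
      by (intro schur_eqI closed fgh) (simp_all add: schur_apply schur_closed fgh)
    show "h \<otimes>\<^bsub>S\<^esub> (f \<oplus>\<^bsub>S\<^esub> g) = h \<otimes>\<^bsub>S\<^esub> f \<oplus>\<^bsub>S\<^esub> h \<otimes>\<^bsub>S\<^esub> g"
      by (intro schur_eqI closed fgh) (simp_all add: schur_apply schur_closed schur_add fgh)
  qed
  show "scalar_algebra_axioms S"
  proof
    fix f g c assume fg: "f \<in> carrier S" "g \<in> carrier S"
    show "(c \<odot>\<^bsub>S\<^esub> f) \<otimes>\<^bsub>S\<^esub> g = c \<odot>\<^bsub>S\<^esub> (f \<otimes>\<^bsub>S\<^esub> g)"
      by (intro schur_eqI closed fg) (simp_all add: schur_apply schur_closed fg)
    show "f \<otimes>\<^bsub>S\<^esub> (c \<odot>\<^bsub>S\<^esub> g) = c \<odot>\<^bsub>S\<^esub> (f \<otimes>\<^bsub>S\<^esub> g)"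
      by (intro schur_eqI closed fg) (simp_all add: schur_apply schur_closed schur_scale fg)
  qed (rule schur_smult_closed)
qed

subsection \<open>The action on the tensor space over the rational functions\<close>

abbreviation rmap :: "(int list \<Rightarrow>\<^sub>0 laurent) \<Rightarrow> (int list \<Rightarrow>\<^sub>0 ratfun)" where
  "rmap \<equiv> Poly_Mapping.map laurent_to_ratfun"

lemma lookup_rmap [simp]: "Poly_Mapping.lookup (rmap x) w = laurent_to_ratfun (Poly_Mapping.lookup x w)"
  by (simp add: Poly_Mapping.map.rep_eq when_def)

lemma rmap_simps [simp]:
  "rmap (x + y) = rmap x + rmap y" "rmap 0 = 0" "rmap (pm_scale c x) = pm_scale (laurent_to_ratfun c) (rmap x)"
  "rmap (om w) = om w"
  by (rule poly_mapping_eqI; simp add: lookup_add om_def lookup_single when_def)+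

lemma rmap_eq_iff [simp]: "rmap x = rmap y \<longleftrightarrow> x = y"
  by (simp add: poly_mapping_eq_iff fun_eq_iff)

lemma rmap_linear:
  fixes F :: "(int list \<Rightarrow>\<^sub>0 laurent) \<Rightarrow> (int list \<Rightarrow>\<^sub>0 laurent)"
  assumes "\<And>x y. x \<in> tensor_carrier r \<Longrightarrow> y \<in> tensor_carrier r \<Longrightarrow> F (x + y) = F x + F y"
    and "\<And>c x. x \<in> tensor_carrier r \<Longrightarrow> F (pm_scale c x) = pm_scale c (F x)"
    and x: "x \<in> tensor_carrier r"
  shows "rmap (F x) = lin_ext (\<lambda>u c. pm_scale c (rmap (F (om u)))) (rmap x)"
proof -
  have [simp]: "rmap (sum g I) = (\<Sum>t\<in>I. rmap (g t))" for g :: "int list \<Rightarrow> _" and I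
    by (induction I rule: infinite_finite_induct) simp_all
  have "Poly_Mapping.keys (rmap x) = Poly_Mapping.keys x"
    by (auto simp: in_keys_iff)
  then show ?thesis
    by (subst linear_on_basis[OF assms]) (simp_all add: lin_ext_def)
qed

lemma schur_v_apply_lin_ext:
  "schur_v_apply p w = lin_ext (\<lambda>f c. pm_scale c (rmap (f (om w)))) p"
  by (simp add: schur_v_apply_def lin_ext_def)

lemma schur_v_apply_add: "schur_v_apply (p + q) w = schur_v_apply p w + schur_v_apply q w"
  unfolding schur_v_apply_lin_ext by (rule lin_ext_add) (simp_all add: pm_scale_add_left)

lemma schur_v_apply_scale: "schur_v_apply (pm_scale c p) w = pm_scale c (schur_v_apply p w)"
  unfolding schur_v_apply_lin_ext by (rule lin_ext_pm_scale) simp_all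

lemma schur_v_apply_zero [simp]: "schur_v_apply 0 w = 0"
  by (simp add: schur_v_apply_lin_ext)

lemma schur_v_apply_diff: "schur_v_apply (p - q) w = schur_v_apply p w - schur_v_apply q w"
  using schur_v_apply_add[of "p - q" q w] by (simp add: eq_diff_eq)

lemma schur_v_apply_single [simp]:
  "schur_v_apply (Poly_Mapping.single f c) w = pm_scale c (rmap (f (om w)))"
  by (simp add: schur_v_apply_lin_ext lin_ext_single)

lemma schur_v_apply_null:
  assumes "p \<in> tensor_null laurent_to_ratfun S" "length w = r"
  shows "schur_v_apply p w = 0"
  using assms(1)
  by (induction rule: tensor_null.induct)
    (simp_all add: assms(2) schur_v_apply_add schur_v_apply_diff schur_v_apply_scale schur_ops)

lemma acts_as_class:
  assumes "Poly_Mapping.keys p \<subseteq> carrier S"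
  shows "acts_as r (tensor_class laurent_to_ratfun S p) D \<longleftrightarrow>
    (\<forall>w. length w = r \<longrightarrow> schur_v_apply p w = D w)"
proof -
  have eq: "schur_v_apply p' w = schur_v_apply p w"
    if "p' \<in> tensor_class laurent_to_ratfun S p" "length w = r" for p' w
    using schur_v_apply_null[OF tensor_classD(2)[OF that(1)] that(2)] by (simp add: schur_v_apply_diff)
  show ?thesis
    unfolding acts_as_def
  proof (intro iffI ballI allI impI)
    fix w :: "int list"
    assume "\<forall>p'\<in>tensor_class laurent_to_ratfun S p. \<forall>w. length w = r \<longrightarrow> schur_v_apply p' w = D w"
      and "length w = r"
    then show "schur_v_apply p w = D w" using tensor_class_self[OF assms] by blast
  next
    fix p' and w :: "int list"
    assume "\<forall>w. length w = r \<longrightarrow> schur_v_apply p w = D w"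
      and "p' \<in> tensor_class laurent_to_ratfun S p" "length w = r"
    then show "schur_v_apply p' w = D w" using eq[of p' w] by simp
  qed
qed

lemma schur_v_apply_mult:
  assumes "Poly_Mapping.keys p \<subseteq> carrier S" "Poly_Mapping.keys q \<subseteq> carrier S" "length w = r"
  shows "schur_v_apply (bilinear_ext (mult S) p q) w
    = lin_ext (\<lambda>u c. pm_scale c (schur_v_apply p u)) (schur_v_apply q w)"
proof (induction p rule: poly_mapping_span_induct)
  case (single f)
  then have f: "f \<in> carrier S" using assms(1) by auto
  let ?c = "Poly_Mapping.lookup p f"
  show ?case
  proof (induction q rule: poly_mapping_span_induct)
    case (single g)
    then have g: "g \<in> carrier S" using assms(2) by auto
    have "rmap (f (g (om w))) = lin_ext (\<lambda>u c. pm_scale c (rmap (f (om u)))) (rmap (g (om w)))"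
      by (rule rmap_linear) (use f g assms(3) in \<open>simp_all add: schur_add schur_scale schur_closed\<close>)
    then show ?case
      using assms(3)
      by (simp add: schur_ops compose_eq lin_ext_pm_scale[where k = "Poly_Mapping.lookup q g"]
          pm_scale_lin_ext mult_ac)
  qed (simp_all add: bilinear_ext_add_right schur_v_apply_add lin_ext_add pm_scale_add_left
      del: schur_v_apply_single)
qed (simp_all add: bilinear_ext_add_left schur_v_apply_add lin_ext_plus_fun)

text \<open>The action is faithful: after multiplication with a common denominator an element of the
  extended algebra comes from \<open>S\<close>, whose elements are maps.\<close>

lemma tensor_null_finsum:
  assumes "finite I" "I \<subseteq> carrier S"
  shows "Poly_Mapping.single (finsum S (\<lambda>f. a f \<odot>\<^bsub>S\<^esub> f) I) 1
    - (\<Sum>f\<in>I. Poly_Mapping.single f (h (a f))) \<in> tensor_null h S"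
  using assms
proof (induction I rule: finite_induct)
  case empty
  then show ?case using tensor_null_uminus[OF tensor_null.rel_add[OF S.zero_closed S.zero_closed, of h]] by simp
next
  case (insert f I)
  let ?F = "finsum S (\<lambda>f. a f \<odot>\<^bsub>S\<^esub> f) I"
  have cl: "(\<lambda>f. a f \<odot>\<^bsub>S\<^esub> f) \<in> I \<rightarrow> carrier S" "a f \<odot>\<^bsub>S\<^esub> f \<in> carrier S" "f \<in> carrier S"
    using insert by (auto intro: S.scalar_closed)
  have "(Poly_Mapping.single (a f \<odot>\<^bsub>S\<^esub> f \<oplus>\<^bsub>S\<^esub> ?F) 1 - Poly_Mapping.single (a f \<odot>\<^bsub>S\<^esub> f) 1 - Poly_Mapping.single ?F 1)
      + ((Poly_Mapping.single (a f \<odot>\<^bsub>S\<^esub> f) 1 - Poly_Mapping.single f (h (a f)))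
      + (Poly_Mapping.single ?F 1 - (\<Sum>f\<in>I. Poly_Mapping.single f (h (a f))))) \<in> tensor_null h S"
    using insert cl
    by (intro tensor_null.null_add tensor_null.rel_add tensor_null.rel_smult insert.IH S.finsum_closed) auto
  then show ?case using insert(1,2) cl by (simp add: algebra_simps)
qed

lemma schur_finsum_apply:
  assumes "finite I" "I \<subseteq> carrier S" "x \<in> tensor_carrier r"
  shows "(finsum S (\<lambda>f. a f \<odot>\<^bsub>S\<^esub> f) I) x = (\<Sum>f\<in>I. pm_scale (a f) (f x))"
  using assms
proof (induction I rule: finite_induct)
  case (insert f I)
  then have "(\<lambda>f. a f \<odot>\<^bsub>S\<^esub> f) \<in> I \<rightarrow> carrier S" "a f \<odot>\<^bsub>S\<^esub> f \<in> carrier S"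
    by (auto intro: S.scalar_closed)
  with insert show ?case by (simp add: schur_apply)
qed (simp add: schur_apply)

lemma schur_v_faithful_null:
  assumes p: "Poly_Mapping.keys p \<subseteq> carrier S" and 0: "\<And>w. length w = r \<Longrightarrow> schur_v_apply p w = 0"
  shows "p \<in> tensor_null laurent_to_ratfun S"
proof -
  obtain b a where b: "b \<noteq> 0"
    and ba: "\<And>f. f \<in> Poly_Mapping.keys p \<Longrightarrow>
      Poly_Mapping.lookup p f * laurent_to_ratfun b = laurent_to_ratfun (a f)"
    using common_laurent_denominator[OF finite_keys, of p "Poly_Mapping.lookup p"] by blast
  define F where "F = finsum S (\<lambda>f. a f \<odot>\<^bsub>S\<^esub> f) (Poly_Mapping.keys p)"
  have FS: "F \<in> carrier S"
    unfolding F_def using p by (intro S.finsum_closed) (auto intro: S.scalar_closed)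
  have rmap_sum: "rmap (sum g I) = (\<Sum>t\<in>I. rmap (g t))" for g :: "endo \<Rightarrow> _" and I
    by (induction I rule: infinite_finite_induct) simp_all
  have "F = \<zero>\<^bsub>S\<^esub>"
  proof (rule schur_eqI[OF FS S.zero_closed])
    fix w :: "int list" assume w: "length w = r"
    have "rmap (F (om w)) = (\<Sum>f\<in>Poly_Mapping.keys p. pm_scale (laurent_to_ratfun (a f)) (rmap (f (om w))))"
      unfolding F_def using p w by (simp add: schur_finsum_apply rmap_sum)
    also have "\<dots> = pm_scale (laurent_to_ratfun b) (schur_v_apply p w)"
      unfolding schur_v_apply_lin_ext lin_ext_def pm_scale_sum
      by (rule sum.cong) (simp_all add: ba[symmetric] mult.commute)
    finally have "rmap (F (om w)) = rmap 0" using 0[OF w] by simp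
    then have "F (om w) = 0" by (simp only: rmap_eq_iff)
    then show "F (om w) = \<zero>\<^bsub>S\<^esub> (om w)" using w by (simp add: schur_ops)
  qed
  then have "Poly_Mapping.single F 1 \<in> tensor_null laurent_to_ratfun S"
    using tensor_null_uminus[OF tensor_null.rel_add[OF S.zero_closed S.zero_closed]] by simp
  from tensor_null_diff[OF this tensor_null_finsum[OF finite_keys p, of a laurent_to_ratfun, folded F_def]]
  have "(\<Sum>f\<in>Poly_Mapping.keys p. Poly_Mapping.single f (laurent_to_ratfun (a f)))
      \<in> tensor_null laurent_to_ratfun S"
    by simp
  also have "(\<Sum>f\<in>Poly_Mapping.keys p. Poly_Mapping.single f (laurent_to_ratfun (a f)))
      = pm_scale (laurent_to_ratfun b) p"
    by (subst (2) poly_mapping_sum_singles[of p]) (simp add: pm_scale_sum ba[symmetric] mult.commute)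
  finally have "pm_scale (inverse (laurent_to_ratfun b)) (pm_scale (laurent_to_ratfun b) p)
      \<in> tensor_null laurent_to_ratfun S"
    by (rule tensor_null.null_scale)
  then show ?thesis using b by simp
qed

lemma schur_v_carrierE:
  assumes "P \<in> carrier (schur_v r act)"
  obtains p where "P = tensor_class laurent_to_ratfun S p" "Poly_Mapping.keys p \<subseteq> carrier S"
  using assms by (auto simp: schur_v_def tensor_algebra_simps)

lemma schur_v_faithful:
  assumes P: "P \<in> carrier (schur_v r act)" "acts_as r P D" and Q: "Q \<in> carrier (schur_v r act)" "acts_as r Q D"
  shows "P = Q"
proof -
  obtain p q where p: "P = tensor_class laurent_to_ratfun S p" "Poly_Mapping.keys p \<subseteq> carrier S"
    and q: "Q = tensor_class laurent_to_ratfun S q" "Poly_Mapping.keys q \<subseteq> carrier S"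
    using P Q by (metis schur_v_carrierE)
  have "p - q \<in> tensor_null laurent_to_ratfun S"
  proof (rule schur_v_faithful_null)
    show "Poly_Mapping.keys (p - q) \<subseteq> carrier S"
      using p(2) q(2) Poly_Mapping.keys_add[of p "- q"] by (auto simp: in_keys_iff)
    fix w :: "int list" assume "length w = r"
    then show "schur_v_apply (p - q) w = 0"
      using P(2) Q(2) p q by (simp add: acts_as_class schur_v_apply_diff)
  qed
  then show ?thesis unfolding p(1) q(1) by (rule tensor_class_eqI)
qed

subsection \<open>Diagonal elements\<close>

definition acts_diag :: "(endo \<Rightarrow>\<^sub>0 ratfun) set \<Rightarrow> (int list \<Rightarrow> ratfun) \<Rightarrow> bool" where
  "acts_diag P d \<longleftrightarrow> P \<in> carrier (schur_v r act) \<and> acts_as r P (\<lambda>w. pm_scale (d w) (om w))"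

lemma acts_diag_class:
  "Poly_Mapping.keys p \<subseteq> carrier S \<Longrightarrow> acts_diag (tensor_class laurent_to_ratfun S p) d \<longleftrightarrow>
    (\<forall>w. length w = r \<longrightarrow> schur_v_apply p w = pm_scale (d w) (om w))"
  by (auto simp: acts_diag_def acts_as_class schur_v_def tensor_algebra_simps)

lemma acts_diagE:
  assumes "acts_diag P d"
  obtains p where "P = tensor_class laurent_to_ratfun S p" "Poly_Mapping.keys p \<subseteq> carrier S"
    "\<And>w. length w = r \<Longrightarrow> schur_v_apply p w = pm_scale (d w) (om w)"
proof -
  obtain p where p: "P = tensor_class laurent_to_ratfun S p" "Poly_Mapping.keys p \<subseteq> carrier S"
    using assms by (auto simp: acts_diag_def elim: schur_v_carrierE)
  with assms have "schur_v_apply p w = pm_scale (d w) (om w)" if "length w = r" for w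
    using that by (simp add: acts_diag_class)
  with p show thesis by (rule that)
qed

lemma acts_diag_eqI:
  assumes "acts_diag P d" "acts_diag Q d'" "\<And>w. length w = r \<Longrightarrow> d w = d' w"
  shows "P = Q"
proof (rule schur_v_faithful)
  show "acts_as r Q (\<lambda>w. pm_scale (d w) (om w))"
    using assms(2,3) by (simp add: acts_diag_def acts_as_def)
qed (use assms in \<open>simp_all add: acts_diag_def\<close>)

lemma acts_diag_mult:
  assumes "acts_diag P d" "acts_diag Q d'"
  shows "acts_diag (P \<otimes>\<^bsub>schur_v r act\<^esub> Q) (\<lambda>w. d w * d' w)"
proof -
  obtain p where p: "P = tensor_class laurent_to_ratfun S p" "Poly_Mapping.keys p \<subseteq> carrier S"
    "\<And>w. length w = r \<Longrightarrow> schur_v_apply p w = pm_scale (d w) (om w)"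
    using acts_diagE[OF assms(1)] by blast
  obtain q where q: "Q = tensor_class laurent_to_ratfun S q" "Poly_Mapping.keys q \<subseteq> carrier S"
    "\<And>w. length w = r \<Longrightarrow> schur_v_apply q w = pm_scale (d' w) (om w)"
    using acts_diagE[OF assms(2)] by blast
  have "Poly_Mapping.keys (bilinear_ext (mult S) p q) \<subseteq> carrier S"
    by (rule keys_bilinear_ext) (use p q in \<open>auto intro: S.m_closed\<close>)
  moreover have "P \<otimes>\<^bsub>schur_v r act\<^esub> Q = tensor_class laurent_to_ratfun S (bilinear_ext (mult S) p q)"
    unfolding schur_v_def p(1) q(1) by (rule S.tensor_algebra_mult[OF p(2) q(2)])
  ultimately show ?thesis
    using p q by (simp add: acts_diag_class schur_v_apply_mult)
      (simp add: om_def lin_ext_single mult.commute)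
qed

lemma acts_diag_add:
  assumes "acts_diag P d" "acts_diag Q d'"
  shows "acts_diag (P \<oplus>\<^bsub>schur_v r act\<^esub> Q) (\<lambda>w. d w + d' w)"
proof -
  obtain p where p: "P = tensor_class laurent_to_ratfun S p" "Poly_Mapping.keys p \<subseteq> carrier S"
    "\<And>w. length w = r \<Longrightarrow> schur_v_apply p w = pm_scale (d w) (om w)"
    using acts_diagE[OF assms(1)] by blast
  obtain q where q: "Q = tensor_class laurent_to_ratfun S q" "Poly_Mapping.keys q \<subseteq> carrier S"
    "\<And>w. length w = r \<Longrightarrow> schur_v_apply q w = pm_scale (d' w) (om w)"
    using acts_diagE[OF assms(2)] by blast
  have "Poly_Mapping.keys (p + q) \<subseteq> carrier S"
    using p(2) q(2) Poly_Mapping.keys_add[of p q] by blast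
  moreover have "P \<oplus>\<^bsub>schur_v r act\<^esub> Q = tensor_class laurent_to_ratfun S (p + q)"
    unfolding schur_v_def p(1) q(1) by (rule tensor_algebra_add[OF p(2) q(2)])
  ultimately show ?thesis
    using p q by (simp add: acts_diag_class schur_v_apply_add pm_scale_add_left)
qed

lemma acts_diag_smult:
  assumes "acts_diag P d"
  shows "acts_diag (c \<odot>\<^bsub>schur_v r act\<^esub> P) (\<lambda>w. c * d w)"
proof -
  obtain p where p: "P = tensor_class laurent_to_ratfun S p" "Poly_Mapping.keys p \<subseteq> carrier S"
    "\<And>w. length w = r \<Longrightarrow> schur_v_apply p w = pm_scale (d w) (om w)"
    using acts_diagE[OF assms(1)] by blast
  have "Poly_Mapping.keys (pm_scale c p) \<subseteq> carrier S"
    using p(2) keys_pm_scale[of c p] by blast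
  moreover have "c \<odot>\<^bsub>schur_v r act\<^esub> P = tensor_class laurent_to_ratfun S (pm_scale c p)"
    unfolding schur_v_def p(1) by (rule tensor_algebra_smult[OF p(2)])
  ultimately show ?thesis
    using p by (simp add: acts_diag_class schur_v_apply_scale)
qed

lemma acts_diag_tensor_one:
  "f \<in> carrier S \<Longrightarrow> acts_diag (tensor_one laurent_to_ratfun S f) d \<longleftrightarrow>
    (\<forall>w. length w = r \<longrightarrow> rmap (f (om w)) = pm_scale (d w) (om w))"
  unfolding tensor_one_def by (subst acts_diag_class) simp_all

lemma acts_diag_one: "acts_diag \<one>\<^bsub>schur_v r act\<^esub> (\<lambda>w. 1)"
proof -
  have "\<one>\<^bsub>schur_v r act\<^esub> = tensor_one laurent_to_ratfun S \<one>\<^bsub>S\<^esub>"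
    by (simp add: schur_v_def tensor_algebra_simps)
  then show ?thesis by (simp add: acts_diag_tensor_one) (simp add: schur_ops)
qed

text \<open>Elements of the extended algebra commute with the Hecke algebra, so the latter preserves
  the eigenspaces of a diagonal element.\<close>

lemma hecke_preserves_eigenspace:
  assumes P: "acts_diag P d" and w: "length w = r" and h: "h \<in> carrier (hecke r)"
    and u: "u \<in> Poly_Mapping.keys (act (om w) h)"
  shows "d u = d w"
proof -
  obtain p where p: "Poly_Mapping.keys p \<subseteq> carrier S"
    and diag: "\<And>w. length w = r \<Longrightarrow> schur_v_apply p w = pm_scale (d w) (om w)"
    using acts_diagE[OF P] by blast
  define A where "A = (\<lambda>x. lin_ext (\<lambda>f c. pm_scale c (rmap (f x))) p)"
  let ?y = "act (om w) h"
  have y: "?y \<in> tensor_carrier r" using w h by (simp add: act_closed)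
  have swap: "A (G x) = lin_ext (\<lambda>u c. pm_scale c (A (G (om u)))) (rmap x)"
    if "\<And>f. f \<in> carrier S \<Longrightarrow>
      rmap (f (G x)) = lin_ext (\<lambda>u c. pm_scale c (rmap (f (G (om u))))) (rmap x)" for G x
  proof -
    have "A (G x) = (\<Sum>f\<in>Poly_Mapping.keys p. pm_scale (Poly_Mapping.lookup p f)
        (lin_ext (\<lambda>u c. pm_scale c (rmap (f (G (om u))))) (rmap x)))"
      unfolding A_def lin_ext_def[of _ p] by (rule sum.cong) (use that p in auto)
    also have "\<dots> = lin_ext (\<lambda>u c. pm_scale c (A (G (om u)))) (rmap x)"
      unfolding A_def lin_ext_def pm_scale_sum
      by (subst sum.swap) (simp add: mult.commute)
    finally show ?thesis .
  qed
  \<comment> \<open>apply the diagonal element to the expansion of \<open>\<omega>\<^sub>w h\<close>\<close>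
  have "A ?y = lin_ext (\<lambda>u c. pm_scale c (A (om u))) (rmap ?y)"
    by (rule swap, rule rmap_linear) (use y in \<open>simp_all add: schur_add schur_scale\<close>)
  also have "\<dots> = lin_ext (\<lambda>u c. Poly_Mapping.single u (c * d u)) (rmap ?y)"
  proof (rule lin_ext_cong)
    fix u assume "u \<in> Poly_Mapping.keys (rmap ?y)"
    then have "length u = r" using y by (auto simp: in_keys_iff tensor_carrier)
    then show "pm_scale (Poly_Mapping.lookup (rmap ?y) u) (A (om u))
        = Poly_Mapping.single u (Poly_Mapping.lookup (rmap ?y) u * d u)"
      using diag[of u] by (simp add: A_def schur_v_apply_lin_ext om_def)
  qed
  finally have 1: "Poly_Mapping.lookup (A ?y) u = laurent_to_ratfun (Poly_Mapping.lookup ?y u) * d u"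
    by (simp add: lin_ext_def lookup_sum lookup_single when_def in_keys_iff)
  \<comment> \<open>apply the Hecke algebra to the eigenvector \<open>\<omega>\<^sub>w\<close>\<close>
  define B where "B = (\<lambda>z. lin_ext (\<lambda>u c. pm_scale c (rmap (act (om u) h))) z)"
  have B: "rmap (act x h) = B (rmap x)" if "x \<in> tensor_carrier r" for x
    unfolding B_def by (rule rmap_linear) (use that h in \<open>simp_all add: act_add act_scale\<close>)
  have B_sum: "B (\<Sum>f\<in>I. pm_scale (c f) (z f)) = (\<Sum>f\<in>I. pm_scale (c f) (B (z f)))" for I c z
  proof (induction I rule: infinite_finite_induct)
    case (insert f I)
    then show ?case
      unfolding B_def
      by (simp add: lin_ext_add pm_scale_add_left lin_ext_pm_scale[where k = "c f"])
  qed (simp_all add: B_def)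
  have "A ?y = (\<Sum>f\<in>Poly_Mapping.keys p. pm_scale (Poly_Mapping.lookup p f) (B (rmap (f (om w)))))"
    unfolding A_def lin_ext_def
  proof (rule sum.cong[OF refl])
    fix f assume "f \<in> Poly_Mapping.keys p"
    then have f: "f \<in> carrier S" using p by blast
    have "f ?y = act (f (om w)) h" by (rule schur_act[OF f _ h]) (simp add: w)
    then show "pm_scale (Poly_Mapping.lookup p f) (rmap (f ?y)) =
        pm_scale (Poly_Mapping.lookup p f) (B (rmap (f (om w))))"
      using B[OF schur_closed[OF f], of "om w"] w by simp
  qed
  also have "\<dots> = B (schur_v_apply p w)"
    by (simp add: B_sum schur_v_apply_lin_ext lin_ext_def)
  also have "\<dots> = pm_scale (d w) (rmap ?y)"
    using w by (simp add: diag B) (simp add: B_def om_def lin_ext_single)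
  finally have "laurent_to_ratfun (Poly_Mapping.lookup ?y u) * d u
      = laurent_to_ratfun (Poly_Mapping.lookup ?y u) * d w"
    using 1 by (auto simp: mult.commute)
  then show ?thesis using u by (auto simp: in_keys_iff)
qed

subsection \<open>Lattices and their reductions\<close>

lemma schur_smult_ops:
  assumes "left_module (schur_v r act) Lv" "f \<in> carrier S" "g \<in> carrier S" "m \<in> carrier Lv"
  shows "schur_smult r act Lv (f \<otimes>\<^bsub>S\<^esub> g) m = schur_smult r act Lv f (schur_smult r act Lv g m)"
    and "schur_smult r act Lv (f \<oplus>\<^bsub>S\<^esub> g) m = schur_smult r act Lv f m \<oplus>\<^bsub>Lv\<^esub> schur_smult r act Lv g m"
    and "schur_smult r act Lv \<one>\<^bsub>S\<^esub> m = m"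
    and "schur_smult r act Lv \<zero>\<^bsub>S\<^esub> m = \<zero>\<^bsub>Lv\<^esub>"
    and "schur_smult r act Lv f m \<in> carrier Lv"
proof -
  interpret Lv: left_module "schur_v r act" Lv by (rule assms(1))
  note hom = S.tensor_one_ring_hom[of laurent_to_ratfun, folded schur_v_def]
  have cl: "tensor_one laurent_to_ratfun S k \<in> carrier (schur_v r act)" if "k \<in> carrier S" for k
    using ring_hom_closed[OF hom that] .
  have z: "tensor_one laurent_to_ratfun S \<zero>\<^bsub>S\<^esub> = \<zero>\<^bsub>schur_v r act\<^esub>"
    using ring_hom_zero[OF hom S.ring_axioms Lv.R.ring_axioms] .
  show "schur_smult r act Lv (f \<otimes>\<^bsub>S\<^esub> g) m = schur_smult r act Lv f (schur_smult r act Lv g m)"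
    "schur_smult r act Lv (f \<oplus>\<^bsub>S\<^esub> g) m = schur_smult r act Lv f m \<oplus>\<^bsub>Lv\<^esub> schur_smult r act Lv g m"
    "schur_smult r act Lv \<one>\<^bsub>S\<^esub> m = m" "schur_smult r act Lv \<zero>\<^bsub>S\<^esub> m = \<zero>\<^bsub>Lv\<^esub>"
    "schur_smult r act Lv f m \<in> carrier Lv"
    using assms(2-4)
    by (simp_all add: schur_smult_def ring_hom_mult[OF hom] ring_hom_add[OF hom] ring_hom_one[OF hom]
        z cl Lv.smult_assoc Lv.smult_l_distr Lv.smult_one Lv.smult_zero_left Lv.smult_closed)
qed

lemma left_module_lattice:
  assumes Lv: "left_module (schur_v r act) Lv" and w: "w \<in> carrier Lv"
  shows "left_module S (lattice r act Lv w)"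
proof -
  interpret Lv: left_module "schur_v r act" Lv by (rule Lv)
  let ?\<Lambda> = "lattice r act Lv w" and ?s = "schur_smult r act Lv"
  note ops = schur_smult_ops[OF Lv _ _ w] and cl = schur_smult_ops(5)[OF Lv _ S.one_closed]
  have \<Lambda>: "carrier ?\<Lambda> = (\<lambda>f. ?s f w) ` carrier S" "add ?\<Lambda> = add Lv" "\<zero>\<^bsub>?\<Lambda>\<^esub> = \<zero>\<^bsub>Lv\<^esub>" "smult ?\<Lambda> = ?s"
    by (auto simp: lattice_def)
  have sub: "m \<in> carrier Lv" if "m \<in> carrier ?\<Lambda>" for m
    using that cl w by (auto simp: \<Lambda>)
  have "abelian_group ?\<Lambda>"
  proof (rule abelian_groupI)
    show "\<zero>\<^bsub>?\<Lambda>\<^esub> \<in> carrier ?\<Lambda>"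
      unfolding \<Lambda> using ops(4)[OF S.one_closed S.one_closed] S.zero_closed by (metis imageI)
    fix x assume x: "x \<in> carrier ?\<Lambda>"
    then obtain f where f: "f \<in> carrier S" "x = ?s f w" by (auto simp: \<Lambda>)
    have "?s (\<ominus>\<^bsub>S\<^esub> f) w \<oplus>\<^bsub>Lv\<^esub> x = \<zero>\<^bsub>Lv\<^esub>"
      using f ops(2)[OF S.a_inv_closed[OF f(1)] f(1)] ops(4)[OF f(1) f(1)] by (simp add: S.l_neg)
    then show "\<exists>y\<in>carrier ?\<Lambda>. y \<oplus>\<^bsub>?\<Lambda>\<^esub> x = \<zero>\<^bsub>?\<Lambda>\<^esub>"
      unfolding \<Lambda> using f(1) by blast
    show "\<zero>\<^bsub>?\<Lambda>\<^esub> \<oplus>\<^bsub>?\<Lambda>\<^esub> x = x" using sub[OF x] by (simp add: \<Lambda>)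
    fix y assume y: "y \<in> carrier ?\<Lambda>"
    then obtain g where g: "g \<in> carrier S" "y = ?s g w" by (auto simp: \<Lambda>)
    show "x \<oplus>\<^bsub>?\<Lambda>\<^esub> y \<in> carrier ?\<Lambda>"
      unfolding \<Lambda> f(2) g(2) ops(2)[OF f(1) g(1), symmetric] using f(1) g(1) by blast
    show "x \<oplus>\<^bsub>?\<Lambda>\<^esub> y = y \<oplus>\<^bsub>?\<Lambda>\<^esub> x"
      using sub[OF x] sub[OF y] by (simp add: \<Lambda> Lv.M.a_comm)
    fix z assume "z \<in> carrier ?\<Lambda>"
    then show "x \<oplus>\<^bsub>?\<Lambda>\<^esub> y \<oplus>\<^bsub>?\<Lambda>\<^esub> z = x \<oplus>\<^bsub>?\<Lambda>\<^esub> (y \<oplus>\<^bsub>?\<Lambda>\<^esub> z)"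
      using sub[OF x] sub[OF y] sub by (simp add: \<Lambda> Lv.M.a_assoc)
  qed
  moreover have "left_module_axioms S ?\<Lambda>"
  proof
    fix f x assume f: "f \<in> carrier S" and x: "x \<in> carrier ?\<Lambda>"
    then obtain g where g: "g \<in> carrier S" "x = ?s g w" by (auto simp: \<Lambda>)
    show "f \<odot>\<^bsub>?\<Lambda>\<^esub> x \<in> carrier ?\<Lambda>"
      unfolding \<Lambda> g(2) ops(1)[OF f g(1), symmetric] using f g(1) by blast
    fix y assume "y \<in> carrier ?\<Lambda>"
    then show "f \<odot>\<^bsub>?\<Lambda>\<^esub> (x \<oplus>\<^bsub>?\<Lambda>\<^esub> y) = f \<odot>\<^bsub>?\<Lambda>\<^esub> x \<oplus>\<^bsub>?\<Lambda>\<^esub> f \<odot>\<^bsub>?\<Lambda>\<^esub> y"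
      using sub[OF x] sub f ring_hom_closed[OF S.tensor_one_ring_hom f, of laurent_to_ratfun]
      by (simp add: \<Lambda> schur_smult_def Lv.smult_r_distr schur_v_def)
  next
    fix f g x assume f: "f \<in> carrier S" and g: "g \<in> carrier S" and x: "x \<in> carrier ?\<Lambda>"
    note ops = schur_smult_ops[OF Lv f g sub[OF x]]
    show "(f \<oplus>\<^bsub>S\<^esub> g) \<odot>\<^bsub>?\<Lambda>\<^esub> x = f \<odot>\<^bsub>?\<Lambda>\<^esub> x \<oplus>\<^bsub>?\<Lambda>\<^esub> g \<odot>\<^bsub>?\<Lambda>\<^esub> x"
      unfolding \<Lambda>(2-4) by (rule ops(2))
    show "(f \<otimes>\<^bsub>S\<^esub> g) \<odot>\<^bsub>?\<Lambda>\<^esub> x = f \<odot>\<^bsub>?\<Lambda>\<^esub> (g \<odot>\<^bsub>?\<Lambda>\<^esub> x)"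
      unfolding \<Lambda>(2-4) by (rule ops(1))
  next
    fix x assume "x \<in> carrier ?\<Lambda>"
    from schur_smult_ops(3)[OF Lv S.one_closed S.one_closed sub[OF this]]
    show "\<one>\<^bsub>S\<^esub> \<odot>\<^bsub>?\<Lambda>\<^esub> x = x" unfolding \<Lambda>(2-4) .
  qed
  ultimately show ?thesis by (intro left_module.intro S.ring_axioms)
qed

lemma generator_in_lattice:
  "left_module (schur_v r act) Lv \<Longrightarrow> w \<in> carrier Lv \<Longrightarrow> w \<in> carrier (lattice r act Lv w)"
  using schur_smult_ops(3)[of Lv "\<one>\<^bsub>S\<^esub>" "\<one>\<^bsub>S\<^esub>" w] S.one_closed
  by (auto simp: lattice_def intro!: exI[of _ "\<one>\<^bsub>S\<^esub>"])

text \<open>Elements of the lattice have the form \<open>m = f w\<close> with \<open>f\<close> in \<open>S\<close>, and \<open>m \<otimes> c\<close> is \<open>f \<otimes> c\<close>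
  applied to \<open>w \<otimes> 1\<close>.\<close>

lemma lattice_at_generated:
  assumes Lv: "left_module (schur_v r act) Lv" and w: "w \<in> carrier Lv"
    and K: "submodule K (schur_at \<epsilon> r act) (lattice_at \<epsilon> r act Lv w)"
    and wK: "tensor_class (laurent_at \<epsilon>) (restrict_to_base S (lattice r act Lv w)) (Poly_Mapping.single w 1) \<in> K"
  shows "carrier (lattice_at \<epsilon> r act Lv w) \<subseteq> K"
proof
  let ?\<Lambda> = "lattice r act Lv w" and ?h = "laurent_at \<epsilon>"
  let ?T = "lattice_at \<epsilon> r act Lv w"
  let ?d = "tensor_class ?h (restrict_to_base S ?\<Lambda>)"
  note \<Lambda> = left_module_lattice[OF Lv w]
  have w\<Lambda>: "w \<in> carrier ?\<Lambda>" by (rule generator_in_lattice[OF Lv w])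
  fix t assume "t \<in> carrier ?T"
  then obtain z where z: "t = ?d z" "Poly_Mapping.keys z \<subseteq> carrier ?\<Lambda>"
    by (auto simp: lattice_at_def tensor_module_simps)
  have "Poly_Mapping.keys z \<subseteq> carrier ?\<Lambda> \<and> ?d z \<in> K"
  proof (induction z rule: poly_mapping_span_induct)
    case (single m)
    let ?c = "Poly_Mapping.lookup z m"
    have "m \<in> carrier ?\<Lambda>" using single z(2) by blast
    then obtain f where f: "f \<in> carrier S" "m = schur_smult r act Lv f w"
      by (auto simp: lattice_def)
    have "tensor_class ?h S (Poly_Mapping.single f ?c) \<odot>\<^bsub>?T\<^esub> ?d (Poly_Mapping.single w 1)
        = ?d (bilinear_ext (smult ?\<Lambda>) (Poly_Mapping.single f ?c) (Poly_Mapping.single w 1))"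
      unfolding lattice_at_def by (rule S.tensor_module_smult[OF \<Lambda>]) (use f w\<Lambda> in auto)
    also have "\<dots> = ?d (Poly_Mapping.single m ?c)"
      by (simp add: f(2)) (simp add: lattice_def)
    finally have "?d (Poly_Mapping.single m ?c) = tensor_class ?h S (Poly_Mapping.single f ?c) \<odot>\<^bsub>?T\<^esub> ?d (Poly_Mapping.single w 1)"
      by (rule sym)
    moreover have "tensor_class ?h S (Poly_Mapping.single f ?c) \<in> carrier (schur_at \<epsilon> r act)"
      unfolding schur_at_def tensor_algebra_simps
      by (intro CollectI exI[of _ "Poly_Mapping.single f ?c"]) (use f in simp)
    ultimately have "?d (Poly_Mapping.single m ?c) \<in> K"
      using K wK by (simp add: submodule_def submodule_axioms_def)
    then show ?case using \<open>m \<in> carrier ?\<Lambda>\<close> by simp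
  next
    case zero
    have "\<zero>\<^bsub>?T\<^esub> \<in> K"
      using K subgroup.one_closed[of K "add_monoid ?T"] by (simp add: submodule_def)
    then show ?case by (simp add: lattice_at_def tensor_module_simps)
  next
    case (add p q)
    then have "?d p \<oplus>\<^bsub>?T\<^esub> ?d q \<in> K"
      using K subgroup.m_closed[of K "add_monoid ?T" "?d p" "?d q"] by (simp add: submodule_def)
    then show ?case
      using add Poly_Mapping.keys_add[of p q] by (auto simp: lattice_at_def tensor_module_add)
  qed
  then show "t \<in> K" by (simp add: z(1))
qed

lemma lattice_at_smult_zero:
  assumes Lv: "left_module (schur_v r act) Lv" and w: "w \<in> carrier Lv" and f: "f \<in> carrier S"
    and kill: "\<And>x. x \<in> carrier Lv \<Longrightarrow> schur_smult r act Lv f x = \<zero>\<^bsub>Lv\<^esub>"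
    and t: "t \<in> carrier (lattice_at \<epsilon> r act Lv w)"
  shows "tensor_one (laurent_at \<epsilon>) S f \<odot>\<^bsub>lattice_at \<epsilon> r act Lv w\<^esub> t = \<zero>\<^bsub>lattice_at \<epsilon> r act Lv w\<^esub>"
proof -
  let ?\<Lambda> = "lattice r act Lv w" and ?h = "laurent_at \<epsilon>"
  let ?B = "restrict_to_base S ?\<Lambda>"
  note \<Lambda> = left_module_lattice[OF Lv w]
  interpret \<Lambda>: left_module S ?\<Lambda> by (rule \<Lambda>)
  obtain z where z: "t = tensor_class ?h ?B z" "Poly_Mapping.keys z \<subseteq> carrier ?\<Lambda>"
    using t by (auto simp: lattice_at_def tensor_module_simps)
  have null: "bilinear_ext (smult ?\<Lambda>) (Poly_Mapping.single f 1) z \<in> tensor_null ?h ?B"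
  proof (induction z rule: poly_mapping_span_induct)
    case (single x)
    then have "x \<in> carrier Lv"
      using z(2) schur_smult_ops(5)[OF Lv _ S.one_closed w] by (auto simp: lattice_def)
    then have "f \<odot>\<^bsub>?\<Lambda>\<^esub> x = \<zero>\<^bsub>?B\<^esub>"
      using kill by (simp add: lattice_def restrict_to_base_def)
    moreover have "Poly_Mapping.single \<zero>\<^bsub>?B\<^esub> 1 \<in> tensor_null ?h ?B"
      using tensor_null_uminus[OF tensor_null.rel_add[of "\<zero>\<^bsub>?\<Lambda>\<^esub>" ?B "\<zero>\<^bsub>?\<Lambda>\<^esub>" ?h]]
      by (simp add: restrict_to_base_def)
    ultimately show ?case
      using tensor_null.null_scale[of _ ?h _ "Poly_Mapping.lookup z x"] by fastforce
  qed (simp_all add: tensor_null.null_zero tensor_null.null_add bilinear_ext_add_right)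
  have "tensor_one ?h S f \<odot>\<^bsub>lattice_at \<epsilon> r act Lv w\<^esub> t
      = tensor_class ?h ?B (bilinear_ext (smult ?\<Lambda>) (Poly_Mapping.single f 1) z)"
    unfolding z(1) tensor_one_def lattice_at_def
    by (rule S.tensor_module_smult[OF \<Lambda>]) (use f z(2) in auto)
  also have "\<dots> = \<zero>\<^bsub>lattice_at \<epsilon> r act Lv w\<^esub>"
    using null by (simp add: lattice_at_def tensor_module_simps tensor_class_eqI)
  finally show ?thesis .
qed

end

section \<open>Weight projections\<close>

text \<open>The entries are the exponents of the eigenvalues of the \<open>k\<^sub>i\<close> on the basis vector of \<open>w\<close>.\<close>

definition content :: "nat \<Rightarrow> int list \<Rightarrow> nat list" where
  "content N w = map (\<lambda>i. length (filter (same_res N (int i)) w)) [1..<N + 1]"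

lemma length_content [simp]: "length (content N w) = N"
  by (simp add: content_def)

lemma nth_content:
  "1 \<le> i \<Longrightarrow> i \<le> N \<Longrightarrow> content N w ! (i - 1) = length (filter (same_res N (int i)) w)"
  using nth_upt[of 1 "i - 1" "N + 1"] by (simp add: content_def del: upt_Suc)

lemma sum_list_content:
  assumes "1 \<le> N"
  shows "sum_list (content N w) = length w"
proof (induction w)
  case Nil
  then show ?case by (simp add: content_def sum_list_triv)
next
  case (Cons s w)
  have "(\<Sum>i\<in>{1..<N + 1}. of_bool (same_res N (int i) s) :: nat) = 1"
  proof -
    define j where "j = nat ((s - 1) mod int N + 1)"
    have j: "int j = (s - 1) mod int N + 1" unfolding j_def using assms by simp
    have jN: "j \<in> {1..<N + 1}"
    proof -
      have "1 \<le> int j" "int j \<le> int N"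
        using j assms pos_mod_bound[of "int N" "s - 1"] pos_mod_sign[of "int N" "s - 1"] by linarith+
      then show ?thesis by simp
    qed
    have "same_res N (int i) s \<longleftrightarrow> i = j" if "i \<in> {1..<N + 1}" for i
    proof
      assume "same_res N (int i) s"
      then have "(int i - 1) mod int N = (s - 1) mod int N"
        unfolding same_res_def by (metis mod_diff_left_eq)
      moreover have "(int i - 1) mod int N = int i - 1" using that by (intro mod_pos_pos_trivial) auto
      ultimately show "i = j" using j by simp
    next
      assume "i = j"
      then show "same_res N (int i) s" unfolding same_res_def by (simp add: j mod_simps)
    qed
    then have "(\<Sum>i\<in>{1..<N + 1}. of_bool (same_res N (int i) s) :: nat) = (\<Sum>i\<in>{1..<N + 1}. of_bool (i = j))"
      by (intro sum.cong) auto
    also have "\<dots> = 1" using jN by (simp add: of_bool_def)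
    finally show ?thesis .
  qed
  moreover have sum: "sum_list (content N u) = (\<Sum>i\<in>{1..<N + 1}. length (filter (same_res N (int i)) u))" for u
    unfolding content_def by (rule sum_list_distinct_conv_sum_set[of "[1..<N + 1]", unfolded set_upt]) simp
  moreover have "sum_list (content N (s # w)) = (\<Sum>i\<in>{1..<N + 1}. of_bool (same_res N (int i) s))
      + (\<Sum>i\<in>{1..<N + 1}. length (filter (same_res N (int i)) w))"
    unfolding sum sum.distrib[symmetric] by (rule sum.cong) auto
  ultimately show ?case using Cons by simp
qed

lemma content_in_compositions:
  "1 \<le> N \<Longrightarrow> length w = r \<Longrightarrow> content N w \<in> compositions N r"
  by (simp add: compositions_def sum_list_content)

lemma k_op_content:
  assumes "1 \<le> i" "i \<le> N"
  shows "k_op N e (int i) w = pm_scale (qv powi (e * int (content N w ! (i - 1)))) (om w)"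
proof -
  have "(\<Prod>s\<leftarrow>w. qv powi (e * of_bool (same_res N (int i) s)))
      = qv powi (e * int (length (filter (same_res N (int i)) w)))"
    by (induction w) (simp_all add: distrib_left power_int_add)
  then show ?thesis unfolding k_op_def nth_content[OF assms] by (simp only:)
qed

text \<open>The Gaussian binomial coefficient \<open>[a; t]\<close>, as the eigenvalue of \<open>[k\<^sub>i; 0; t]\<close> on the
  eigenspace of \<open>k\<^sub>i\<close> for \<open>v\<^sup>a\<close>.\<close>

definition gauss_binom :: "nat \<Rightarrow> nat \<Rightarrow> ratfun" where
  "gauss_binom a t = (\<Prod>s\<leftarrow>[1..<t + 1]. 1 / (qv powi int s - qv powi (- int s)) *
     (qv powi (1 - int s) * qv powi int a - qv powi (int s - 1) * qv powi (- int a)))"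

lemma gauss_binom_less:
  assumes "a < t"
  shows "gauss_binom a t = 0"
proof -
  let ?F = "\<lambda>s. 1 / (qv powi int s - qv powi (- int s)) *
     (qv powi (1 - int s) * qv powi int a - qv powi (int s - 1) * qv powi (- int a))"
  have "?F (a + 1) = 0" by (simp add: power_int_add[symmetric] del: power_int_of_nat)
  moreover have "a + 1 \<in> set [1..<t + 1]" using assms by (simp del: upt_Suc)
  ultimately have "0 \<in> set (map ?F [1..<t + 1])" unfolding set_map by (intro image_eqI[of 0 ?F "a + 1"]) simp_all
  then show ?thesis unfolding gauss_binom_def prod_list_zero_iff .
qed

lemma gauss_binom_self: "gauss_binom a a = 1"
proof -
  define f where "f s = qv powi int s - qv powi (- int s)" for s :: nat
  have nz: "f s \<noteq> 0" if "1 \<le> s" for s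
    using that by (simp add: f_def del: power_int_of_nat)
  have "gauss_binom a a = (\<Prod>s\<in>{1..<a + 1}. 1 / f s * f (a + 1 - s))"
  proof -
    have "gauss_binom a a = (\<Prod>s\<in>{1..<a + 1}. 1 / f s *
        (qv powi (1 - int s) * qv powi int a - qv powi (int s - 1) * qv powi (- int a)))"
      unfolding gauss_binom_def f_def
      by (rule prod.distinct_set_conv_list[of "[1..<a + 1]", unfolded set_upt, symmetric]) simp
    also have "\<dots> = (\<Prod>s\<in>{1..<a + 1}. 1 / f s * f (a + 1 - s))"
    proof (rule prod.cong[OF refl])
      fix s assume "s \<in> {1..<a + 1}"
      then have "int (a + 1 - s) = 1 - int s + int a" "- int (a + 1 - s) = int s - 1 + - int a" by auto
      then have "f (a + 1 - s) = qv powi (1 - int s) * qv powi int a - qv powi (int s - 1) * qv powi (- int a)"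
        unfolding f_def by (simp only: power_int_add qv_nonzero not_False_eq_True simp_thms)
      then show "1 / f s * (qv powi (1 - int s) * qv powi int a - qv powi (int s - 1) * qv powi (- int a))
          = 1 / f s * f (a + 1 - s)" by simp
    qed
    finally show ?thesis .
  qed
  also have "\<dots> = (\<Prod>s\<in>{1..<a + 1}. f (a + 1 - s)) / (\<Prod>s\<in>{1..<a + 1}. f s)"
    by (simp add: prod.distrib prod_dividef)
  also have "(\<Prod>s\<in>{1..<a + 1}. f (a + 1 - s)) = (\<Prod>s\<in>{1..<a + 1}. f s)"
    by (rule prod.reindex_bij_witness[of _ "\<lambda>s. a + 1 - s" "\<lambda>s. a + 1 - s"]) auto
  also have "\<dots> / (\<Prod>s\<in>{1..<a + 1}. f s) = 1"
    using nz by (simp add: prod_zero_iff)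
  finally show ?thesis .
qed

text \<open>Two different compositions of \<open>r\<close> cannot satisfy \<open>\<nu> \<le> \<mu>\<close> in all places, and where
  \<open>\<mu>\<^sub>i < \<nu>\<^sub>i\<close> the Gaussian binomial vanishes.\<close>

lemma prod_gauss_binom:
  assumes "\<mu> \<in> compositions N r" "\<nu> \<in> compositions N r"
  shows "(\<Prod>i\<leftarrow>[1..<N + 1]. gauss_binom (\<mu> ! (i - 1)) (\<nu> ! (i - 1))) = of_bool (\<mu> = \<nu>)"
proof (cases "\<mu> = \<nu>")
  case True
  have "(\<Prod>i\<leftarrow>is. 1 :: ratfun) = 1" for "is" :: "nat list" by (induction "is") simp_all
  with True show ?thesis by (simp add: gauss_binom_self del: upt_Suc)
next
  case False
  have len: "length \<mu> = N" "length \<nu> = N" and sums: "sum_list \<mu> = r" "sum_list \<nu> = r"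
    using assms by (simp_all add: compositions_def)
  have "\<exists>i<N. \<mu> ! i < \<nu> ! i"
  proof (rule ccontr)
    assume "\<not> (\<exists>i<N. \<mu> ! i < \<nu> ! i)"
    then have le: "\<And>i. i < N \<Longrightarrow> \<nu> ! i \<le> \<mu> ! i" by (meson not_less)
    obtain i where i: "i < N" "\<mu> ! i \<noteq> \<nu> ! i"
      using False len by (metis nth_equalityI)
    have "(\<Sum>i<N. \<nu> ! i) < (\<Sum>i<N. \<mu> ! i)"
      by (rule sum_strict_mono_ex1) (use le i in \<open>auto simp: le_neq_implies_less intro!: bexI[of _ i]\<close>)
    then show False using sums len by (simp add: sum_list_sum_nth atLeast0LessThan)
  qed
  then obtain i where i: "i < N" "\<mu> ! i < \<nu> ! i" by blast
  then have "0 \<in> set (map (\<lambda>i. gauss_binom (\<mu> ! (i - 1)) (\<nu> ! (i - 1))) [1..<N + 1])"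
    by (auto simp: gauss_binom_less image_iff simp del: upt_Suc intro!: bexI[of _ "i + 1"])
  then show ?thesis using False by (simp only: prod_list_zero_iff of_bool_eq)
qed

lemma finite_compositions: "finite (compositions n r)"
proof (rule finite_subset)
  show "compositions n r \<subseteq> {xs. set xs \<subseteq> {..r} \<and> length xs = n}"
    by (auto simp: compositions_def member_le_sum_list)
qed (simp add: finite_lists_length_eq)

lemma pad_in_compositions: "n \<le> N \<Longrightarrow> \<mu> \<in> compositions n r \<Longrightarrow> pad N \<mu> \<in> compositions N r"
  by (auto simp: compositions_def pad_def sum_list_replicate)

lemma sum_prefix_composition:
  assumes "\<nu> \<in> compositions N r" "n \<le> N"
  shows "(\<Sum>i=1..n. \<nu> ! (i - 1)) = sum_list (take n \<nu>)"
proof -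
  have "(\<Sum>i=1..n. \<nu> ! (i - 1)) = (\<Sum>i<n. \<nu> ! i)"
    by (rule sum.reindex_bij_witness[of _ "\<lambda>i. i + 1" "\<lambda>i. i - 1"]) auto
  then show ?thesis
    using assms by (simp add: sum_list_sum_nth compositions_def atLeast0LessThan)
qed

lemma sum_prefix_composition_le:
  assumes "\<nu> \<in> compositions N r" "n \<le> N"
  shows "(\<Sum>i=1..n. \<nu> ! (i - 1)) \<le> r"
proof -
  have "sum_list (take n \<nu>) + sum_list (drop n \<nu>) = r"
    using assms(1) by (simp add: compositions_def flip: sum_list_append)
  then show ?thesis unfolding sum_prefix_composition[OF assms] by linarith
qed

lemma padded_compositions_iff:
  assumes "\<nu> \<in> compositions N r" "n \<le> N"
  shows "\<nu> \<in> padded_compositions n N r \<longleftrightarrow> (\<Sum>i=1..n. \<nu> ! (i - 1)) = r"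
proof -
  show ?thesis unfolding sum_prefix_composition[OF assms]
  proof
    assume "\<nu> \<in> padded_compositions n N r"
    then show "sum_list (take n \<nu>) = r"
      by (auto simp: padded_compositions_def pad_def compositions_def)
  next
    assume r: "sum_list (take n \<nu>) = r"
    have "sum_list (take n \<nu>) + sum_list (drop n \<nu>) = r"
      using assms(1) by (simp add: compositions_def flip: sum_list_append)
    with r have "sum_list (drop n \<nu>) = 0" by simp
    then have "drop n \<nu> = replicate (N - n) 0"
      using assms by (intro replicate_eqI) (auto simp: compositions_def)
    then have "\<nu> = pad N (take n \<nu>)"
      using assms append_take_drop_id[of n \<nu>] by (simp add: pad_def compositions_def)
    moreover have "take n \<nu> \<in> compositions n r"
      using assms r by (simp add: compositions_def)
    ultimately show "\<nu> \<in> padded_compositions n N r" unfolding padded_compositions_def by blast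
  qed
qed

locale zeta_space = hecke_space +
  fixes N :: nat and \<zeta> :: "qaff_free set \<Rightarrow> (endo \<Rightarrow>\<^sub>0 ratfun) set"
  assumes zeta: "zeta_hom N r act \<zeta>" and N_pos: "1 \<le> N"
begin

abbreviation \<zeta>_class :: "qaff_free \<Rightarrow> (endo \<Rightarrow>\<^sub>0 ratfun) set" where
  "\<zeta>_class p \<equiv> \<zeta> (qaff_class N p)"

lemma zeta_ring_hom: "\<zeta> \<in> ring_hom (qaff N) (schur_v r act)"
  using zeta by (simp add: zeta_hom_def)

lemma \<zeta>_class_mult:
  "p \<in> qaff_alg N \<Longrightarrow> q \<in> qaff_alg N \<Longrightarrow> \<zeta>_class (p * q) = \<zeta>_class p \<otimes>\<^bsub>schur_v r act\<^esub> \<zeta>_class q"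
  using ring_hom_mult[OF qaff_class_hom, of p N q] ring_hom_mult[OF zeta_ring_hom]
  by (simp add: qaff_class_closed)

lemma \<zeta>_class_add:
  "p \<in> qaff_alg N \<Longrightarrow> q \<in> qaff_alg N \<Longrightarrow> \<zeta>_class (p + q) = \<zeta>_class p \<oplus>\<^bsub>schur_v r act\<^esub> \<zeta>_class q"
  using ring_hom_add[OF qaff_class_hom, of p N q] ring_hom_add[OF zeta_ring_hom]
  by (simp add: qaff_class_closed)

lemma \<zeta>_class_one: "\<zeta>_class 1 = \<one>\<^bsub>schur_v r act\<^esub>"
  using ring_hom_one[OF qaff_class_hom, of N] ring_hom_one[OF zeta_ring_hom] by simp

lemma \<zeta>_class_scal:
  "p \<in> qaff_alg N \<Longrightarrow> \<zeta>_class (scal c * p) = c \<odot>\<^bsub>schur_v r act\<^esub> \<zeta>_class p"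
  using zeta by (simp add: zeta_hom_def qaff_smult[symmetric] qaff_class_closed)

definition acts_diag_word :: "qaff_free \<Rightarrow> (int list \<Rightarrow> ratfun) \<Rightarrow> bool" where
  "acts_diag_word p d \<longleftrightarrow> p \<in> qaff_alg N \<and> acts_diag (\<zeta>_class p) d"

lemma acts_diag_word_mult:
  "acts_diag_word p d \<Longrightarrow> acts_diag_word q d' \<Longrightarrow> acts_diag_word (p * q) (\<lambda>w. d w * d' w)"
  by (simp add: acts_diag_word_def \<zeta>_class_mult acts_diag_mult free_algebra_mult)

lemma acts_diag_word_scal:
  "acts_diag_word p d \<Longrightarrow> acts_diag_word (scal c * p) (\<lambda>w. c * d w)"
  by (simp add: acts_diag_word_def \<zeta>_class_scal acts_diag_smult free_algebra_mult free_algebra_scal)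

lemma acts_diag_word_diff:
  assumes "acts_diag_word p d" "acts_diag_word q d'"
  shows "acts_diag_word (p - q) (\<lambda>w. d w - d' w)"
proof -
  have "acts_diag_word (scal (- 1) * q) (\<lambda>w. - 1 * d' w)"
    by (rule acts_diag_word_scal[OF assms(2)])
  then have q: "scal (- 1) * q \<in> qaff_alg N" "acts_diag (\<zeta>_class (scal (- 1) * q)) (\<lambda>w. - 1 * d' w)"
    unfolding acts_diag_word_def by blast+
  have p: "p \<in> qaff_alg N" "acts_diag (\<zeta>_class p) d"
    using assms(1) by (simp_all add: acts_diag_word_def)
  have "acts_diag_word (p + scal (- 1) * q) (\<lambda>w. d w + - 1 * d' w)"
    unfolding acts_diag_word_def \<zeta>_class_add[OF p(1) q(1)]
    by (intro conjI free_algebra_add acts_diag_add p q)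
  then show ?thesis by (simp add: scal_uminus)
qed

lemma acts_diag_word_one: "acts_diag_word 1 (\<lambda>w. 1)"
  by (simp add: acts_diag_word_def \<zeta>_class_one acts_diag_one free_algebra_one)

lemma acts_diag_word_prod_list:
  assumes "\<And>i. i \<in> set is \<Longrightarrow> acts_diag_word (p i) (d i)"
  shows "acts_diag_word (\<Prod>i\<leftarrow>is. p i) (\<lambda>w. \<Prod>i\<leftarrow>is. d i w)"
  using assms by (induction "is") (simp_all add: acts_diag_word_one acts_diag_word_mult)

lemma acts_diag_word_k:
  assumes "1 \<le> i" "i \<le> N"
  shows "acts_diag_word (k_gen i) (\<lambda>w. qv powi int (content N w ! (i - 1)))"
    and "acts_diag_word (k_inv i) (\<lambda>w. qv powi (- int (content N w ! (i - 1))))"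
proof -
  have "acts_as r (\<zeta>_class (k_gen i)) (k_op N 1 (int i))" "acts_as r (\<zeta>_class (k_inv i)) (k_op N (-1) (int i))"
    using zeta assms by (simp_all add: zeta_hom_def)
  moreover have "\<zeta>_class p \<in> carrier (schur_v r act)" if "p \<in> qaff_alg N" for p
    using ring_hom_closed[OF zeta_ring_hom qaff_class_closed[OF that]] .
  ultimately show "acts_diag_word (k_gen i) (\<lambda>w. qv powi int (content N w ! (i - 1)))"
    "acts_diag_word (k_inv i) (\<lambda>w. qv powi (- int (content N w ! (i - 1))))"
    using assms by (simp_all add: acts_diag_word_def acts_diag_def free_algebra_gen acts_as_def k_op_content)
qed

lemma acts_diag_k_binom:
  assumes "1 \<le> i" "i \<le> N"
  shows "acts_diag_word (k_binom i t) (\<lambda>w. gauss_binom (content N w ! (i - 1)) t)"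
  unfolding k_binom_def gauss_binom_def
  by (intro acts_diag_word_prod_list acts_diag_word_scal acts_diag_word_diff acts_diag_word_k assms)

text \<open>The \<open>k\<^sub>i\<close> act diagonally, and their eigenvalues determine the content.\<close>

lemma hecke_preserves_content:
  assumes "length w = r" "h \<in> carrier (hecke r)" "u \<in> Poly_Mapping.keys (act (om w) h)"
  shows "content N u = content N w"
proof (rule nth_equalityI)
  fix i assume "i < length (content N u)"
  then have "1 \<le> i + 1" "i + 1 \<le> N" by simp_all
  from acts_diag_word_k(1)[OF this] have "qv powi int (content N u ! i) = qv powi int (content N w ! i)"
    unfolding acts_diag_word_def by (auto dest: hecke_preserves_eigenspace[OF _ assms])
  then show "content N u ! i = content N w ! i" by (simp del: power_int_of_nat)
qed simp

definition weight_proj :: "nat list set \<Rightarrow> endo" where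
  "weight_proj A = (\<lambda>x\<in>tensor_carrier r. Poly_Mapping.mapp (\<lambda>w c. c when content N w \<in> A) x)"

lemma lookup_weight_proj:
  "x \<in> tensor_carrier r \<Longrightarrow>
   Poly_Mapping.lookup (weight_proj A x) w = (Poly_Mapping.lookup x w when content N w \<in> A)"
  by (simp add: weight_proj_def lookup_mapp when_def in_keys_iff)

lemma weight_proj_om:
  "length w = r \<Longrightarrow> weight_proj A (om w) = (if content N w \<in> A then om w else 0)"
  by (rule poly_mapping_eqI) (simp add: lookup_weight_proj, simp add: om_def lookup_single when_def)

lemma weight_proj_closed: "weight_proj A \<in> carrier S"
proof (rule schurI)
  show "weight_proj A \<in> extensional (tensor_carrier r)" by (simp add: weight_proj_def)
  fix x :: "int list \<Rightarrow>\<^sub>0 laurent" assume x: "x \<in> tensor_carrier r"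
  show closed: "weight_proj A y \<in> tensor_carrier r" if "y \<in> tensor_carrier r" for y
    using that unfolding tensor_carrier
    by (auto simp: in_keys_iff lookup_weight_proj[OF that] when_def split: if_splits)
  show add: "weight_proj A (y + z) = weight_proj A y + weight_proj A z"
    if "y \<in> tensor_carrier r" "z \<in> tensor_carrier r" for y z
    by (rule poly_mapping_eqI) (use that in \<open>simp add: lookup_weight_proj lookup_add when_def\<close>)
  have scale: "weight_proj A (pm_scale c y) = pm_scale c (weight_proj A y)"
    if "y \<in> tensor_carrier r" for c y
    by (rule poly_mapping_eqI) (use that in \<open>simp add: lookup_weight_proj when_def\<close>)
  fix h assume h: "h \<in> carrier (hecke r)"
  \<comment> \<open>all basis vectors in \<open>\<omega>\<^sub>w h\<close> have the content of \<open>w\<close>\<close>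
  have basis: "weight_proj A (act (om w) h) = act (weight_proj A (om w)) h" if w: "length w = r" for w
  proof -
    have y: "act (om w) h \<in> tensor_carrier r" using w h by (simp add: act_closed)
    have "weight_proj A (act (om w) h) = (if content N w \<in> A then act (om w) h else 0)"
    proof (rule poly_mapping_eqI)
      fix u
      show "Poly_Mapping.lookup (weight_proj A (act (om w) h)) u
          = Poly_Mapping.lookup (if content N w \<in> A then act (om w) h else 0) u"
        using hecke_preserves_content[OF w h, of u]
        by (cases "u \<in> Poly_Mapping.keys (act (om w) h)")
          (simp_all add: lookup_weight_proj[OF y] in_keys_iff)
    qed
    then show ?thesis using h by (simp add: weight_proj_om[OF w] act_zero)
  qed
  have "weight_proj A (act x h) = lin_ext (\<lambda>u c. pm_scale c (weight_proj A (act (om u) h))) x"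
    by (rule linear_on_basis) (use x h in \<open>simp_all add: act_add act_scale act_closed add scale\<close>)
  also have "\<dots> = lin_ext (\<lambda>u c. pm_scale c (act (weight_proj A (om u)) h)) x"
    by (rule lin_ext_cong) (use x basis in \<open>simp add: tensor_carrier\<close>)
  also have "\<dots> = act (weight_proj A x) h"
    by (rule linear_on_basis[symmetric]) (use x h in \<open>simp_all add: act_add act_scale closed add scale\<close>)
  finally show "weight_proj A (act x h) = act (weight_proj A x) h" .
qed

lemma schur_zero: "f \<in> carrier S \<Longrightarrow> f 0 = 0"
  using schur_scale[of f 0 0] by simp

lemma weight_proj_mult: "weight_proj A \<otimes>\<^bsub>S\<^esub> weight_proj B = weight_proj (A \<inter> B)"
  by (rule schur_eqI)
    (simp_all add: schur_apply weight_proj_closed schur_zero[OF weight_proj_closed] weight_proj_om)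

lemma weight_proj_add: "A \<inter> B = {} \<Longrightarrow> weight_proj A \<oplus>\<^bsub>S\<^esub> weight_proj B = weight_proj (A \<union> B)"
  by (rule schur_eqI) (auto simp add: schur_apply weight_proj_closed weight_proj_om)

lemma weight_proj_empty: "weight_proj {} = \<zero>\<^bsub>S\<^esub>"
  by (rule schur_eqI) (simp_all add: schur_apply weight_proj_closed weight_proj_om)

lemma acts_diag_weight_proj:
  "acts_diag (tensor_one laurent_to_ratfun S (weight_proj A)) (\<lambda>w. of_bool (content N w \<in> A))"
  by (auto simp: acts_diag_tensor_one weight_proj_closed weight_proj_om)

lemma tensor_one_injective:
  assumes "f \<in> carrier S" "g \<in> carrier S"
    and "tensor_one laurent_to_ratfun S f = tensor_one laurent_to_ratfun S g"
  shows "f = g"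
proof (rule schur_eqI[OF assms(1,2)])
  fix w :: "int list" assume w: "length w = r"
  have "Poly_Mapping.single f 1 - Poly_Mapping.single g 1 \<in> tensor_null laurent_to_ratfun S"
    using assms(3) unfolding tensor_one_def by (rule tensor_class_eqD) (simp add: assms(1))
  from schur_v_apply_null[OF this w] have "rmap (f (om w)) = rmap (g (om w))"
    by (simp add: schur_v_apply_diff)
  then show "f (om w) = g (om w)" by (simp only: rmap_eq_iff)
qed

text \<open>The projection and the product of the \<open>\<zeta> [k\<^sub>i; 0; \<nu>\<^sub>i]\<close> act by the same eigenvalues, so they
  agree by faithfulness. The description in \<^const>\<open>idem\<close> is unique because the integral Schur
  algebra embeds into its extension.\<close>

lemma idem_eq_weight_proj:
  assumes "\<nu> \<in> compositions N r"
  shows "idem N r act \<zeta> \<nu> = weight_proj {\<nu>}"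
proof -
  let ?P = "\<lambda>is. foldr (mult (schur_v r act))
    (map (\<lambda>i. \<zeta>_class (k_binom i (\<nu> ! (i - 1)))) is) \<one>\<^bsub>schur_v r act\<^esub>"
  have diag: "acts_diag (?P is) (\<lambda>w. \<Prod>i\<leftarrow>is. gauss_binom (content N w ! (i - 1)) (\<nu> ! (i - 1)))"
    if "set is \<subseteq> {1..N}" for "is"
    using that
  proof (induction "is")
    case (Cons i "is")
    then have "acts_diag (\<zeta>_class (k_binom i (\<nu> ! (i - 1)))) (\<lambda>w. gauss_binom (content N w ! (i - 1)) (\<nu> ! (i - 1)))"
      using acts_diag_k_binom[of i] by (simp add: acts_diag_word_def)
    from acts_diag_mult[OF this Cons.IH] Cons.prems show ?case by simp
  qed (simp add: acts_diag_one)
  have "tensor_one laurent_to_ratfun S (weight_proj {\<nu>}) = ?P [1..<N + 1]"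
  proof (rule acts_diag_eqI[OF acts_diag_weight_proj diag])
    fix w :: "int list" assume "length w = r"
    from prod_gauss_binom[OF content_in_compositions[OF N_pos this] assms]
    show "of_bool (content N w \<in> {\<nu>}) =
        (\<Prod>i\<leftarrow>[1..<N + 1]. gauss_binom (content N w ! (i - 1)) (\<nu> ! (i - 1)))"
      by (simp only: singleton_iff)
  qed auto
  then show ?thesis
    unfolding idem_def
    by (intro the_equality) (auto intro: weight_proj_closed tensor_one_injective)
qed

lemma corner_idem_eq_weight_proj:
  assumes "n \<le> N"
  shows "corner_idem n N r act \<zeta> = weight_proj (padded_compositions n N r)"
proof -
  have "finsum S (\<lambda>\<mu>. idem N r act \<zeta> (pad N \<mu>)) I = weight_proj (pad N ` I)"
    if "finite I" "I \<subseteq> compositions n r" for I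
    using that
  proof (induction I rule: finite_induct)
    case (insert \<mu> I)
    have proj: "idem N r act \<zeta> (pad N \<kappa>) = weight_proj {pad N \<kappa>}" if "\<kappa> \<in> insert \<mu> I" for \<kappa>
      using that insert.prems assms by (intro idem_eq_weight_proj pad_in_compositions) auto
    have "pad N \<mu> \<notin> pad N ` I"
    proof
      assume "pad N \<mu> \<in> pad N ` I"
      then obtain \<kappa> where "\<kappa> \<in> I" "pad N \<mu> = pad N \<kappa>" by blast
      moreover from this have "length \<mu> = length \<kappa>"
        using insert.prems by (auto simp: compositions_def)
      ultimately have "\<mu> \<in> I" by (simp add: pad_def)
      then show False using insert.hyps by simp
    qed
    then have "weight_proj {pad N \<mu>} \<oplus>\<^bsub>S\<^esub> weight_proj (pad N ` I) = weight_proj (insert (pad N \<mu>) (pad N ` I))"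
      using weight_proj_add[of "{pad N \<mu>}" "pad N ` I"] by simp
    moreover have "finsum S (\<lambda>\<mu>. idem N r act \<zeta> (pad N \<mu>)) (insert \<mu> I)
        = weight_proj {pad N \<mu>} \<oplus>\<^bsub>S\<^esub> weight_proj (pad N ` I)"
      using insert proj by (simp add: weight_proj_closed Pi_def)
    ultimately show ?case by simp
  qed (simp add: weight_proj_empty)
  from this[OF finite_compositions order_refl] show ?thesis
    by (simp add: corner_idem_def padded_compositions_def)
qed

end

section \<open>Modules over both algebras\<close>

locale zeta_module = zeta_space +
  fixes L :: "(qaff_free set, 'm) module" and Lv :: "((endo \<Rightarrow>\<^sub>0 ratfun) set, 'm) module"
  assumes L: "left_module (qaff N) L" and via: "module_via (qaff N) (schur_v r act) \<zeta> L Lv"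
begin

sublocale L: qaff_module N L by (rule qaff_module.intro[OF L])

sublocale Lv: left_module "schur_v r act" Lv
  using via by (simp add: module_via_def)

lemma via_simps: "carrier Lv = carrier L" "\<zero>\<^bsub>Lv\<^esub> = \<zero>\<^bsub>L\<^esub>" "add Lv = add L"
  using via by (simp_all add: module_via_def)

lemma via_smult: "p \<in> qaff_alg N \<Longrightarrow> x \<in> carrier L \<Longrightarrow> \<zeta>_class p \<odot>\<^bsub>Lv\<^esub> x = L.op p x"
  using via by (simp add: module_via_def qaff_class_closed L.op_def)

text \<open>The scalar \<open>a - b\<close> is invertible in \<open>\<complex>(v)\<close>. The module has no scalar multiplication of its
  own, so the scalars act through multiples of elements of the algebra.\<close>

lemma smult_eq_zeroI:
  assumes P: "acts_diag P d" and y: "y \<in> carrier Lv" and ab: "a \<noteq> b"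
    and eq: "(a \<odot>\<^bsub>schur_v r act\<^esub> P) \<odot>\<^bsub>Lv\<^esub> y = (b \<odot>\<^bsub>schur_v r act\<^esub> P) \<odot>\<^bsub>Lv\<^esub> y"
  shows "P \<odot>\<^bsub>Lv\<^esub> y = \<zero>\<^bsub>Lv\<^esub>"
proof -
  let ?V = "schur_v r act"
  define s where "s c = c \<odot>\<^bsub>?V\<^esub> P" for c
  have diag: "acts_diag (s c) (\<lambda>w. c * d w)" for c
    unfolding s_def by (rule acts_diag_smult[OF P])
  then have s: "s c \<in> carrier ?V" for c by (simp add: acts_diag_def)
  define u where "u = (1 / (a - b)) \<odot>\<^bsub>?V\<^esub> \<one>\<^bsub>?V\<^esub>"
  have u_diag: "acts_diag u (\<lambda>w. 1 / (a - b) * 1)"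
    unfolding u_def by (rule acts_diag_smult[OF acts_diag_one])
  then have u: "u \<in> carrier ?V" by (simp add: acts_diag_def)
  have "s a = s (a - b) \<oplus>\<^bsub>?V\<^esub> s b"
    by (rule acts_diag_eqI[OF diag acts_diag_add[OF diag diag]]) (simp add: algebra_simps)
  then have "s b \<odot>\<^bsub>Lv\<^esub> y = s (a - b) \<odot>\<^bsub>Lv\<^esub> y \<oplus>\<^bsub>Lv\<^esub> s b \<odot>\<^bsub>Lv\<^esub> y"
    using eq Lv.smult_l_distr[OF s s y] by (simp add: s_def)
  then have 0: "s (a - b) \<odot>\<^bsub>Lv\<^esub> y = \<zero>\<^bsub>Lv\<^esub>"
    using Lv.smult_closed[OF s y] by (simp add: Lv.M.add.r_cancel_one')
  have "P = u \<otimes>\<^bsub>?V\<^esub> s (a - b)"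
    by (rule acts_diag_eqI[OF P acts_diag_mult[OF u_diag diag]]) (use ab in simp)
  then have "P \<odot>\<^bsub>Lv\<^esub> y = u \<odot>\<^bsub>Lv\<^esub> (s (a - b) \<odot>\<^bsub>Lv\<^esub> y)"
    using Lv.smult_assoc[OF u s y] by simp
  then show ?thesis using Lv.smult_zero_right[OF u] by (simp add: 0)
qed

text \<open>A content is padded if and only if its first \<open>n\<close> entries have sum \<open>r\<close>, so
  \<open>e k\<^sub>1 \<cdots> k\<^sub>n = v\<^sup>r e\<close>. Compare this with the eigenvalue of \<open>k\<^sub>1 \<cdots> k\<^sub>n\<close> on \<open>x\<close>.\<close>

lemma corner_kills_weight_vector:
  assumes n: "n \<le> N" and x: "L.weight_vector a x" and ne: "weight_height n a \<noteq> int r"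
  shows "schur_smult r act Lv (weight_proj (padded_compositions n N r)) x = \<zero>\<^bsub>Lv\<^esub>"
proof -
  let ?V = "schur_v r act" and ?C = "padded_compositions n N r"
  define E where "E = tensor_one laurent_to_ratfun S (weight_proj ?C)"
  define K where "K = (\<Prod>i\<leftarrow>[1..<n + 1]. k_gen i)"
  have E: "acts_diag E (\<lambda>w. of_bool (content N w \<in> ?C))"
    unfolding E_def by (rule acts_diag_weight_proj)
  have xL: "x \<in> carrier L" using x by (simp add: L.weight_vector_def)
  have K: "acts_diag_word K (\<lambda>w. \<Prod>i\<leftarrow>[1..<n + 1]. qv powi int (content N w ! (i - 1)))"
    unfolding K_def by (rule acts_diag_word_prod_list, rule acts_diag_word_k) (use n in auto)
  have K_diag: "acts_diag (\<zeta>_class K) (\<lambda>w. qv ^ (\<Sum>i=1..n. content N w ! (i - 1)))"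
  proof -
    have "(\<Prod>i\<leftarrow>is. qv ^ c i) = qv ^ (\<Sum>i\<leftarrow>is. c i)" for c :: "nat \<Rightarrow> nat" and "is"
      by (induction "is") (simp_all add: power_add)
    moreover have "(\<Sum>i\<leftarrow>[1..<n + 1]. c i) = (\<Sum>i=1..n. c i)" for c :: "nat \<Rightarrow> nat"
      by (simp add: interv_sum_list_conv_sum_set_nat atLeastLessThanSuc_atLeastAtMost del: upt_Suc)
    ultimately show ?thesis using K by (simp add: acts_diag_word_def del: upt_Suc)
  qed
  have KA: "K \<in> qaff_alg N" using K by (simp add: acts_diag_word_def)
  define h where "h = weight_height n a"
  have scal_diag: "acts_diag (\<zeta>_class (scal c)) (\<lambda>w. c)" for c
    using acts_diag_word_scal[OF acts_diag_word_one, of c] by (simp add: acts_diag_word_def)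
  have "E \<otimes>\<^bsub>?V\<^esub> \<zeta>_class K = (qv ^ r) \<odot>\<^bsub>?V\<^esub> E"
  proof (rule acts_diag_eqI[OF acts_diag_mult[OF E K_diag] acts_diag_smult[OF E]])
    fix w :: "int list" assume "length w = r"
    from padded_compositions_iff[OF content_in_compositions[OF N_pos this] n]
    show "of_bool (content N w \<in> ?C) * qv ^ (\<Sum>i=1..n. content N w ! (i - 1))
        = qv ^ r * of_bool (content N w \<in> ?C)"
      by simp
  qed
  moreover have "E \<otimes>\<^bsub>?V\<^esub> \<zeta>_class (scal (qv powi h)) = (qv powi h) \<odot>\<^bsub>?V\<^esub> E"
    by (rule acts_diag_eqI[OF acts_diag_mult[OF E scal_diag] acts_diag_smult[OF E]]) simp
  moreover have "\<zeta>_class K \<odot>\<^bsub>Lv\<^esub> x = \<zeta>_class (scal (qv powi h)) \<odot>\<^bsub>Lv\<^esub> x"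
  proof -
    have "(\<Sum>i\<leftarrow>[1..<n + 1]. a i) = h"
      by (simp add: h_def weight_height_def interv_sum_list_conv_sum_set_nat
          atLeastLessThanSuc_atLeastAtMost del: upt_Suc)
    moreover have "L.op K x = L.op (scal (qv powi (\<Sum>i\<leftarrow>[1..<n + 1]. a i))) x"
      unfolding K_def by (rule L.op_k_prod[OF x]) (use n in auto)
    ultimately show ?thesis using KA xL by (simp add: via_smult free_algebra_scal)
  qed
  moreover have "(E \<otimes>\<^bsub>?V\<^esub> \<zeta>_class p) \<odot>\<^bsub>Lv\<^esub> x = E \<odot>\<^bsub>Lv\<^esub> (\<zeta>_class p \<odot>\<^bsub>Lv\<^esub> x)"
    if "acts_diag (\<zeta>_class p) d" for p d
    using that E xL by (intro Lv.smult_assoc) (simp_all add: acts_diag_def via_simps)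
  ultimately have eq: "(qv ^ r \<odot>\<^bsub>?V\<^esub> E) \<odot>\<^bsub>Lv\<^esub> x = (qv powi h \<odot>\<^bsub>?V\<^esub> E) \<odot>\<^bsub>Lv\<^esub> x"
    using K_diag scal_diag by metis
  have "qv ^ r \<noteq> qv powi h"
    using ne qv_powi_eq_iff[of "int r" h] by (simp add: h_def)
  from smult_eq_zeroI[OF E _ this eq] xL show ?thesis
    by (simp add: via_simps schur_smult_def E_def)
qed

lemma corner_kills_low_module:
  assumes n: "n \<le> N" and hw: "highest_weight_module N L hw a"
    and height: "weight_height n a < int r" and x: "x \<in> carrier Lv"
  shows "schur_smult r act Lv (weight_proj (padded_compositions n N r)) x = \<zero>\<^bsub>Lv\<^esub>"
  using n x[unfolded via_simps]
proof (rule highest_weight_module.weight_vector_induct[OF hw])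
  let ?e = "weight_proj (padded_compositions n N r)"
  fix b y assume "L.weight_vector b y" and "weight_height n b \<le> weight_height n a"
  then show "schur_smult r act Lv ?e y = \<zero>\<^bsub>Lv\<^esub>"
    using height by (intro corner_kills_weight_vector[OF n]) auto
next
  let ?e = "weight_proj (padded_compositions n N r)"
  fix y z assume "y \<in> carrier L" "z \<in> carrier L"
    and "schur_smult r act Lv ?e y = \<zero>\<^bsub>Lv\<^esub>" "schur_smult r act Lv ?e z = \<zero>\<^bsub>Lv\<^esub>"
  moreover have "tensor_one laurent_to_ratfun S ?e \<in> carrier (schur_v r act)"
    unfolding schur_v_def by (rule tensor_one_closed[OF weight_proj_closed])
  ultimately show "schur_smult r act Lv ?e (y \<oplus>\<^bsub>L\<^esub> z) = \<zero>\<^bsub>Lv\<^esub>"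
    by (simp add: schur_smult_def Lv.smult_r_distr flip: via_simps)
qed

end

theorem proposition3p5:
  fixes \<epsilon> :: complex and l n N r :: nat
    and act :: hecke_act
    and \<zeta> :: "qaff_free set \<Rightarrow> (endo \<Rightarrow>\<^sub>0 ratfun) set"
    and Q :: "ratfun poly list"
    and L :: "(qaff_free set, qaff_free set set set) module"
    and Lv :: "((endo \<Rightarrow>\<^sub>0 ratfun) set, qaff_free set set set) module"
    and w :: "qaff_free set set set"
    and V :: "((endo \<Rightarrow>\<^sub>0 complex) set, (qaff_free set set set \<Rightarrow>\<^sub>0 complex) set set) module"
  assumes "primitive_root_of_unity l \<epsilon>" and "2 \<le> n" and "n \<le> N" and "1 \<le> r"
    and "hecke_action N r act"
    and "zeta_hom N r act \<zeta>"
    and "Q \<in> drinfeld_tuples_deg N r"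
    and "irreducible_quotient (qaff N) (hw_module N Q) L"
    and "module_via (qaff N) (schur_v r act) \<zeta> L Lv"
    and "w \<in> {schur_smult r act Lv (idem N r act \<zeta> (map degree Q)) m | m. m \<in> carrier Lv}"
    and "w \<noteq> \<zero>\<^bsub>Lv\<^esub>"
    and "irreducible_quotient (schur_at \<epsilon> r act) (lattice_at \<epsilon> r act Lv w) V"
  shows "carrier (functor_G \<epsilon> n N r act \<zeta> V) \<noteq> {\<zero>\<^bsub>functor_G \<epsilon> n N r act \<zeta> V\<^esub>} \<longleftrightarrow>
         map degree Q \<in> padded_compositions n N r"
proof -
  obtain K where K: "submodule K (qaff N) (hw_module N Q)" "L = quot_module (hw_module N Q) K"
    and L_mod: "left_module (qaff N) L"
    using assms(8) by (auto simp: irreducible_quotient_def simple_module_def)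
  interpret zeta_module r act N \<zeta> L Lv
  proof (intro zeta_module.intro zeta_space.intro hecke_space.intro zeta_space_axioms.intro
      zeta_module_axioms.intro L_mod assms(6,9))
    show "right_module (hecke r) (tensor_space r) act" using assms(5) by (simp add: hecke_action_def)
    show "1 \<le> N" using assms(2,3) by simp
  qed
  obtain hw where hw: "highest_weight_module N L hw (\<lambda>i. int (degree (Q ! (i - 1))))"
    using highest_weight_quotient[OF left_module.axioms(1)[OF L_mod] K(1)] N_pos unfolding K(2) by blast
  define \<nu> where "\<nu> = map degree Q"
  let ?C = "padded_compositions n N r"
  define e where "e = weight_proj ?C"
  have e: "corner_idem n N r act \<zeta> = e"
    unfolding e_def by (rule corner_idem_eq_weight_proj[OF assms(3)])
  have eS: "e \<in> carrier S" unfolding e_def by (rule weight_proj_closed)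
  have Q: "length Q = N" "sum_list \<nu> = r"
    using assms(7) by (simp_all add: drinfeld_tuples_deg_def drinfeld_tuples_def \<nu>_def)
  then have \<nu>: "\<nu> \<in> compositions N r" by (simp add: compositions_def \<nu>_def)
  have Lv_mod: "left_module (schur_v r act) Lv" by (rule Lv.left_module_axioms)
  obtain m where m: "m \<in> carrier Lv" "w = schur_smult r act Lv (weight_proj {\<nu>}) m"
    using assms(10) unfolding \<nu>_def[symmetric] idem_eq_weight_proj[OF \<nu>] by blast
  have w: "w \<in> carrier Lv"
    using schur_smult_ops(5)[OF Lv_mod weight_proj_closed weight_proj_closed m(1)] by (simp add: m(2))
  let ?h = "laurent_at \<epsilon>" and ?\<Lambda> = "lattice r act Lv w" and ?T = "lattice_at \<epsilon> r act Lv w"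
  let ?d = "tensor_class ?h (restrict_to_base S ?\<Lambda>)"
  have \<Lambda>: "left_module S ?\<Lambda>" by (rule left_module_lattice[OF Lv_mod w])
  obtain K' where K': "submodule K' (schur_at \<epsilon> r act) ?T" and V: "V = quot_module ?T K'"
    and V_mod: "left_module (schur_at \<epsilon> r act) V" and V_ne: "carrier V \<noteq> {\<zero>\<^bsub>V\<^esub>}"
    using assms(12) by (auto simp: irreducible_quotient_def simple_module_def)
  interpret V: left_module "schur_at \<epsilon> r act" V by (rule V_mod)
  have T_mod: "left_module (schur_at \<epsilon> r act) ?T"
    unfolding schur_at_def lattice_at_def
    by (rule S.left_module_tensor_module[OF \<Lambda> V.R.ring_axioms[unfolded schur_at_def]])
  interpret T: left_module "schur_at \<epsilon> r act" ?T by (rule T_mod)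
  note V_carrier = quot_module_carrier[OF T_mod K', folded V]
  note V_zero = quot_module_zero[OF T_mod K', folded V]
  define E where "E = tensor_one ?h S e"
  have E: "E \<in> carrier (schur_at \<epsilon> r act)"
    unfolding E_def schur_at_def by (rule tensor_one_closed[OF eS])
  have G: "carrier (functor_G \<epsilon> n N r act \<zeta> V) = (\<lambda>x. E \<odot>\<^bsub>V\<^esub> x) ` carrier V"
    "\<zero>\<^bsub>functor_G \<epsilon> n N r act \<zeta> V\<^esub> = \<zero>\<^bsub>V\<^esub>"
    by (auto simp: functor_G_def Let_def e E_def)
  show ?thesis
    unfolding G \<nu>_def[symmetric]
  proof
    assume padded: "\<nu> \<in> ?C"
    show "(\<lambda>x. E \<odot>\<^bsub>V\<^esub> x) ` carrier V \<noteq> {\<zero>\<^bsub>V\<^esub>}"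
    proof
      assume 0: "(\<lambda>x. E \<odot>\<^bsub>V\<^esub> x) ` carrier V = {\<zero>\<^bsub>V\<^esub>}"
      let ?w = "?d (Poly_Mapping.single w 1)"
      have w\<Lambda>: "w \<in> carrier ?\<Lambda>" by (rule generator_in_lattice[OF Lv_mod w])
      have w_keys: "Poly_Mapping.keys (Poly_Mapping.single w 1) \<subseteq> carrier ?\<Lambda>"
        using w\<Lambda> by simp
      then have wT: "?w \<in> carrier ?T"
        unfolding lattice_at_def tensor_module_simps by blast
      have "schur_smult r act Lv e w = w"
        using schur_smult_ops(1)[OF Lv_mod eS weight_proj_closed m(1), of "{\<nu>}"] padded
        by (simp add: m(2) e_def weight_proj_mult Int_insert_right)
      moreover have "E \<odot>\<^bsub>?T\<^esub> ?w = ?d (bilinear_ext (smult ?\<Lambda>) (Poly_Mapping.single e 1) (Poly_Mapping.single w 1))"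
        unfolding E_def tensor_one_def lattice_at_def
        by (rule S.tensor_module_smult[OF \<Lambda> _ w_keys]) (use eS in simp)
      ultimately have "E \<odot>\<^bsub>?T\<^esub> ?w = ?w"
        by simp (simp add: lattice_def)
      then have "K' +>\<^bsub>?T\<^esub> ?w = E \<odot>\<^bsub>V\<^esub> (K' +>\<^bsub>?T\<^esub> ?w)"
        unfolding V by (subst quot_module_smult[OF T_mod K' E wT]) simp
      also have "\<dots> = \<zero>\<^bsub>V\<^esub>" using 0 wT by (auto simp: V_carrier)
      finally have "?w \<in> K'" using coset_eq_iff[OF T_mod K' wT] by (simp add: V_zero)
      then have "carrier ?T \<subseteq> K'" by (rule lattice_at_generated[OF Lv_mod w K'])
      then have "carrier V \<subseteq> {\<zero>\<^bsub>V\<^esub>}"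
        using coset_eq_iff[OF T_mod K'] by (auto simp: V_carrier V_zero)
      then show False using V_ne V.M.zero_closed by blast
    qed
  next
    assume ne: "(\<lambda>x. E \<odot>\<^bsub>V\<^esub> x) ` carrier V \<noteq> {\<zero>\<^bsub>V\<^esub>}"
    show "\<nu> \<in> ?C"
    proof (rule ccontr)
      assume not_padded: "\<nu> \<notin> ?C"
      have "(\<Sum>i=1..n. \<nu> ! (i - 1)) < r"
        using not_padded padded_compositions_iff[OF \<nu> assms(3)]
          sum_prefix_composition_le[OF \<nu> assms(3)] by simp
      moreover have "weight_height n (\<lambda>i. int (degree (Q ! (i - 1)))) = int (\<Sum>i=1..n. \<nu> ! (i - 1))"
        using Q(1) assms(3) unfolding weight_height_def \<nu>_def of_nat_sum by (intro sum.cong) auto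
      ultimately have height: "weight_height n (\<lambda>i. int (degree (Q ! (i - 1)))) < int r"
        by (simp only: of_nat_less_iff)
      have kill: "schur_smult r act Lv e x = \<zero>\<^bsub>Lv\<^esub>" if "x \<in> carrier Lv" for x
        unfolding e_def by (rule corner_kills_low_module[OF assms(3) hw height that])
      have "E \<odot>\<^bsub>V\<^esub> X = \<zero>\<^bsub>V\<^esub>" if X: "X \<in> carrier V" for X
      proof -
        obtain t where t: "t \<in> carrier ?T" "X = K' +>\<^bsub>?T\<^esub> t" using X by (auto simp: V_carrier)
        have "E \<odot>\<^bsub>?T\<^esub> t = \<zero>\<^bsub>?T\<^esub>"
          unfolding E_def by (rule lattice_at_smult_zero[OF Lv_mod w eS kill t(1)])
        then have "E \<odot>\<^bsub>V\<^esub> X = K' +>\<^bsub>?T\<^esub> \<zero>\<^bsub>?T\<^esub>"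
          unfolding V t(2) using quot_module_smult[OF T_mod K' E t(1)] by simp
        also have "\<dots> = K'"
          using coset_eq_iff[OF T_mod K' T.M.zero_closed] K'
            subgroup.one_closed[of K' "add_monoid ?T"] by (simp add: submodule_def)
        finally show ?thesis by (simp add: V_zero)
      qed
      then have "(\<lambda>x. E \<odot>\<^bsub>V\<^esub> x) ` carrier V = {\<zero>\<^bsub>V\<^esub>}"
        using V.M.zero_closed by (auto simp: image_iff)
      with ne show False ..
    qed
  qed
qed

end
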